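(* Let $k=2$, let $B$ be an $R$-order with $C\subseteq B\subseteq C[t^{-1}]$ which is rigid as a $C$-module, where $C=C_{2,n}$, and let $\Pi$ be the associated positroid variety of type $(2,n)$ with open positroid variety $\Pi^\circ$. Then $\mathbb C[\Pi^\circ]$ is generated (as a $\mathbb C$-algebra) by (the restrictions of) $$\{\Delta_I,\ \Delta_J^{-1}:M_I\in\mathrm{GP}\,B,\ M_J\in\mathrm{add}\,B\}.$$
   Context: Let $R=\mathbb C[[t]]$, $0<k<n$. $C=C_{k,n}$ is the $R$-algebra of the quiver with vertices $\mathbb Z_n$ and arrows $x_i:i-1\to i$, $y_i:i\to i-1$, with relations $xy=t=yx$, $x^k=y^{n-k}$ at every vertex. $\mathrm{CM}\,C$ is the category of finitely generated $C$-modules free over $R$. For a $k$-subset $I\subseteq[n]$, $M_I$ is the rank one module with $e_jM_I=R$, $x_i$ acting as $1$ if $i\in I$ and $t$ otherwise, $y_i$ acting as $t$ if $i\in I$ and $1$ otherwise. Rigid means $\mathrm{Ext}^1_C(B,B)=0$. $\mathrm{CM}\,B$ is the category of finitely generated $B$-modules free over $R$, and $\mathrm{GP}\,B=\{M\in\mathrm{CM}\,B:\mathrm{Ext}^1_B(M,B)=0\}$. As a $C$-module $B\cong\bigoplus_{i=1}^nM_{I_i}$ for a Grassmann necklace $\mathcal N=(I_1,\dots,I_n)$ (i.e. $I_i\setminus\{i\}\subseteq I_{i+1}$, indices mod $n$), and this gives a bijection between such $B$ and Grassmann necklaces (equivalently positroids) of type $(k,n)$. The positroid is $\mathsf P=\{J\in\binom{[n]}{k}:I_i\le_iJ\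 \forall i\}$, where $\le_i$ is the termwise order on $k$-subsets from the total order $i<_ii+1<_i\dots<_in<_i1<_i\dots<_ii-1$. $\mathrm{Gr}(k,n)$ is the affine cone over the Grassmannian, with Plücker coordinates $\Delta_I$; $\Pi=\{V\in\mathrm{Gr}(k,n):\Delta_I(V)=0\ \forall I\notin\mathsf P\}$ and $\Pi^\circ=\{V\in\Pi:\Delta_I(V)\ne0\ \forall I\in\mathcal N\}$. *)

theory Defs
  imports
    "HOL-Computational_Algebra.Formal_Laurent_Series"
    "Jordan_Normal_Form.Determinant"
    "HOL-Algebra.Module"
    "HOL-Algebra.QuotRing"
    "HOL-Algebra.Subrings"
begin

section \<open>Modules over a not necessarily commutative ring\<close>

text \<open>
  The locale \<^locale>\<open>module\<close> requires a commutative ring of scalars; here only its record type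
  is reused.  The fields \<open>mult\<close> and \<open>one\<close> of a module record carry no information.
\<close>

locale left_module = R?: ring R + M?: abelian_group M
  for R :: "('a, 'c) ring_scheme" (structure) and M :: "('a, 'b, 'd) module_scheme" (structure) +
  assumes smult_closed: "\<lbrakk>a \<in> carrier R; x \<in> carrier M\<rbrakk> \<Longrightarrow> a \<odot>\<^bsub>M\<^esub> x \<in> carrier M"
    and smult_l_distr: "\<lbrakk>a \<in> carrier R; b \<in> carrier R; x \<in> carrier M\<rbrakk> \<Longrightarrow>
      (a \<oplus> b) \<odot>\<^bsub>M\<^esub> x = a \<odot>\<^bsub>M\<^esub> x \<oplus>\<^bsub>M\<^esub> b \<odot>\<^bsub>M\<^esub> x"
    and smult_r_distr: "\<lbrakk>a \<in> carrier R; x \<in> carrier M; y \<in> carrier M\<rbrakk> \<Longrightarrow>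
      a \<odot>\<^bsub>M\<^esub> (x \<oplus>\<^bsub>M\<^esub> y) = a \<odot>\<^bsub>M\<^esub> x \<oplus>\<^bsub>M\<^esub> a \<odot>\<^bsub>M\<^esub> y"
    and smult_assoc: "\<lbrakk>a \<in> carrier R; b \<in> carrier R; x \<in> carrier M\<rbrakk> \<Longrightarrow>
      (a \<otimes> b) \<odot>\<^bsub>M\<^esub> x = a \<odot>\<^bsub>M\<^esub> (b \<odot>\<^bsub>M\<^esub> x)"
    and smult_one: "x \<in> carrier M \<Longrightarrow> \<one> \<odot>\<^bsub>M\<^esub> x = x"

definition regular_module :: "'a ring \<Rightarrow> ('a, 'a) module" where
  "regular_module R = \<lparr>carrier = carrier R, mult = undefined, one = undefined,
     zero = \<zero>\<^bsub>R\<^esub>, add = add R, smult = mult R\<rparr>"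

definition restrict_scalars :: "('c \<Rightarrow> 'a) \<Rightarrow> ('a, 'b) module \<Rightarrow> ('c, 'b) module" where
  "restrict_scalars \<phi> M = \<lparr>carrier = carrier M, mult = undefined, one = undefined,
     zero = \<zero>\<^bsub>M\<^esub>, add = add M, smult = (\<lambda>c x. \<phi> c \<odot>\<^bsub>M\<^esub> x)\<rparr>"

definition direct_sum_module :: "'i set \<Rightarrow> ('i \<Rightarrow> ('a, 'b) module) \<Rightarrow> ('a, 'i \<Rightarrow> 'b) module" where
  "direct_sum_module S F = \<lparr>carrier = (\<Pi>\<^sub>E i\<in>S. carrier (F i)), mult = undefined, one = undefined,
     zero = (\<lambda>i\<in>S. \<zero>\<^bsub>F i\<^esub>), add = (\<lambda>v w. \<lambda>i\<in>S. v i \<oplus>\<^bsub>F i\<^esub> w i),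
     smult = (\<lambda>a v. \<lambda>i\<in>S. a \<odot>\<^bsub>F i\<^esub> v i)\<rparr>"

definition lmod_hom :: "'a ring \<Rightarrow> ('a, 'b) module \<Rightarrow> ('a, 'c) module \<Rightarrow> ('b \<Rightarrow> 'c) set" where
  "lmod_hom R M N = {f \<in> carrier M \<rightarrow> carrier N.
     (\<forall>x\<in>carrier M. \<forall>y\<in>carrier M. f (x \<oplus>\<^bsub>M\<^esub> y) = f x \<oplus>\<^bsub>N\<^esub> f y) \<and>
     (\<forall>a\<in>carrier R. \<forall>x\<in>carrier M. f (a \<odot>\<^bsub>M\<^esub> x) = a \<odot>\<^bsub>N\<^esub> f x)}"

definition lmod_iso :: "'a ring \<Rightarrow> ('a, 'b) module \<Rightarrow> ('a, 'c) module \<Rightarrow> bool" where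
  "lmod_iso R M N \<longleftrightarrow> (\<exists>f\<in>lmod_hom R M N. bij_betw f (carrier M) (carrier N))"

definition fin_gen_module :: "'a ring \<Rightarrow> ('a, 'b) module \<Rightarrow> bool" where
  "fin_gen_module R M \<longleftrightarrow> (\<exists>S. finite S \<and> S \<subseteq> carrier M \<and>
     (\<forall>x\<in>carrier M. \<exists>c\<in>S \<rightarrow> carrier R. x = (\<Oplus>\<^bsub>M\<^esub>s\<in>S. c s \<odot>\<^bsub>M\<^esub> s)))"

definition free_module :: "'a ring \<Rightarrow> ('a, 'b) module \<Rightarrow> bool" where
  "free_module R M \<longleftrightarrow> (\<exists>S\<subseteq>carrier M. \<forall>x\<in>carrier M. \<exists>!c.
     c \<in> S \<rightarrow>\<^sub>E carrier R \<and> finite {s\<in>S. c s \<noteq> \<zero>\<^bsub>R\<^esub>} \<and>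
     x = (\<Oplus>\<^bsub>M\<^esub>s\<in>{s\<in>S. c s \<noteq> \<zero>\<^bsub>R\<^esub>}. c s \<odot>\<^bsub>M\<^esub> s))"

definition short_exact ::
    "'a ring \<Rightarrow> ('a, 'n) module \<Rightarrow> ('n \<Rightarrow> 'e) \<Rightarrow> ('a, 'e) module \<Rightarrow> ('e \<Rightarrow> 'm) \<Rightarrow> ('a, 'm) module \<Rightarrow> bool" where
  "short_exact R N f E g M \<longleftrightarrow> f \<in> lmod_hom R N E \<and> g \<in> lmod_hom R E M \<and>
     inj_on f (carrier N) \<and> f ` carrier N = {e \<in> carrier E. g e = \<zero>\<^bsub>M\<^esub>} \<and>
     g ` carrier E = carrier M"

text \<open>
  Vanishing of the Yoneda group \<open>Ext\<^sup>1\<^sub>R(M,N)\<close>: all extensions \<open>0 \<rightarrow> N \<rightarrow> E \<rightarrow> M \<rightarrow> 0\<close> split.  The middle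
  term is taken on the type of pairs, which loses no extension since \<open>E\<close> is in bijection with
  \<open>N \<times> M\<close>; see \<open>ext1_vanishes_split\<close> below.
\<close>

definition ext1_vanishes :: "'a ring \<Rightarrow> ('a, 'm) module \<Rightarrow> ('a, 'n) module \<Rightarrow> bool" where
  "ext1_vanishes R M N \<longleftrightarrow> (\<forall>(E :: ('a, 'n \<times> 'm) module) f g.
     left_module R E \<and> short_exact R N f E g M \<longrightarrow>
     (\<exists>s\<in>lmod_hom R M E. \<forall>x\<in>carrier M. g (s x) = x))"

lemma left_module_transport:
  assumes E: "left_module R E" and h: "inj_on h (carrier E)"
  defines "k \<equiv> the_inv_into (carrier E) h"
  shows "left_module R \<lparr>carrier = h ` carrier E, mult = undefined, one = undefined,
     zero = h \<zero>\<^bsub>E\<^esub>, add = (\<lambda>u v. h (k u \<oplus>\<^bsub>E\<^esub> k v)), smult = (\<lambda>a v. h (a \<odot>\<^bsub>E\<^esub> k v))\<rparr>"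
    (is "left_module R ?E")
proof -
  interpret left_module R E by (rule E)
  have k: "k (h e) = e" if "e \<in> carrier E" for e
    unfolding k_def using h that by (rule the_inv_into_f_f)
  have "abelian_group ?E"
  proof (rule abelian_groupI)
    fix x assume "x \<in> carrier ?E"
    then obtain e where e: "e \<in> carrier E" "x = h e" by auto
    then show "\<exists>y\<in>carrier ?E. y \<oplus>\<^bsub>?E\<^esub> x = \<zero>\<^bsub>?E\<^esub>"
      by (intro bexI[of _ "h (\<ominus>\<^bsub>E\<^esub> e)"]) (auto simp: k M.l_neg)
  qed (auto simp: k M.add.m_ac)
  moreover have "left_module_axioms R ?E"
    by unfold_locales
      (auto simp: k smult_closed smult_l_distr smult_r_distr smult_assoc smult_one)
  ultimately show ?thesis
    by (intro left_module.intro) (rule R.ring_axioms)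
qed

lemma ext1_vanishes_split:
  fixes E :: "('a, 'e) module" and M :: "('a, 'm) module" and N :: "('a, 'n) module"
  assumes ext: "ext1_vanishes R M N" and E: "left_module R E" and M: "left_module R M"
    and ses: "short_exact R N f E g M"
  shows "\<exists>s\<in>lmod_hom R M E. \<forall>x\<in>carrier M. g (s x) = x"
proof -
  interpret E: left_module R E by (rule E)
  interpret M: left_module R M by (rule M)
  have f: "f \<in> lmod_hom R N E" "inj_on f (carrier N)"
      "f ` carrier N = {e \<in> carrier E. g e = \<zero>\<^bsub>M\<^esub>}"
    and g: "g \<in> lmod_hom R E M" "g ` carrier E = carrier M"
    using ses by (auto simp: short_exact_def)
  have gadd: "g (x \<oplus>\<^bsub>E\<^esub> y) = g x \<oplus>\<^bsub>M\<^esub> g y" if "x \<in> carrier E" "y \<in> carrier E" for x y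
    using g(1) that by (auto simp: lmod_hom_def)
  have gcl: "g x \<in> carrier M" if "x \<in> carrier E" for x
    using g(1) that by (auto simp: lmod_hom_def)
  define \<sigma> where "\<sigma> = inv_into (carrier E) g"
  have \<sigma>: "\<sigma> x \<in> carrier E" "g (\<sigma> x) = x" if "x \<in> carrier M" for x
    using that g(2) unfolding \<sigma>_def by (auto simp: inv_into_into f_inv_into_f)
  define d where "d e = e \<oplus>\<^bsub>E\<^esub> (\<ominus>\<^bsub>E\<^esub> \<sigma> (g e))" for e
  have d: "d e \<in> f ` carrier N" if e: "e \<in> carrier E" for e
  proof -
    have s: "\<sigma> (g e) \<in> carrier E" "g (\<sigma> (g e)) = g e" using \<sigma> gcl e by auto
    have c: "d e \<in> carrier E" using e s by (simp add: d_def)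
    have "e = d e \<oplus>\<^bsub>E\<^esub> \<sigma> (g e)" using e s by (simp add: d_def E.M.a_assoc E.M.l_neg)
    then have "g e = g (d e) \<oplus>\<^bsub>M\<^esub> g e" using gadd[OF c s(1)] s by simp
    then have "g (d e) = \<zero>\<^bsub>M\<^esub>" using gcl[OF c] gcl[OF e] M.M.add.l_cancel_one'[of "g e" "g (d e)"]
      by simp
    then show ?thesis using c f(3) by auto
  qed
  define h where "h e = (the_inv_into (carrier N) f (d e), g e)" for e
  have h: "inj_on h (carrier E)"
  proof (rule inj_onI)
    fix x y assume xy: "x \<in> carrier E" "y \<in> carrier E" "h x = h y"
    then have "g x = g y" "the_inv_into (carrier N) f (d x) = the_inv_into (carrier N) f (d y)"
      by (auto simp: h_def)
    then have "d x = d y" using d[OF xy(1)] d[OF xy(2)] f(2) by (metis f_the_inv_into_f)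
    then show "x = y" using xy \<open>g x = g y\<close> \<sigma>(1)[OF gcl] by (simp add: d_def)
  qed
  define k where "k = the_inv_into (carrier E) h"
  have k: "k (h e) = e" if "e \<in> carrier E" for e
    unfolding k_def using h that by (rule the_inv_into_f_f)
  let ?E = "\<lparr>carrier = h ` carrier E, mult = undefined, one = undefined,
     zero = h \<zero>\<^bsub>E\<^esub>, add = (\<lambda>u v. h (k u \<oplus>\<^bsub>E\<^esub> k v)), smult = (\<lambda>a v. h (a \<odot>\<^bsub>E\<^esub> k v))\<rparr>
     :: ('a, 'n \<times> 'm) module"
  have "left_module R ?E" unfolding k_def by (rule left_module_transport[OF E h])
  moreover have "short_exact R N (h \<circ> f) ?E (g \<circ> k) M"
  proof -
    have fc: "f x \<in> carrier E" if "x \<in> carrier N" for x using f(1) that by (auto simp: lmod_hom_def)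
    have "(h \<circ> f) \<in> lmod_hom R N ?E"
      using f(1) fc by (auto simp: lmod_hom_def k)
    moreover have "(g \<circ> k) \<in> lmod_hom R ?E M"
      using g(1) by (auto simp: lmod_hom_def k E.smult_closed Pi_iff)
    moreover have "inj_on (h \<circ> f) (carrier N)"
      using f(2) h fc by (auto intro!: comp_inj_on intro: inj_on_subset)
    moreover have "(h \<circ> f) ` carrier N = {e \<in> carrier ?E. (g \<circ> k) e = \<zero>\<^bsub>M\<^esub>}"
      unfolding image_comp[symmetric] f(3) by (auto simp: k)
    moreover have "(g \<circ> k) ` carrier ?E = carrier M"
      using g(2) by (force simp: k image_image)
    ultimately show ?thesis by (simp add: short_exact_def)
  qed
  ultimately obtain s where s: "s \<in> lmod_hom R M ?E" "\<forall>x\<in>carrier M. (g \<circ> k) (s x) = x"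
    using ext unfolding ext1_vanishes_def by blast
  have sc: "s x \<in> h ` carrier E" if "x \<in> carrier M" for x
    using s(1) that by (auto simp: lmod_hom_def)
  have kc: "k (s x) \<in> carrier E" if "x \<in> carrier M" for x
    using sc[OF that] k by auto
  have "k \<circ> s \<in> lmod_hom R M E"
    using s(1) kc by (auto simp: lmod_hom_def k E.smult_closed)
  then show ?thesis using s(2) by (intro bexI[of _ "k \<circ> s"]) auto
qed

text \<open>\<open>add R\<close>: isomorphic to a direct summand of some \<open>R\<^sup>m\<close>.\<close>

definition in_add :: "'a ring \<Rightarrow> ('a, 'b) module \<Rightarrow> bool" where
  "in_add R M \<longleftrightarrow> (\<exists>m P Q. let F = direct_sum_module {..<m::nat} (\<lambda>_. regular_module R) in
     submodule P R F \<and> submodule Q R F \<and> P \<inter> Q = {\<zero>\<^bsub>F\<^esub>} \<and> P <+>\<^bsub>F\<^esub> Q = carrier F \<and>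
     lmod_iso R M (F\<lparr>carrier := P\<rparr>))"


section \<open>The circle algebra\<close>

text \<open>
  The vertex set \<open>\<int>\<^sub>n\<close> is represented by \<open>{1..n}\<close>.  The arrow \<open>X i\<close> goes from \<open>i - 1\<close> to \<open>i\<close>, and
  \<open>Y i\<close> goes back.
\<close>

datatype arrow = X nat | Y nat

definition csucc :: "nat \<Rightarrow> nat \<Rightarrow> nat" where
  "csucc n i = (if i = n then 1 else i + 1)"

definition cpred :: "nat \<Rightarrow> nat \<Rightarrow> nat" where
  "cpred n i = (if i = 1 then n else i - 1)"

fun arrow_index :: "arrow \<Rightarrow> nat" where
  "arrow_index (X i) = i"
| "arrow_index (Y i) = i"

fun arrow_source :: "nat \<Rightarrow> arrow \<Rightarrow> nat" where
  "arrow_source n (X i) = cpred n i"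
| "arrow_source n (Y i) = i"

fun arrow_target :: "nat \<Rightarrow> arrow \<Rightarrow> nat" where
  "arrow_target n (X i) = i"
| "arrow_target n (Y i) = cpred n i"

text \<open>
  A path is a pair of its starting vertex and its word of arrows.  Words are written like
  composites of maps: the last letter is the arrow traversed first.  Thus left modules over the path
  algebra are representations of the quiver.
\<close>

type_synonym qpath = "nat \<times> arrow list"

fun path_end :: "nat \<Rightarrow> qpath \<Rightarrow> nat" where
  "path_end n (j, []) = j"
| "path_end n (j, a # w) = arrow_target n a"

fun is_path :: "nat \<Rightarrow> qpath \<Rightarrow> bool" where
  "is_path n (j, []) \<longleftrightarrow> j \<in> {1..n}"
| "is_path n (j, a # w) \<longleftrightarrow>
     is_path n (j, w) \<and> arrow_index a \<in> {1..n} \<and> arrow_source n a = path_end n (j, w)"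

text \<open>
  The path algebra with coefficients in \<open>'a\<close>.  The product sums over all ways of cutting a path in
  two.
\<close>

definition path_algebra :: "nat \<Rightarrow> (qpath \<Rightarrow> 'a::comm_ring_1) ring" where
  "path_algebra n = \<lparr>carrier = {f. finite {p. f p \<noteq> 0} \<and> (\<forall>p. f p \<noteq> 0 \<longrightarrow> is_path n p)},
     mult = (\<lambda>f g (j, w). \<Sum>m\<le>length w. f (path_end n (j, drop m w), take m w) * g (j, drop m w)),
     one = (\<lambda>(j, w). if w = [] \<and> j \<in> {1..n} then 1 else 0),
     zero = (\<lambda>_. 0),
     add = (\<lambda>f g p. f p + g p)\<rparr>"

definition path_elem :: "qpath \<Rightarrow> qpath \<Rightarrow> 'a::comm_ring_1" where
  "path_elem p = (\<lambda>q. if q = p then 1 else 0)"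

definition x_path :: "nat \<Rightarrow> nat \<Rightarrow> nat \<Rightarrow> qpath" where
  "x_path n j m = (j, rev (map (\<lambda>s. X ((csucc n ^^ Suc s) j)) [0..<m]))"

definition y_path :: "nat \<Rightarrow> nat \<Rightarrow> nat \<Rightarrow> qpath" where
  "y_path n j m = (j, rev (map (\<lambda>s. Y ((cpred n ^^ s) j)) [0..<m]))"

definition circle_relations :: "nat \<Rightarrow> nat \<Rightarrow> 'a::comm_ring_1 \<Rightarrow> (qpath \<Rightarrow> 'a) set" where
  "circle_relations k n t =
     (\<Union>j\<in>{1..n}.
       {\<lambda>p. path_elem (j, [X j, Y j]) p - t * path_elem (j, []) p,
        \<lambda>p. path_elem (j, [Y (csucc n j), X (csucc n j)]) p - t * path_elem (j, []) p,
        \<lambda>p. path_elem (x_path n j k) p - path_elem (y_path n j (n - k)) p})"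

definition circle_ideal :: "nat \<Rightarrow> nat \<Rightarrow> 'a::comm_ring_1 \<Rightarrow> (qpath \<Rightarrow> 'a) set" where
  "circle_ideal k n t = genideal (path_algebra n) (circle_relations k n t)"

definition circle_algebra :: "nat \<Rightarrow> nat \<Rightarrow> 'a::comm_ring_1 \<Rightarrow> (qpath \<Rightarrow> 'a) set ring" where
  "circle_algebra k n t = FactRing (path_algebra n) (circle_ideal k n t)"

text \<open>The ground ring \<open>\<complex>[[t]]\<close>.\<close>

definition fps_ring :: "complex fps ring" where
  "fps_ring = \<lparr>carrier = UNIV, mult = (*), one = 1, zero = 0, add = (+)\<rparr>"

abbreviation Calg :: "nat \<Rightarrow> nat \<Rightarrow> (qpath \<Rightarrow> complex fps) set ring" where
  "Calg k n \<equiv> circle_algebra k n fps_X"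

text \<open>
  \<open>C[t\<^sup>-\<^sup>1] = C \<otimes> \<complex>((t))\<close>: since forming path algebras and quotients by relations commutes with base
  change, this is the algebra with the same quiver and relations over \<open>\<complex>((t))\<close>.
\<close>

abbreviation Cloc :: "nat \<Rightarrow> nat \<Rightarrow> (qpath \<Rightarrow> complex fls) set ring" where
  "Cloc k n \<equiv> circle_algebra k n fls_X"

text \<open>The structure map from the ground ring to \<open>C\<close>, and the localisation map from \<open>C\<close>.\<close>

definition R_to_C :: "nat \<Rightarrow> nat \<Rightarrow> complex fps \<Rightarrow> (qpath \<Rightarrow> complex fps) set" where
  "R_to_C k n r = circle_ideal k n fps_X +>\<^bsub>path_algebra n\<^esub> (\<lambda>p. r * \<one>\<^bsub>path_algebra n\<^esub> p)"

definition C_to_Cloc :: "nat \<Rightarrow> nat \<Rightarrow> (qpath \<Rightarrow> complex fps) set \<Rightarrow> (qpath \<Rightarrow> complex fls) set" where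
  "C_to_Cloc k n c = circle_ideal k n fls_X <+>\<^bsub>path_algebra n\<^esub> ((\<lambda>f. fps_to_fls \<circ> f) ` c)"


section \<open>Orders and their modules\<close>

abbreviation order_ring ::
    "nat \<Rightarrow> nat \<Rightarrow> (qpath \<Rightarrow> complex fls) set set \<Rightarrow> (qpath \<Rightarrow> complex fls) set ring" where
  "order_ring k n B \<equiv> (Cloc k n)\<lparr>carrier := B\<rparr>"

text \<open>
  For a module over an order \<open>B\<close> with \<open>C \<subseteq> B \<subseteq> C[t\<^sup>-\<^sup>1]\<close>: the underlying modules over \<open>C\<close> and
  over \<open>\<complex>[[t]]\<close>.
\<close>

definition as_C_module ::
    "nat \<Rightarrow> nat \<Rightarrow> ((qpath \<Rightarrow> complex fls) set, 'm) module \<Rightarrow> ((qpath \<Rightarrow> complex fps) set, 'm) module" where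
  "as_C_module k n M = restrict_scalars (C_to_Cloc k n) M"

definition as_R_module ::
    "nat \<Rightarrow> nat \<Rightarrow> ((qpath \<Rightarrow> complex fls) set, 'm) module \<Rightarrow> (complex fps, 'm) module" where
  "as_R_module k n M = restrict_scalars (R_to_C k n) (as_C_module k n M)"

definition is_order :: "nat \<Rightarrow> nat \<Rightarrow> (qpath \<Rightarrow> complex fls) set set \<Rightarrow> bool" where
  "is_order k n B \<longleftrightarrow> subring B (Cloc k n) \<and> C_to_Cloc k n ` carrier (Calg k n) \<subseteq> B \<and>
     fin_gen_module fps_ring (as_R_module k n (regular_module (order_ring k n B))) \<and>
     free_module fps_ring (as_R_module k n (regular_module (order_ring k n B)))"

definition rigid_C_module :: "nat \<Rightarrow> nat \<Rightarrow> ((qpath \<Rightarrow> complex fps) set, 'm) module \<Rightarrow> bool" where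
  "rigid_C_module k n M \<longleftrightarrow> ext1_vanishes (Calg k n) M M"

definition in_CM ::
    "nat \<Rightarrow> nat \<Rightarrow> (qpath \<Rightarrow> complex fls) set set \<Rightarrow> ((qpath \<Rightarrow> complex fls) set, 'm) module \<Rightarrow> bool" where
  "in_CM k n B M \<longleftrightarrow> left_module (order_ring k n B) M \<and> fin_gen_module (order_ring k n B) M \<and>
     free_module fps_ring (as_R_module k n M)"

definition in_GP ::
    "nat \<Rightarrow> nat \<Rightarrow> (qpath \<Rightarrow> complex fls) set set \<Rightarrow> ((qpath \<Rightarrow> complex fls) set, 'm) module \<Rightarrow> bool" where
  "in_GP k n B M \<longleftrightarrow> in_CM k n B M \<and>
     ext1_vanishes (order_ring k n B) M (regular_module (order_ring k n B))"


section \<open>Rank one modules\<close>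

definition k_subsets :: "nat \<Rightarrow> nat \<Rightarrow> nat set set" where
  "k_subsets k n = {I. I \<subseteq> {1..n} \<and> card I = k}"

fun arrow_weight :: "nat set \<Rightarrow> arrow \<Rightarrow> complex fps" where
  "arrow_weight I (X i) = (if i \<in> I then 1 else fps_X)"
| "arrow_weight I (Y i) = (if i \<in> I then fps_X else 1)"

definition rank_one_act ::
    "nat \<Rightarrow> nat set \<Rightarrow> (qpath \<Rightarrow> complex fps) \<Rightarrow> (nat \<Rightarrow> complex fps) \<Rightarrow> nat \<Rightarrow> complex fps" where
  "rank_one_act n I f v = (\<lambda>i\<in>{1..n}. \<Sum>p | f p \<noteq> 0 \<and> path_end n p = i.
     f p * prod_list (map (arrow_weight I) (snd p)) * v (fst p))"

text \<open>
  The module \<open>M\<^sub>I\<close>.  For \<open>I\<close> a \<open>k\<close>-subset, the action of the path algebra respects the relations, so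
  the choice of a representative of a class in \<open>C\<close> is immaterial.
\<close>

definition rank_one_module :: "nat \<Rightarrow> nat set \<Rightarrow> ((qpath \<Rightarrow> complex fps) set, nat \<Rightarrow> complex fps) module" where
  "rank_one_module n I = \<lparr>carrier = {1..n} \<rightarrow>\<^sub>E UNIV, mult = undefined, one = undefined,
     zero = (\<lambda>j\<in>{1..n}. 0), add = (\<lambda>v w. \<lambda>j\<in>{1..n}. v j + w j),
     smult = (\<lambda>c v. rank_one_act n I (SOME f. f \<in> c) v)\<rparr>"

text \<open>
  Restriction \<open>CM B \<rightarrow> CM C\<close> is fully faithful, so a \<open>C\<close>-module belongs to a class of \<open>B\<close>-modules
  when it is isomorphic to the restriction of a \<open>B\<close>-module in that class.
\<close>

definition rank_one_in_GP :: "nat \<Rightarrow> nat \<Rightarrow> (qpath \<Rightarrow> complex fls) set set \<Rightarrow> nat set \<Rightarrow> bool" where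
  "rank_one_in_GP k n B I \<longleftrightarrow>
     (\<exists>M :: ((qpath \<Rightarrow> complex fls) set, nat \<Rightarrow> complex fps) module.
        in_GP k n B M \<and> lmod_iso (Calg k n) (rank_one_module n I) (as_C_module k n M))"

definition rank_one_in_add :: "nat \<Rightarrow> nat \<Rightarrow> (qpath \<Rightarrow> complex fls) set set \<Rightarrow> nat set \<Rightarrow> bool" where
  "rank_one_in_add k n B I \<longleftrightarrow>
     (\<exists>M :: ((qpath \<Rightarrow> complex fls) set, nat \<Rightarrow> complex fps) module.
        in_CM k n B M \<and> in_add (order_ring k n B) M \<and>
        lmod_iso (Calg k n) (rank_one_module n I) (as_C_module k n M))"


section \<open>Positroids\<close>

definition grassmann_necklace :: "nat \<Rightarrow> nat \<Rightarrow> (nat \<Rightarrow> nat set) \<Rightarrow> bool" where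
  "grassmann_necklace k n \<I> \<longleftrightarrow>
     (\<forall>i\<in>{1..n}. \<I> i \<in> k_subsets k n \<and> \<I> i - {i} \<subseteq> \<I> (csucc n i))"

definition necklace_of_order ::
    "nat \<Rightarrow> nat \<Rightarrow> (qpath \<Rightarrow> complex fls) set set \<Rightarrow> (nat \<Rightarrow> nat set) \<Rightarrow> bool" where
  "necklace_of_order k n B \<I> \<longleftrightarrow> grassmann_necklace k n \<I> \<and>
     lmod_iso (Calg k n) (as_C_module k n (regular_module (order_ring k n B)))
       (direct_sum_module {1..n} (\<lambda>i. rank_one_module n (\<I> i)))"

text \<open>
  \<open>cyclic_rank n i j\<close> is the position of \<open>j\<close> in the order
  \<open>i <\<^sub>i i + 1 <\<^sub>i \<dots> <\<^sub>i n <\<^sub>i 1 <\<^sub>i \<dots> <\<^sub>i i - 1\<close>.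
\<close>

definition cyclic_rank :: "nat \<Rightarrow> nat \<Rightarrow> nat \<Rightarrow> nat" where
  "cyclic_rank n i j = (j + n - i) mod n"

definition cyclic_le :: "nat \<Rightarrow> nat \<Rightarrow> nat set \<Rightarrow> nat set \<Rightarrow> bool" where
  "cyclic_le n i I J \<longleftrightarrow>
     list_all2 (\<le>) (sorted_list_of_set (cyclic_rank n i ` I)) (sorted_list_of_set (cyclic_rank n i ` J))"

definition positroid :: "nat \<Rightarrow> nat \<Rightarrow> (nat \<Rightarrow> nat set) \<Rightarrow> nat set set" where
  "positroid k n \<I> = {J \<in> k_subsets k n. \<forall>i\<in>{1..n}. cyclic_le n i (\<I> i) J}"


section \<open>Positroid varieties and their coordinate rings\<close>

text \<open>
  The affine cone over the Grassmannian, inside the affine space of all families indexed by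
  \<open>k\<close>-subsets: the vectors of maximal minors of arbitrary \<open>k \<times> n\<close> matrices.  Matrices of rank less
  than \<open>k\<close> give the vertex of the cone.
\<close>

definition Gr_cone :: "nat \<Rightarrow> nat \<Rightarrow> (nat set \<Rightarrow> complex) set" where
  "Gr_cone k n = {V. \<exists>A\<in>carrier_mat k n. V = (\<lambda>I\<in>k_subsets k n.
     det (mat k k (\<lambda>(r, s). A $$ (r, sorted_list_of_set I ! s - 1))))}"

definition Pluecker :: "nat set \<Rightarrow> (nat set \<Rightarrow> complex) \<Rightarrow> complex" where
  "Pluecker I V = V I"

definition positroid_variety :: "nat \<Rightarrow> nat \<Rightarrow> (nat \<Rightarrow> nat set) \<Rightarrow> (nat set \<Rightarrow> complex) set" where
  "positroid_variety k n \<I> =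
     {V \<in> Gr_cone k n. \<forall>I\<in>k_subsets k n - positroid k n \<I>. Pluecker I V = 0}"

definition open_positroid_variety :: "nat \<Rightarrow> nat \<Rightarrow> (nat \<Rightarrow> nat set) \<Rightarrow> (nat set \<Rightarrow> complex) set" where
  "open_positroid_variety k n \<I> =
     {V \<in> positroid_variety k n \<I>. \<forall>i\<in>{1..n}. Pluecker (\<I> i) V \<noteq> 0}"

text \<open>
  The \<open>\<complex>\<close>-algebra of functions on \<open>D\<close> generated by the restrictions to \<open>D\<close> of the functions in \<open>S\<close>.
  Functions on \<open>D\<close> are represented by their extensional versions.
\<close>

inductive_set generated_algebra :: "'v set \<Rightarrow> ('v \<Rightarrow> complex) set \<Rightarrow> ('v \<Rightarrow> complex) set"
  for D S where
  const: "(\<lambda>V\<in>D. c) \<in> generated_algebra D S"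
| gen: "f \<in> S \<Longrightarrow> restrict f D \<in> generated_algebra D S"
| add: "f \<in> generated_algebra D S \<Longrightarrow> g \<in> generated_algebra D S \<Longrightarrow>
    (\<lambda>V\<in>D. f V + g V) \<in> generated_algebra D S"
| mult: "f \<in> generated_algebra D S \<Longrightarrow> g \<in> generated_algebra D S \<Longrightarrow>
    (\<lambda>V\<in>D. f V * g V) \<in> generated_algebra D S"

text \<open>
  \<open>\<complex>[\<Pi>]\<close>, for the closed subvariety \<open>\<Pi>\<close> of affine space, consists of the polynomial functions in the
  coordinates; \<open>\<Pi>\<^sup>\<circ>\<close> is the principal open subset where \<open>\<Prod>\<^sub>I \<Delta>\<^sub>I\<close>, with \<open>I\<close> in the necklace, does not
  vanish, so \<open>\<complex>[\<Pi>\<^sup>\<circ>]\<close> is the localisation of \<open>\<complex>[\<Pi>]\<close> at this function.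
\<close>

definition coord_ring_positroid :: "nat \<Rightarrow> nat \<Rightarrow> (nat \<Rightarrow> nat set) \<Rightarrow> ((nat set \<Rightarrow> complex) \<Rightarrow> complex) set" where
  "coord_ring_positroid k n \<I> =
     generated_algebra (positroid_variety k n \<I>) (Pluecker ` k_subsets k n)"

definition coord_ring_open_positroid ::
    "nat \<Rightarrow> nat \<Rightarrow> (nat \<Rightarrow> nat set) \<Rightarrow> ((nat set \<Rightarrow> complex) \<Rightarrow> complex) set" where
  "coord_ring_open_positroid k n \<I> =
     {\<lambda>V\<in>open_positroid_variety k n \<I>. f V / (\<Prod>I\<in>\<I> ` {1..n}. Pluecker I V) ^ m | f m.
        f \<in> coord_ring_positroid k n \<I>}"

end

theory Submission
  imports Defs
begin

text \<open>
  Write \<open>\<I> i = {p, q}\<close> with \<open>p <\<^sub>i q\<close>; then \<open>\<I> p = {p, q}\<close>, and on \<open>\<Pi>\<close> every column strictly between \<open>p\<close>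
  and \<open>q\<close> is parallel to the column \<open>p\<close>.  If \<open>{a, b}\<close> crosses \<open>{p, q}\<close>, with \<open>a\<close> between \<open>p\<close> and \<open>q\<close>, then
  the Pluecker relation gives \<open>\<Delta>\<^bsub>{a,b}\<^esub> \<Delta>\<^bsub>{p,q}\<^esub> = \<plusminus> \<Delta>\<^bsub>{p,b}\<^esub> \<Delta>\<^bsub>{a,q}\<^esub>\<close>, where \<open>{a, q} = \<I> a\<close>.  Hence all Pluecker
  coordinates are obtained from those of the necklace, their inverses, and the \<open>\<Delta>\<^sub>I\<close> for which \<open>I\<close> lies in
  the positroid and crosses no element of the necklace.  For such \<open>I\<close> the module \<open>M\<^sub>I\<close> is a quotient
  of \<open>B\<close>, and \<open>Ext\<^sup>1\<^sub>C(M\<^sub>I, M\<^sub>J) = 0\<close> for all \<open>J\<close> in the necklace.  As \<open>B\<close>-linear and \<open>C\<close>-linear maps between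
  torsion-free modules agree, \<open>M\<^sub>I\<close> is in \<open>GP B\<close>.  Finally \<open>M\<^sub>J\<close> is in \<open>add B\<close> only if \<open>J\<close> is in the necklace,
  since the endomorphism ring \<open>\<complex>[[t]]\<close> of \<open>M\<^sub>J\<close> is local.
\<close>

section \<open>The path algebra\<close>

text \<open>Elements of C are cosets, and \<open>rank_one_module\<close> acts through a chosen
  representative, so all computations take place over the path algebra A that surjects onto C;
  linearity over A and over C agree. Of B next to nothing is explicit, except that t^N b comes from
  A for large N. Every return from A to B therefore rests on torsion-freeness, also of the middle
  term of an extension, and splittings have to be found over A only.

  Noncrossing enters as follows. M_{a,b} has generators at the vertices a - 1 and b - 1 and two
  relations, at a and at b, of which the first implies the second in torsion-free modules. An
  extension by M_J thus has a single obstruction, a power series at the vertex a, to be written as a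
  value of x plus a value of y^(b-1-a); this can fail only if J crosses {a,b}. For I in the necklace
  no such computation is made: M_I is a summand of B, hence projective.

  The two kinds of generators are treated unequally: every \<Delta>_I is regular on the open
  positroid variety, so it is enough to find sufficiently many I in GP B, whereas the rank one
  modules in add B must be listed exactly.\<close>

lemma csucc_mem: "i \<in> {1..n} \<Longrightarrow> csucc n i \<in> {1..n}"
  by (auto simp: csucc_def)

lemma cpred_mem: "i \<in> {1..n} \<Longrightarrow> cpred n i \<in> {1..n}"
  by (auto simp: cpred_def)

lemma csucc_cpred: "i \<in> {1..n} \<Longrightarrow> csucc n (cpred n i) = i"
  by (auto simp: csucc_def cpred_def)

lemma cpred_csucc: "i \<in> {1..n} \<Longrightarrow> cpred n (csucc n i) = i"
  by (auto simp: csucc_def cpred_def)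

lemma path_end_mem: "is_path n p \<Longrightarrow> path_end n p \<in> {1..n}"
proof (induction p rule: is_path.induct)
  case (2 n j a w)
  then show ?case by (cases a) (auto simp del: atLeastAtMost_iff One_nat_def intro: cpred_mem)
qed auto

lemma path_start_mem: "is_path n p \<Longrightarrow> fst p \<in> {1..n}"
  by (induction p rule: is_path.induct) auto

lemma path_end_append: "path_end n (j, w @ w') = path_end n (path_end n (j, w'), w)"
  by (cases w) auto

lemma is_path_append:
  "is_path n (j, w @ w') \<longleftrightarrow> is_path n (j, w') \<and> is_path n (path_end n (j, w'), w)"
proof (induction w)
  case Nil
  then show ?case using path_end_mem[of n "(j, w')"] by auto
next
  case (Cons a w)
  then show ?case by (auto simp: path_end_append)
qed

section \<open>Ring structure of the path algebra\<close>

lemma path_algebra_simps: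
  "\<zero>\<^bsub>path_algebra n\<^esub> = (\<lambda>_. 0)"
  "f \<oplus>\<^bsub>path_algebra n\<^esub> g = (\<lambda>p. f p + g p)"
  "\<one>\<^bsub>path_algebra n\<^esub> = (\<lambda>(j, w). if w = [] \<and> j \<in> {1..n} then 1 else 0)"
  by (simp_all add: path_algebra_def)

lemma path_algebra_mult:
  "(f \<otimes>\<^bsub>path_algebra n\<^esub> g) (j, w) =
     (\<Sum>m\<le>length w. f (path_end n (j, drop m w), take m w) * g (j, drop m w))"
  by (simp add: path_algebra_def)

lemma path_algebra_carrier:
  "f \<in> carrier (path_algebra n) \<longleftrightarrow> finite {p. f p \<noteq> 0} \<and> (\<forall>p. f p \<noteq> 0 \<longrightarrow> is_path n p)"
  by (simp add: path_algebra_def)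

lemma path_algebra_nonpath: "f \<in> carrier (path_algebra n) \<Longrightarrow> \<not> is_path n p \<Longrightarrow> f p = 0"
  by (cases p) (auto simp: path_algebra_carrier)

lemma path_algebra_mult_closed:
  fixes f g :: "qpath \<Rightarrow> 'a::comm_ring_1"
  assumes f: "f \<in> carrier (path_algebra n)" and g: "g \<in> carrier (path_algebra n)"
  shows "f \<otimes>\<^bsub>path_algebra n\<^esub> g \<in> carrier (path_algebra n)"
proof -
  let ?S = "(\<lambda>(p, q). (fst q, snd p @ snd q)) ` ({p. f p \<noteq> 0} \<times> {q. g q \<noteq> 0})"
  have *: "\<exists>m\<le>length w. f (path_end n (j, drop m w), take m w) \<noteq> 0 \<and> g (j, drop m w) \<noteq> 0"
    if "(f \<otimes>\<^bsub>path_algebra n\<^esub> g) (j, w) \<noteq> 0" for j w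
  proof (rule ccontr)
    assume "\<not> ?thesis"
    then have "(f \<otimes>\<^bsub>path_algebra n\<^esub> g) (j, w) = 0"
      unfolding path_algebra_mult by (intro sum.neutral) auto
    then show False using that by simp
  qed
  have "{p. (f \<otimes>\<^bsub>path_algebra n\<^esub> g) p \<noteq> 0} \<subseteq> ?S"
  proof safe
    fix j w assume "(f \<otimes>\<^bsub>path_algebra n\<^esub> g) (j, w) \<noteq> 0"
    then obtain m where "f (path_end n (j, drop m w), take m w) \<noteq> 0" "g (j, drop m w) \<noteq> 0"
      using * by blast
    then show "(j, w) \<in> ?S"
      by (intro image_eqI[of _ _ "((path_end n (j, drop m w), take m w), (j, drop m w))"]) auto
  qed
  moreover have "finite ?S"
    using f g by (auto simp: path_algebra_carrier)
  moreover have "is_path n p" if "(f \<otimes>\<^bsub>path_algebra n\<^esub> g) p \<noteq> 0" for p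
  proof (cases p)
    case (Pair j w)
    with * that obtain m where m: "f (path_end n (j, drop m w), take m w) \<noteq> 0" "g (j, drop m w) \<noteq> 0"
      by blast
    then have "is_path n (path_end n (j, drop m w), take m w)" "is_path n (j, drop m w)"
      using f g by (auto simp: path_algebra_carrier)
    then show ?thesis using is_path_append[of n j "take m w" "drop m w"] Pair by simp
  qed
  ultimately show ?thesis
    by (auto simp: path_algebra_carrier intro: finite_subset)
qed

text \<open>Both sides are sums over pairs of cut points l \<le> m of the word; they differ only in
  which cut is summed over first. The fact \<open>e\<close> says that the vertex reached at the
  inner cut is the same whether one walks the whole tail at once or in two pieces.\<close>

lemma path_algebra_assoc:
  fixes f g h :: "qpath \<Rightarrow> 'a::comm_ring_1"
  shows "(f \<otimes>\<^bsub>path_algebra n\<^esub> g) \<otimes>\<^bsub>path_algebra n\<^esub> h = f \<otimes>\<^bsub>path_algebra n\<^esub> (g \<otimes>\<^bsub>path_algebra n\<^esub> h)"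
proof
  fix p :: qpath
  obtain j w where p: "p = (j, w)" by (cases p)
  let ?e = "\<lambda>m. path_end n (j, drop m w)"
  let ?t = "\<lambda>l m. f (?e l, take l w) * g (?e m, drop l (take m w)) * h (j, drop m w)"
  have e: "path_end n (?e m, drop l (take m w)) = ?e l" if "l \<le> m" for l m
  proof -
    have "drop l (take m w) @ drop m w = drop l w"
      using that by (metis append_take_drop_id drop_drop drop_take le_add_diff_inverse2)
    then show ?thesis by (metis path_end_append)
  qed
  have "((f \<otimes>\<^bsub>path_algebra n\<^esub> g) \<otimes>\<^bsub>path_algebra n\<^esub> h) p = (\<Sum>m\<le>length w. \<Sum>l\<le>m. ?t l m)"
    unfolding p path_algebra_mult sum_distrib_right
    by (intro sum.cong refl) (auto simp: e min_def)
  also have "\<dots> = (\<Sum>l\<le>length w. \<Sum>m=l..length w. ?t l m)"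
    unfolding sum.Sigma[OF finite_atMost ballI[OF finite_atMost]]
      sum.Sigma[OF finite_atMost ballI[OF finite_atLeastAtMost]]
    by (rule sum.reindex_bij_witness[of _ "\<lambda>x. (snd x, fst x)" "\<lambda>x. (snd x, fst x)"]) auto
  also have "\<dots> = (\<Sum>l\<le>length w. \<Sum>m\<le>length w - l. ?t l (l + m))"
  proof (rule sum.cong[OF refl])
    fix l assume "l \<in> {..length w}"
    then show "(\<Sum>m=l..length w. ?t l m) = (\<Sum>m\<le>length w - l. ?t l (l + m))"
      by (intro sum.reindex_bij_witness[of _ "\<lambda>m. l + m" "\<lambda>m. m - l"]) auto
  qed
  also have "\<dots> = (f \<otimes>\<^bsub>path_algebra n\<^esub> (g \<otimes>\<^bsub>path_algebra n\<^esub> h)) p"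
    unfolding p path_algebra_mult sum_distrib_left
    by (intro sum.cong refl) (auto simp: add.commute mult.assoc drop_take)
  finally show "((f \<otimes>\<^bsub>path_algebra n\<^esub> g) \<otimes>\<^bsub>path_algebra n\<^esub> h) p
    = (f \<otimes>\<^bsub>path_algebra n\<^esub> (g \<otimes>\<^bsub>path_algebra n\<^esub> h)) p" .
qed

lemma path_algebra_l_one:
  assumes "g \<in> carrier (path_algebra n)"
  shows "\<one>\<^bsub>path_algebra n\<^esub> \<otimes>\<^bsub>path_algebra n\<^esub> g = g"
proof
  fix p :: qpath
  obtain j w where p: "p = (j, w)" by (cases p)
  have "(\<one>\<^bsub>path_algebra n\<^esub> \<otimes>\<^bsub>path_algebra n\<^esub> g) p =
      (\<Sum>m\<in>{0}. (if take m w = [] \<and> path_end n (j, drop m w) \<in> {1..n} then 1 else 0) * g (j, drop m w))"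
    unfolding p path_algebra_mult path_algebra_simps
    by (rule sum.mono_neutral_cong_right) auto
  also have "\<dots> = g p"
    using path_end_mem[of n p] path_algebra_nonpath[OF assms, of p] by (auto simp: p)
  finally show "(\<one>\<^bsub>path_algebra n\<^esub> \<otimes>\<^bsub>path_algebra n\<^esub> g) p = g p" .
qed

lemma path_algebra_r_one:
  assumes "g \<in> carrier (path_algebra n)"
  shows "g \<otimes>\<^bsub>path_algebra n\<^esub> \<one>\<^bsub>path_algebra n\<^esub> = g"
proof
  fix p :: qpath
  obtain j w where p: "p = (j, w)" by (cases p)
  have "(g \<otimes>\<^bsub>path_algebra n\<^esub> \<one>\<^bsub>path_algebra n\<^esub>) p =
      (\<Sum>m\<in>{length w}. g (path_end n (j, drop m w), take m w) * (if drop m w = [] \<and> j \<in> {1..n} then 1 else 0))"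
    unfolding p path_algebra_mult path_algebra_simps
    by (rule sum.mono_neutral_cong_right) auto
  also have "\<dots> = g p"
    using path_start_mem[of n p] path_algebra_nonpath[OF assms, of p] by (auto simp: p)
  finally show "(g \<otimes>\<^bsub>path_algebra n\<^esub> \<one>\<^bsub>path_algebra n\<^esub>) p = g p" .
qed

lemma path_algebra_lincomb_closed:
  assumes f: "f \<in> carrier (path_algebra n)" and g: "g \<in> carrier (path_algebra n)"
  shows "(\<lambda>p. r * f p + s * g p) \<in> carrier (path_algebra n)"
proof -
  have "{p. r * f p + s * g p \<noteq> 0} \<subseteq> {p. f p \<noteq> 0} \<union> {p. g p \<noteq> 0}" by auto
  then show ?thesis using f g by (auto simp: path_algebra_carrier intro: finite_subset)
qed

lemma path_algebra_zero_closed: "(\<lambda>_. 0) \<in> carrier (path_algebra n)"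
  by (simp add: path_algebra_carrier)

lemma path_algebra_one_closed: "\<one>\<^bsub>path_algebra n\<^esub> \<in> carrier (path_algebra n)"
proof -
  have "{p. \<one>\<^bsub>path_algebra n\<^esub> p \<noteq> (0 :: 'a :: comm_ring_1)} \<subseteq> (\<lambda>j. (j, [])) ` {1..n}"
    by (auto simp: path_algebra_simps split: if_splits)
  then show ?thesis
    by (auto simp: path_algebra_carrier path_algebra_simps split: if_splits intro: finite_subset)
qed

lemma ring_path_algebra: "ring (path_algebra n :: (qpath \<Rightarrow> 'a::comm_ring_1) ring)"
  (is "ring ?A")
proof (rule ringI)
  note simps = path_algebra_simps
  have lin: "(\<lambda>p. f p + g p) \<in> carrier ?A" "(\<lambda>p. - f p) \<in> carrier ?A"
    if "f \<in> carrier ?A" "g \<in> carrier ?A" for f g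
    using path_algebra_lincomb_closed[OF that, of 1 1] path_algebra_lincomb_closed[OF that, of "-1" 0]
    by simp_all
  show "abelian_group ?A"
  proof (rule abelian_groupI)
    fix f assume f: "f \<in> carrier ?A"
    show "\<exists>y\<in>carrier ?A. y \<oplus>\<^bsub>?A\<^esub> f = \<zero>\<^bsub>?A\<^esub>"
      by (rule bexI[of _ "\<lambda>p. - f p"]) (use lin f in \<open>auto simp: simps\<close>)
  qed (use lin path_algebra_zero_closed in \<open>auto simp: simps algebra_simps\<close>)
  show "monoid ?A"
    by (rule monoidI) (auto simp: path_algebra_one_closed path_algebra_mult_closed
        path_algebra_assoc path_algebra_l_one path_algebra_r_one)
qed (auto simp: path_algebra_simps path_algebra_mult fun_eq_iff sum.distrib algebra_simps)

subsection \<open>Generators\<close>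

definition scal :: "nat \<Rightarrow> 'a::comm_ring_1 \<Rightarrow> qpath \<Rightarrow> 'a" where
  "scal n r = (\<lambda>p. r * \<one>\<^bsub>path_algebra n\<^esub> p)"

text \<open>The element x of the path algebra, the sum of all arrows x_i. Together with y below it
  replaces the individual arrows, which are recovered by multiplying with trivial paths.\<close>

definition x_sum :: "nat \<Rightarrow> qpath \<Rightarrow> 'a::comm_ring_1" where
  "x_sum n = (\<lambda>(j, w). if j \<in> {1..n} \<and> w = [X (csucc n j)] then 1 else 0)"

definition y_sum :: "nat \<Rightarrow> qpath \<Rightarrow> 'a::comm_ring_1" where
  "y_sum n = (\<lambda>(j, w). if j \<in> {1..n} \<and> w = [Y j] then 1 else 0)"

lemma scal_closed: "scal n r \<in> carrier (path_algebra n)"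
  using path_algebra_lincomb_closed[OF path_algebra_one_closed path_algebra_one_closed, where r=r and s=0]
  by (simp add: scal_def)

lemma path_elem_closed: "is_path n p \<Longrightarrow> path_elem p \<in> carrier (path_algebra n)"
  by (auto simp: path_algebra_carrier path_elem_def)

lemma x_sum_closed: "x_sum n \<in> carrier (path_algebra n)"
proof -
  have "{p. x_sum n p \<noteq> (0::'a)} \<subseteq> (\<lambda>j. (j, [X (csucc n j)])) ` {1..n}"
    by (auto simp: x_sum_def split: if_splits)
  moreover have "is_path n p" if "x_sum n p \<noteq> (0::'a)" for p
    using that csucc_mem[of "fst p" n] cpred_csucc[of "fst p" n]
    by (cases p) (auto simp: x_sum_def simp del: One_nat_def split: if_splits)
  ultimately show ?thesis by (auto simp: path_algebra_carrier intro: finite_subset)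
qed

lemma y_sum_closed: "y_sum n \<in> carrier (path_algebra n)"
proof -
  have "{p. y_sum n p \<noteq> (0::'a)} \<subseteq> (\<lambda>j. (j, [Y j])) ` {1..n}"
    by (auto simp: y_sum_def split: if_splits)
  then show ?thesis
    by (auto simp: path_algebra_carrier y_sum_def split: if_splits intro: finite_subset)
qed

lemma scal_mult:
  assumes "g \<in> carrier (path_algebra n)"
  shows "scal n r \<otimes>\<^bsub>path_algebra n\<^esub> g = (\<lambda>p. r * g p)"
    "g \<otimes>\<^bsub>path_algebra n\<^esub> scal n r = (\<lambda>p. r * g p)"
proof -
  have "(scal n r \<otimes>\<^bsub>path_algebra n\<^esub> g) (j, w) = r * (\<one>\<^bsub>path_algebra n\<^esub> \<otimes>\<^bsub>path_algebra n\<^esub> g) (j, w)" for j w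
    unfolding path_algebra_mult by (simp add: scal_def sum_distrib_left mult.assoc)
  then show "scal n r \<otimes>\<^bsub>path_algebra n\<^esub> g = (\<lambda>p. r * g p)"
    using path_algebra_l_one[OF assms] by auto
  have "(g \<otimes>\<^bsub>path_algebra n\<^esub> scal n r) (j, w) = r * (g \<otimes>\<^bsub>path_algebra n\<^esub> \<one>\<^bsub>path_algebra n\<^esub>) (j, w)" for j w
    unfolding path_algebra_mult by (simp add: scal_def sum_distrib_left algebra_simps)
  then show "g \<otimes>\<^bsub>path_algebra n\<^esub> scal n r = (\<lambda>p. r * g p)"
    using path_algebra_r_one[OF assms] by auto
qed

text \<open>Since s lives on words of length one, only the cut after the first letter contributes.
  In both uses below \<open>a j\<close> is the arrow of its kind that leaves j, so multiplication by
  s prolongs every path by one step.\<close>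

lemma arrow_sum_mult:
  assumes "\<And>j w. s (j, w) = (if j \<in> {1..n} \<and> w = [a j] then 1 else 0)"
  shows "(s \<otimes>\<^bsub>path_algebra n\<^esub> g) (j, w) =
    (case w of [] \<Rightarrow> 0 | b # w' \<Rightarrow>
       if path_end n (j, w') \<in> {1..n} \<and> b = a (path_end n (j, w')) then g (j, w') else 0)"
proof (cases w)
  case Nil
  then show ?thesis by (simp add: path_algebra_mult assms)
next
  case (Cons b w')
  have "(s \<otimes>\<^bsub>path_algebra n\<^esub> g) (j, w) =
      (\<Sum>m\<in>{1}. s (path_end n (j, drop m w), take m w) * g (j, drop m w))"
    unfolding path_algebra_mult
  proof (rule sum.mono_neutral_right)
    show "\<forall>m\<in>{..length w} - {1}. s (path_end n (j, drop m w), take m w) * g (j, drop m w) = 0"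
    proof
      fix m assume m: "m \<in> {..length w} - {1}"
      then have "length (take m w) \<noteq> length [a (path_end n (j, drop m w))]" by auto
      then have "take m w \<noteq> [a (path_end n (j, drop m w))]" by metis
      then show "s (path_end n (j, drop m w), take m w) * g (j, drop m w) = 0" by (simp add: assms)
    qed
  qed (auto simp: Cons)
  then show ?thesis by (auto simp: Cons assms)
qed

lemmas x_sum_mult = arrow_sum_mult[of "x_sum n" n "\<lambda>j. X (csucc n j)" for n, unfolded x_sum_def prod.case, OF refl,
    folded x_sum_def]
  and y_sum_mult = arrow_sum_mult[of "y_sum n" n Y for n, unfolded y_sum_def prod.case, OF refl,
    folded y_sum_def]

lemma x_sum_path_elem:
  assumes "is_path n (j, w)"
  shows "x_sum n \<otimes>\<^bsub>path_algebra n\<^esub> path_elem (j, w) = path_elem (j, X (csucc n (path_end n (j, w))) # w)"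
  using path_end_mem[OF assms] by (auto simp: fun_eq_iff x_sum_mult path_elem_def split: list.split)

lemma y_sum_path_elem:
  assumes "is_path n (j, w)"
  shows "y_sum n \<otimes>\<^bsub>path_algebra n\<^esub> path_elem (j, w) = path_elem (j, Y (path_end n (j, w)) # w)"
  using path_end_mem[OF assms] by (auto simp: fun_eq_iff y_sum_mult path_elem_def split: list.split)

lemma trivial_path_mult:
  assumes "j \<in> {1..n}"
  shows "(path_elem (j, []) \<otimes>\<^bsub>path_algebra n\<^esub> g) p = (if path_end n p = j then g p else 0)"
proof -
  obtain i w where p: "p = (i, w)" by (cases p)
  have "(path_elem (j, []) \<otimes>\<^bsub>path_algebra n\<^esub> g) p =
      (\<Sum>m\<in>{0}. path_elem (j, []) (path_end n (i, drop m w), take m w) * g (i, drop m w))"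
    unfolding p path_algebra_mult by (rule sum.mono_neutral_right) (auto simp: path_elem_def)
  then show ?thesis by (auto simp: p path_elem_def)
qed

text \<open>Exactly one x-arrow and one y-arrow leave each vertex. Hence every path arises from a
  trivial one by repeated multiplication with x and y, and every element, having finite support, is
  a combination of paths. This reduces multiplicativity of the action on M_I and linearity of maps
  to four kinds of generators.\<close>

lemma path_algebra_induct [consumes 1, case_names scal idem x y add mult]:
  fixes f :: "qpath \<Rightarrow> 'a::comm_ring_1"
  assumes f: "f \<in> carrier (path_algebra n)"
    and scal: "\<And>r. P (scal n r)"
    and idem: "\<And>j. j \<in> {1..n} \<Longrightarrow> P (path_elem (j, []))"
    and x: "P (x_sum n)" and y: "P (y_sum n)"
    and add: "\<And>f g. f \<in> carrier (path_algebra n) \<Longrightarrow> g \<in> carrier (path_algebra n) \<Longrightarrow> P f \<Longrightarrow> P g \<Longrightarrow>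
      P (f \<oplus>\<^bsub>path_algebra n\<^esub> g)"
    and mult: "\<And>f g. f \<in> carrier (path_algebra n) \<Longrightarrow> g \<in> carrier (path_algebra n) \<Longrightarrow> P f \<Longrightarrow> P g \<Longrightarrow>
      P (f \<otimes>\<^bsub>path_algebra n\<^esub> g)"
  shows "P f"
proof -
  have path: "P (path_elem (j, w))" if "is_path n (j, w)" for j w
    using that
  proof (induction w)
    case Nil
    then show ?case using idem by simp
  next
    case (Cons a w)
    then have w: "is_path n (j, w)" and a: "arrow_index a \<in> {1..n}" "arrow_source n a = path_end n (j, w)"
      by auto
    note c = path_elem_closed[OF w] x_sum_closed[of n] y_sum_closed[of n]
    show ?case
    proof (cases a)
      case (X i)
      then have "i = csucc n (path_end n (j, w))" using a csucc_cpred[of i n] by (simp del: One_nat_def)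
      then show ?thesis using mult[OF c(2,1) x] Cons.IH w x_sum_path_elem[OF w, where 'a='a] X by simp
    next
      case (Y i)
      then show ?thesis using mult[OF c(3,1) y] Cons.IH w a y_sum_path_elem[OF w, where 'a='a] by simp
    qed
  qed
  have "P f" if "finite S" "{p. f p \<noteq> 0} \<subseteq> S" "\<And>p. f p \<noteq> 0 \<Longrightarrow> is_path n p" for S f
    using that
  proof (induction S arbitrary: f)
    case empty
    then have "f = scal n 0" by (auto simp: scal_def)
    then show ?case using scal by simp
  next
    case (insert p S)
    let ?g = "f(p := 0)"
    have g: "P ?g" using insert.prems by (intro insert.IH) (auto split: if_splits)
    show ?case
    proof (cases "f p = 0")
      case True
      then have "?g = f" by auto
      then show ?thesis using g by simp
    next
      case False
      have p: "is_path n p" using insert.prems False by blast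
      have fin: "finite {q. f q \<noteq> 0}"
        using finite_subset[OF insert.prems(1)] insert.hyps by simp
      have gc: "?g \<in> carrier (path_algebra n)"
        using insert.prems by (auto simp: path_algebra_carrier intro: finite_subset[OF _ fin])
      note pc = path_elem_closed[OF p]
      have "P (scal n (f p) \<otimes>\<^bsub>path_algebra n\<^esub> path_elem p)"
        using mult[OF scal_closed pc scal] path[of "fst p" "snd p"] p by simp
      then have "P ((scal n (f p) \<otimes>\<^bsub>path_algebra n\<^esub> path_elem p) \<oplus>\<^bsub>path_algebra n\<^esub> ?g)"
        using g gc pc scal_closed path_algebra_mult_closed add by blast
      also have "(scal n (f p) \<otimes>\<^bsub>path_algebra n\<^esub> path_elem p) \<oplus>\<^bsub>path_algebra n\<^esub> ?g = f"
        unfolding scal_mult[OF pc] by (auto simp: path_algebra_simps path_elem_def)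
      finally show ?thesis .
    qed
  qed
  then show ?thesis using f by (auto simp: path_algebra_carrier)
qed

section \<open>Generalities on left modules\<close>

context left_module begin

lemma smult_l_null: "x \<in> carrier M \<Longrightarrow> \<zero> \<odot>\<^bsub>M\<^esub> x = \<zero>\<^bsub>M\<^esub>"
  using smult_l_distr[of \<zero> \<zero> x] M.add.l_cancel_one'[of "\<zero> \<odot>\<^bsub>M\<^esub> x" "\<zero> \<odot>\<^bsub>M\<^esub> x"] smult_closed[of \<zero> x]
  by simp

lemma smult_r_null: "a \<in> carrier R \<Longrightarrow> a \<odot>\<^bsub>M\<^esub> \<zero>\<^bsub>M\<^esub> = \<zero>\<^bsub>M\<^esub>"
  using smult_r_distr[of a "\<zero>\<^bsub>M\<^esub>" "\<zero>\<^bsub>M\<^esub>"] M.add.l_cancel_one'[of "a \<odot>\<^bsub>M\<^esub> \<zero>\<^bsub>M\<^esub>" "a \<odot>\<^bsub>M\<^esub> \<zero>\<^bsub>M\<^esub>"]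
    smult_closed[of a "\<zero>\<^bsub>M\<^esub>"]
  by simp

lemma smult_r_minus: "a \<in> carrier R \<Longrightarrow> x \<in> carrier M \<Longrightarrow> a \<odot>\<^bsub>M\<^esub> (\<ominus>\<^bsub>M\<^esub> x) = \<ominus>\<^bsub>M\<^esub> (a \<odot>\<^bsub>M\<^esub> x)"
  by (rule M.minus_equality[symmetric])
    (auto simp: smult_closed smult_r_distr[symmetric] smult_r_null M.l_neg)

lemma smult_l_minus: "a \<in> carrier R \<Longrightarrow> x \<in> carrier M \<Longrightarrow> (\<ominus> a) \<odot>\<^bsub>M\<^esub> x = \<ominus>\<^bsub>M\<^esub> (a \<odot>\<^bsub>M\<^esub> x)"
  by (rule M.minus_equality[symmetric])
    (auto simp: smult_closed smult_l_distr[symmetric] smult_l_null R.l_neg)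

text \<open>Two-sidedness is what allows relations to be tested on generators: an annihilator that
  contains the circle relations contains the whole circle ideal.\<close>

lemma annihilator_ideal: "ideal {a \<in> carrier R. \<forall>x\<in>carrier M. a \<odot>\<^bsub>M\<^esub> x = \<zero>\<^bsub>M\<^esub>} R" (is "ideal ?I R")
proof (rule idealI)
  show "ring R" by (rule R.ring_axioms)
  show "subgroup ?I (add_monoid R)"
    by (rule R.add.subgroupI)
      (auto simp: smult_l_distr smult_l_null smult_l_minus simp flip: a_inv_def intro!: exI[of _ \<zero>])
qed (auto simp: smult_assoc smult_r_null smult_closed)

end

lemma restrict_scalars_simps:
  "carrier (restrict_scalars h M) = carrier M"
  "\<zero>\<^bsub>restrict_scalars h M\<^esub> = \<zero>\<^bsub>M\<^esub>"
  "x \<oplus>\<^bsub>restrict_scalars h M\<^esub> y = x \<oplus>\<^bsub>M\<^esub> y"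
  "a \<odot>\<^bsub>restrict_scalars h M\<^esub> x = h a \<odot>\<^bsub>M\<^esub> x"
  by (simp_all add: restrict_scalars_def)

lemma left_module_restrict_scalars:
  assumes M: "left_module S M" and R: "ring R" and h: "h \<in> ring_hom R S"
  shows "left_module R (restrict_scalars h M)"
proof -
  interpret M: left_module S M by (rule M)
  show ?thesis
  proof (intro left_module.intro left_module_axioms.intro R)
    show "abelian_group (restrict_scalars h M)"
    proof (rule abelian_groupI)
      fix x assume "x \<in> carrier (restrict_scalars h M)"
      then show "\<exists>y\<in>carrier (restrict_scalars h M). y \<oplus>\<^bsub>restrict_scalars h M\<^esub> x = \<zero>\<^bsub>restrict_scalars h M\<^esub>"
        by (intro bexI[of _ "\<ominus>\<^bsub>M\<^esub> x"]) (auto simp: restrict_scalars_simps M.M.l_neg)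
    qed (auto simp: restrict_scalars_simps M.M.add.m_ac)
  qed (use h in \<open>auto simp: restrict_scalars_simps ring_hom_def Pi_iff M.smult_closed M.smult_l_distr
      M.smult_r_distr M.smult_assoc M.smult_one\<close>)
qed

lemma lmod_homD:
  assumes "f \<in> lmod_hom R M N"
  shows "x \<in> carrier M \<Longrightarrow> f x \<in> carrier N"
    and "x \<in> carrier M \<Longrightarrow> y \<in> carrier M \<Longrightarrow> f (x \<oplus>\<^bsub>M\<^esub> y) = f x \<oplus>\<^bsub>N\<^esub> f y"
    and "a \<in> carrier R \<Longrightarrow> x \<in> carrier M \<Longrightarrow> f (a \<odot>\<^bsub>M\<^esub> x) = a \<odot>\<^bsub>N\<^esub> f x"
  using assms by (auto simp: lmod_hom_def)

lemma lmod_hom_zero: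
  assumes f: "f \<in> lmod_hom R M N" and M: "left_module R M" and N: "left_module R N"
  shows "f \<zero>\<^bsub>M\<^esub> = \<zero>\<^bsub>N\<^esub>"
proof -
  interpret M: left_module R M by (rule M)
  interpret N: left_module R N by (rule N)
  show ?thesis
    using lmod_homD(3)[OF f, of "\<zero>\<^bsub>R\<^esub>" "\<zero>\<^bsub>M\<^esub>"] lmod_homD(1)[OF f, of "\<zero>\<^bsub>M\<^esub>"]
    by (simp add: M.smult_l_null N.smult_l_null)
qed

lemma lmod_hom_minus:
  assumes f: "f \<in> lmod_hom R M N" and M: "left_module R M" and N: "left_module R N" and x: "x \<in> carrier M"
  shows "f (\<ominus>\<^bsub>M\<^esub> x) = \<ominus>\<^bsub>N\<^esub> f x"
proof -
  interpret M: left_module R M by (rule M)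
  interpret N: left_module R N by (rule N)
  show ?thesis
    using lmod_homD(2)[OF f, of "\<ominus>\<^bsub>M\<^esub> x" x] lmod_homD(1)[OF f] x lmod_hom_zero[OF f M N]
    by (intro N.M.minus_equality[symmetric]) (auto simp: M.M.l_neg)
qed

lemma lmod_hom_compose:
  "f \<in> lmod_hom R M N \<Longrightarrow> g \<in> lmod_hom R N P \<Longrightarrow> (\<lambda>x. g (f x)) \<in> lmod_hom R M P"
  by (auto simp: lmod_hom_def Pi_iff)

lemma lmod_hom_inv:
  assumes f: "f \<in> lmod_hom R M N" and M: "left_module R M" and b: "bij_betw f (carrier M) (carrier N)"
  shows "inv_into (carrier M) f \<in> lmod_hom R N M"
proof -
  interpret M: left_module R M by (rule M)
  let ?g = "inv_into (carrier M) f"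
  have g: "?g y \<in> carrier M" "f (?g y) = y" if "y \<in> carrier N" for y
    using that b by (auto simp: bij_betw_def inv_into_into f_inv_into_f)
  have gf: "?g (f x) = x" if "x \<in> carrier M" for x
    using that b by (auto simp: bij_betw_def inv_into_f_f)
  have "?g (x \<oplus>\<^bsub>N\<^esub> y) = ?g x \<oplus>\<^bsub>M\<^esub> ?g y" if "x \<in> carrier N" "y \<in> carrier N" for x y
    using gf[of "?g x \<oplus>\<^bsub>M\<^esub> ?g y"] lmod_homD(2)[OF f, of "?g x" "?g y"] g that by simp
  moreover have "?g (a \<odot>\<^bsub>N\<^esub> x) = a \<odot>\<^bsub>M\<^esub> ?g x" if "a \<in> carrier R" "x \<in> carrier N" for a x
    using gf[of "a \<odot>\<^bsub>M\<^esub> ?g x"] lmod_homD(3)[OF f, of a "?g x"] g that M.smult_closed by simp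
  ultimately show ?thesis using g by (auto simp: lmod_hom_def)
qed

lemma abelian_group_vectors:
  "abelian_group \<lparr>carrier = {1..n::nat} \<rightarrow>\<^sub>E (UNIV :: 'a::ab_group_add set), mult = a, one = b,
     zero = (\<lambda>j\<in>{1..n}. 0), add = (\<lambda>v w. \<lambda>j\<in>{1..n}. v j + w j), smult = s\<rparr>" (is "abelian_group ?V")
proof (rule abelian_groupI)
  fix v assume "v \<in> carrier ?V"
  show "\<exists>y\<in>carrier ?V. y \<oplus>\<^bsub>?V\<^esub> v = \<zero>\<^bsub>?V\<^esub>"
    by (rule bexI[of _ "\<lambda>j\<in>{1..n}. - v j"]) auto
qed (auto simp: add_ac PiE_iff extensional_def fun_eq_iff)

lemma finsum_vectors:
  fixes W (structure)
  assumes W: "abelian_group W" and c: "carrier W = {1..n::nat} \<rightarrow>\<^sub>E (UNIV :: 'a::ab_group_add set)"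
    and z: "\<zero> = (\<lambda>j\<in>{1..n}. 0)" and a: "\<And>v w. v \<oplus> w = (\<lambda>j\<in>{1..n}. v j + w j)"
    and T: "finite T" and g: "g \<in> T \<rightarrow> carrier W"
  shows "finsum W g T = (\<lambda>i\<in>{1..n}. \<Sum>s\<in>T. g s i)"
proof -
  interpret abelian_group W by (rule W)
  show ?thesis using T g
  proof (induction T)
    case empty
    then show ?case by (simp add: z)
  next
    case (insert x T)
    then have "finsum W g (insert x T) = g x \<oplus> finsum W g T" by (intro finsum_insert) auto
    also have "\<dots> = (\<lambda>i\<in>{1..n}. \<Sum>s\<in>insert x T. g s i)"
      unfolding a using insert by (intro restrict_ext) simp
    finally show ?case .
  qed
qed

section \<open>The circle algebra and its localisation\<close>

lemma csucc_pow: "j \<in> {1..n} \<Longrightarrow> (csucc n ^^ s) j = (j - 1 + s) mod n + 1"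
proof -
  assume j: "j \<in> {1..n}"
  then obtain i where i: "j = Suc i" "i < n" by (cases j) auto
  show ?thesis unfolding i(1) using i(2) by (induction s) (auto simp: csucc_def mod_Suc)
qed

lemma csucc_pow_mem: "j \<in> {1..n} \<Longrightarrow> (csucc n ^^ s) j \<in> {1..n}"
  by (induction s) (use csucc_mem in auto)

lemma csucc_pow_bij:
  assumes j: "j \<in> {1..n}"
  shows "bij_betw (\<lambda>s. (csucc n ^^ s) j) {1..n} {1..n}"
proof -
  have "inj_on (\<lambda>s. (csucc n ^^ s) j) {1..n}"
  proof (rule inj_onI)
    fix s s' assume s: "s \<in> {1..n}" "s' \<in> {1..n}" "(csucc n ^^ s) j = (csucc n ^^ s') j"
    then have "(j - 1 + s) mod n = (j - 1 + s') mod n" by (simp add: csucc_pow[OF j])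
    have "s = s'" if "s \<le> s'" "(i + s) mod n = (i + s') mod n" "s \<in> {1..n}" "s' \<in> {1..n}" for i s s'
    proof -
      have "n dvd (i + s') - (i + s)" using that mod_eq_dvd_iff_nat[of "i + s" "i + s'" n] by auto
      then show ?thesis using that by (auto dest: dvd_imp_le)
    qed
    from this[of s s' "j - 1"] this[of s' s "j - 1"] show "s = s'"
      using s \<open>(j - 1 + s) mod n = (j - 1 + s') mod n\<close> by (cases "s \<le> s'") auto
  qed
  moreover have "(\<lambda>s. (csucc n ^^ s) j) ` {1..n} \<subseteq> {1..n}"
    using csucc_pow_mem[OF j] by blast
  ultimately show ?thesis by (simp add: bij_betw_def endo_inj_surj)
qed

text \<open>Prepares the comparison of the y-path of length n - k with the x-path of length k: read
  forwards from the same vertex, the former covers the steps k + 1, ..., n.\<close>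

lemma cpred_pow: "j \<in> {1..n} \<Longrightarrow> s \<le> n \<Longrightarrow> (cpred n ^^ s) j = (csucc n ^^ (n - s)) j"
proof (induction s)
  case 0
  then show ?case using csucc_pow[of j n n] by (cases j) auto
next
  case (Suc s)
  then have "(csucc n ^^ (n - s)) j = csucc n ((csucc n ^^ (n - Suc s)) j)"
    by (metis Suc_diff_Suc Suc_le_lessD comp_apply funpow.simps(2))
  then show ?case
    using Suc cpred_csucc[OF csucc_pow_mem[of j n "n - Suc s"]] by simp
qed

lemma cpred_pow_mem: "j \<in> {1..n} \<Longrightarrow> (cpred n ^^ s) j \<in> {1..n}"
  by (induction s) (use cpred_mem in auto)

section \<open>Straight paths and the defining relations\<close>

lemma x_path_simps:
  "x_path n j 0 = (j, [])"
  "x_path n j (Suc m) = (j, X ((csucc n ^^ Suc m) j) # snd (x_path n j m))"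
  by (simp_all add: x_path_def)

lemma y_path_simps:
  "y_path n j 0 = (j, [])"
  "y_path n j (Suc m) = (j, Y ((cpred n ^^ m) j) # snd (y_path n j m))"
  by (simp_all add: y_path_def)

lemma x_path:
  assumes "j \<in> {1..n}"
  shows "is_path n (x_path n j m)" "path_end n (x_path n j m) = (csucc n ^^ m) j"
    "fst (x_path n j m) = j"
proof -
  have "is_path n (x_path n j m) \<and> path_end n (x_path n j m) = (csucc n ^^ m) j \<and> fst (x_path n j m) = j"
  proof (induction m)
    case 0
    then show ?case using assms by (simp add: x_path_simps)
  next
    case (Suc m)
    then show ?case
      using csucc_pow_mem[OF assms, of m] csucc_mem[OF csucc_pow_mem[OF assms, of m]]
        cpred_csucc[OF csucc_pow_mem[OF assms, of m]]
      by (cases "x_path n j m") (auto simp: x_path_simps)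
  qed
  then show "is_path n (x_path n j m)" "path_end n (x_path n j m) = (csucc n ^^ m) j"
    "fst (x_path n j m) = j" by auto
qed

lemma y_path:
  assumes "j \<in> {1..n}"
  shows "is_path n (y_path n j m)" "path_end n (y_path n j m) = (cpred n ^^ m) j"
    "fst (y_path n j m) = j"
proof -
  have "is_path n (y_path n j m) \<and> path_end n (y_path n j m) = (cpred n ^^ m) j \<and> fst (y_path n j m) = j"
  proof (induction m)
    case 0
    then show ?case using assms by (simp add: y_path_simps)
  next
    case (Suc m)
    then show ?case
      using cpred_pow_mem[OF assms, of m] by (cases "y_path n j m") (auto simp: y_path_simps)
  qed
  then show "is_path n (y_path n j m)" "path_end n (y_path n j m) = (cpred n ^^ m) j"
    "fst (y_path n j m) = j" by auto
qed

lemma is_path_two_cycles: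
  assumes "j \<in> {1..n}"
  shows "is_path n (j, [X j, Y j])" "is_path n (j, [Y (csucc n j), X (csucc n j)])"
  using assms csucc_mem[OF assms] cpred_csucc[OF assms] cpred_mem[OF assms] by auto

lemma circle_relations_carrier: "circle_relations k n t \<subseteq> carrier (path_algebra n)"
proof -
  have *: "(\<lambda>p. path_elem q p - s * path_elem q' p) \<in> carrier (path_algebra n)"
    if "is_path n q" "is_path n q'" for q q' and s :: 'a
    using path_algebra_lincomb_closed[OF path_elem_closed[OF that(1)] path_elem_closed[OF that(2)], of 1 "- s"]
    by simp
  show ?thesis
  proof
    fix r :: "qpath \<Rightarrow> 'a" assume "r \<in> circle_relations k n t"
    then obtain j where j: "j \<in> {1..n}" and "r = (\<lambda>p. path_elem (j, [X j, Y j]) p - t * path_elem (j, []) p) \<or>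
        r = (\<lambda>p. path_elem (j, [Y (csucc n j), X (csucc n j)]) p - t * path_elem (j, []) p) \<or>
        r = (\<lambda>p. path_elem (x_path n j k) p - path_elem (y_path n j (n - k)) p)"
      unfolding circle_relations_def by blast
    then show "r \<in> carrier (path_algebra n)"
      using *[OF is_path_two_cycles(1)[OF j], of "(j, [])" t] *[OF is_path_two_cycles(2)[OF j], of "(j, [])" t]
        *[OF x_path(1)[OF j, of k] y_path(1)[OF j, of "n - k"], of 1]
      by (elim disjE) simp_all
  qed
qed

lemma circle_ideal: "ideal (circle_ideal k n t) (path_algebra n)"
  unfolding circle_ideal_def by (intro ring.genideal_ideal ring_path_algebra circle_relations_carrier)

lemma circle_ideal_minimal:
  "ideal J (path_algebra n) \<Longrightarrow> circle_relations k n t \<subseteq> J \<Longrightarrow> circle_ideal k n t \<subseteq> J"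
  unfolding circle_ideal_def by (intro ring.genideal_minimal ring_path_algebra)

lemma circle_relations_ideal: "circle_relations k n t \<subseteq> circle_ideal k n t"
  unfolding circle_ideal_def by (intro ring.genideal_self ring_path_algebra circle_relations_carrier)

lemma ring_circle_algebra: "ring (circle_algebra k n t)"
  unfolding circle_algebra_def by (intro ideal.quotient_is_ring circle_ideal)

lemma circle_proj_hom: "(+>\<^bsub>path_algebra n\<^esub>) (circle_ideal k n t) \<in> ring_hom (path_algebra n) (circle_algebra k n t)"
  unfolding circle_algebra_def by (intro ideal.rcos_ring_hom circle_ideal)

lemma circle_algebra_carrier:
  "carrier (circle_algebra k n t) = (+>\<^bsub>path_algebra n\<^esub>) (circle_ideal k n t) ` carrier (path_algebra n)"
  by (auto simp: circle_algebra_def FactRing_def A_RCOSETS_def RCOSETS_def a_r_coset_def)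

section \<open>Base change from power series to Laurent series\<close>

lemma to_fls_hom: "(\<lambda>f. fps_to_fls \<circ> f) \<in> ring_hom (path_algebra n) (path_algebra n)"
proof (rule ring_hom_memI)
  have sum: "fps_to_fls (\<Sum>i\<in>S. g i) = (\<Sum>i\<in>S. fps_to_fls (g i))" if "finite S" for S and g :: "nat \<Rightarrow> 'a fps"
    using that by (induction S) auto
  fix f g :: "qpath \<Rightarrow> 'a::comm_ring_1 fps"
  assume f: "f \<in> carrier (path_algebra n)"
  then show "fps_to_fls \<circ> f \<in> carrier (path_algebra n)"
    by (auto simp: path_algebra_carrier)
  show "fps_to_fls \<circ> (f \<otimes>\<^bsub>path_algebra n\<^esub> g) = (fps_to_fls \<circ> f) \<otimes>\<^bsub>path_algebra n\<^esub> (fps_to_fls \<circ> g)"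
    by (auto simp: fun_eq_iff path_algebra_mult sum fls_times_fps_to_fls)
  show "fps_to_fls \<circ> (f \<oplus>\<^bsub>path_algebra n\<^esub> g) = (fps_to_fls \<circ> f) \<oplus>\<^bsub>path_algebra n\<^esub> (fps_to_fls \<circ> g)"
    by (auto simp: fun_eq_iff path_algebra_simps)
qed (auto simp: fun_eq_iff path_algebra_simps)

text \<open>The map \<open>C_to_Cloc\<close> on representatives. It is a composite of two ring
  homomorphisms, coefficientwise inclusion and projection, whereas \<open>C_to_Cloc\<close> adds
  whole sets.\<close>

definition to_Cloc :: "nat \<Rightarrow> nat \<Rightarrow> (qpath \<Rightarrow> complex fps) \<Rightarrow> (qpath \<Rightarrow> complex fls) set" where
  "to_Cloc k n f = circle_ideal k n fls_X +>\<^bsub>path_algebra n\<^esub> (fps_to_fls \<circ> f)"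

lemma to_fls_circle_ideal:
  assumes "f \<in> circle_ideal k n (fps_X :: 'a::comm_ring_1 fps)"
  shows "fps_to_fls \<circ> f \<in> circle_ideal k n fls_X"
proof -
  interpret h: ring_hom_ring "path_algebra n" "path_algebra n" "\<lambda>f. fps_to_fls \<circ> (f :: qpath \<Rightarrow> 'a fps)"
    by (intro ring_hom_ringI2 ring_path_algebra to_fls_hom)
  have elem: "fps_to_fls (path_elem q p :: 'a fps) = path_elem q p" for p q
    by (simp add: path_elem_def)
  have "fps_to_fls \<circ> r \<in> circle_relations k n fls_X" if "r \<in> circle_relations k n (fps_X :: 'a fps)" for r
    using that unfolding circle_relations_def by (fastforce simp: elem fls_times_fps_to_fls)
  then have "circle_ideal k n (fps_X :: 'a fps) \<subseteq>
      {f \<in> carrier (path_algebra n). fps_to_fls \<circ> f \<in> circle_ideal k n fls_X}"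
    using circle_relations_carrier circle_relations_ideal
    by (intro circle_ideal_minimal h.ideal_vimage circle_ideal) blast
  then show ?thesis using assms by blast
qed

text \<open>The sum of sets in \<open>C_to_Cloc\<close> is a single coset because the circle ideal
  over power series is mapped into the one over Laurent series.\<close>

lemma C_to_Cloc_coset:
  assumes f: "f \<in> carrier (path_algebra n)"
  shows "C_to_Cloc k n (circle_ideal k n fps_X +>\<^bsub>path_algebra n\<^esub> f) = to_Cloc k n f"
proof -
  interpret I: ideal "circle_ideal k n (fps_X :: complex fps)" "path_algebra n" by (rule circle_ideal)
  interpret I': ideal "circle_ideal k n (fls_X :: complex fls)" "path_algebra n" by (rule circle_ideal)
  note defs = a_r_coset_def' set_add_def' path_algebra_simps
  show ?thesis
  proof (intro equalityI subsetI)
    fix g assume "g \<in> C_to_Cloc k n (circle_ideal k n fps_X +>\<^bsub>path_algebra n\<^esub> f)"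
    then obtain a i where a: "a \<in> circle_ideal k n fls_X" and i: "i \<in> circle_ideal k n fps_X"
      and g: "g = (\<lambda>p. a p + fps_to_fls (i p + f p))"
      by (auto simp: C_to_Cloc_def defs)
    have "(\<lambda>p. a p + fps_to_fls (i p)) \<in> circle_ideal k n fls_X"
      using additive_subgroup.a_closed[OF I'.is_additive_subgroup a to_fls_circle_ideal[OF i]] by (simp add: path_algebra_simps)
    then show "g \<in> to_Cloc k n f"
      unfolding g to_Cloc_def defs by (force simp: add.assoc)
  next
    fix g assume "g \<in> to_Cloc k n f"
    then obtain a where a: "a \<in> circle_ideal k n fls_X" "g = (\<lambda>p. a p + fps_to_fls (f p))"
      by (auto simp: to_Cloc_def defs)
    have "f \<in> circle_ideal k n fps_X +>\<^bsub>path_algebra n\<^esub> f"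
      using I.a_rcos_self f by blast
    then show "g \<in> C_to_Cloc k n (circle_ideal k n fps_X +>\<^bsub>path_algebra n\<^esub> f)"
      unfolding C_to_Cloc_def using a by (force simp: set_add_def' path_algebra_simps)
  qed
qed

lemma to_Cloc_hom: "to_Cloc k n \<in> ring_hom (path_algebra n) (Cloc k n)"
proof -
  have "to_Cloc k n = (+>\<^bsub>path_algebra n\<^esub>) (circle_ideal k n fls_X) \<circ> (\<lambda>f. fps_to_fls \<circ> f)"
    by (auto simp: to_Cloc_def)
  then show ?thesis using ring_hom_trans[OF to_fls_hom circle_proj_hom] by simp
qed

lemma to_Cloc_zero:
  assumes "f \<in> circle_ideal k n fps_X"
  shows "to_Cloc k n f = \<zero>\<^bsub>Cloc k n\<^esub>"
proof -
  interpret I': ideal "circle_ideal k n (fls_X :: complex fls)" "path_algebra n" by (rule circle_ideal)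
  show ?thesis
    using I'.a_rcos_const[OF to_fls_circle_ideal[OF assms]]
    by (simp add: to_Cloc_def circle_algebra_def FactRing_def)
qed

lemma fls_denominator: "\<exists>N f. (fls_X :: complex fls) ^ N * a = fps_to_fls f"
proof -
  obtain N where N: "- fls_subdegree a \<le> int N" by (metis nat_le_iff order_refl)
  have "0 \<le> fls_subdegree (fls_X ^ N * a)"
    using N by (cases "a = 0") (auto simp: fls_subdegree_pow)
  then show ?thesis by (metis fls_regpart_to_fls_trivial)
qed

text \<open>A representative has finite support, so one power of t clears the denominators of all
  its coefficients. This is how elements of B are brought into the image of C later.\<close>

lemma Cloc_denominator:
  assumes b: "b \<in> carrier (Cloc k n)"
  shows "\<exists>N. \<exists>f\<in>carrier (path_algebra n). to_Cloc k n (scal n (fps_X ^ N)) \<otimes>\<^bsub>Cloc k n\<^esub> b = to_Cloc k n f"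
proof -
  obtain g where g: "g \<in> carrier (path_algebra n)" "b = circle_ideal k n fls_X +>\<^bsub>path_algebra n\<^esub> g"
    using b circle_algebra_carrier by blast
  have "\<forall>p. \<exists>N f. (fls_X :: complex fls) ^ N * g p = fps_to_fls f" using fls_denominator by blast
  then obtain N f where Nf: "\<And>p. (fls_X :: complex fls) ^ N p * g p = fps_to_fls (f p)" by metis
  define L where "L = Max (N ` {p. g p \<noteq> 0})"
  have L: "N p \<le> L" if "g p \<noteq> 0" for p
    unfolding L_def using that g(1) by (intro Max_ge) (auto simp: path_algebra_carrier)
  define h where "h p = (if g p = 0 then 0 else fps_X ^ (L - N p) * f p)" for p
  have h: "fls_X ^ L * g p = fps_to_fls (h p)" for p
  proof (cases "g p = 0")
    case False
    have "fls_X ^ L * g p = fls_X ^ (L - N p) * (fls_X ^ N p * g p)"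
      using L[OF False] by (simp flip: power_add mult.assoc)
    then show ?thesis using False by (simp add: h_def Nf fls_times_fps_to_fls fps_to_fls_power)
  qed (simp add: h_def)
  have hc: "h \<in> carrier (path_algebra n)"
    using g(1) by (auto simp: path_algebra_carrier h_def intro: finite_subset[of _ "{p. g p \<noteq> 0}"])
  have sc: "fps_to_fls \<circ> scal n (fps_X ^ L) = scal n (fls_X ^ L :: complex fls)"
    by (auto simp: scal_def path_algebra_simps fls_times_fps_to_fls fps_to_fls_power)
  have "to_Cloc k n (scal n (fps_X ^ L)) \<otimes>\<^bsub>Cloc k n\<^esub> b =
      circle_ideal k n fls_X +>\<^bsub>path_algebra n\<^esub> (scal n (fls_X ^ L) \<otimes>\<^bsub>path_algebra n\<^esub> g)"
    unfolding to_Cloc_def sc g(2) using ring_hom_mult[OF circle_proj_hom scal_closed g(1)] by simp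
  also have "scal n (fls_X ^ L) \<otimes>\<^bsub>path_algebra n\<^esub> g = fps_to_fls \<circ> h"
    by (auto simp: scal_mult[OF g(1)] h)
  finally show ?thesis using hc unfolding to_Cloc_def by blast
qed

section \<open>Rank one modules over the path algebra\<close>

definition path_weight :: "nat set \<Rightarrow> qpath \<Rightarrow> complex fps" where
  "path_weight I p = prod_list (map (arrow_weight I) (snd p))"

lemma path_weight_simps:
  "path_weight I (j, []) = 1"
  "path_weight I (j, a # w) = arrow_weight I a * path_weight I (j, w)"
  by (simp_all add: path_weight_def)

lemma path_algebra_supp: "f \<in> carrier (path_algebra n) \<Longrightarrow> f p \<noteq> 0 \<Longrightarrow> is_path n p"
  by (cases p) (auto simp: path_algebra_carrier)

text \<open>The defining sum runs over the support, which varies with f. Summing over any finite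
  superset instead makes the actions of different elements comparable term by term.\<close>

lemma rank_one_act_eq:
  assumes S: "finite S" "{p. f p \<noteq> 0} \<subseteq> S"
  shows "rank_one_act n I f v =
    (\<lambda>i\<in>{1..n}. \<Sum>p\<in>S. if path_end n p = i then f p * path_weight I p * v (fst p) else 0)"
proof -
  have sum_eq: "(\<Sum>p | f p \<noteq> 0 \<and> path_end n p = i. f p * prod_list (map (arrow_weight I) (snd p)) * v (fst p)) =
      (\<Sum>p\<in>S. if path_end n p = i then f p * path_weight I p * v (fst p) else 0)" for i
  proof -
  have "(\<Sum>p | f p \<noteq> 0 \<and> path_end n p = i. f p * prod_list (map (arrow_weight I) (snd p)) * v (fst p)) =
      (\<Sum>p\<in>{p\<in>S. path_end n p = i}. f p * path_weight I p * v (fst p))"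
    using S by (intro sum.mono_neutral_cong_left) (auto simp: path_weight_def)
  also have "\<dots> = (\<Sum>p\<in>S. if path_end n p = i then f p * path_weight I p * v (fst p) else 0)"
    using S by (simp add: sum.inter_filter)
  finally show ?thesis .
  qed
  show ?thesis unfolding rank_one_act_def sum_eq ..
qed

lemma rank_one_act_closed: "rank_one_act n I f v \<in> {1..n} \<rightarrow>\<^sub>E UNIV"
  by (simp add: rank_one_act_def)

lemma rank_one_act_add_left:
  assumes "f \<in> carrier (path_algebra n)" "g \<in> carrier (path_algebra n)"
  shows "rank_one_act n I (f \<oplus>\<^bsub>path_algebra n\<^esub> g) v =
    (\<lambda>i\<in>{1..n}. rank_one_act n I f v i + rank_one_act n I g v i)"
proof -
  let ?S = "{p. f p \<noteq> 0} \<union> {p. g p \<noteq> 0}"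
  have fin: "finite ?S" using assms by (auto simp: path_algebra_carrier)
  have sub: "{p. (f \<oplus>\<^bsub>path_algebra n\<^esub> g) p \<noteq> 0} \<subseteq> ?S" by (auto simp: path_algebra_simps)
  show ?thesis
    unfolding rank_one_act_eq[OF fin sub] rank_one_act_eq[OF fin Un_upper1] rank_one_act_eq[OF fin Un_upper2]
    by (auto simp: fun_eq_iff path_algebra_simps restrict_def algebra_simps simp flip: sum.distrib
        intro!: sum.cong)
qed

lemma rank_one_act_add_right:
  "rank_one_act n I f (\<lambda>j\<in>{1..n}. v j + w j) = (\<lambda>i\<in>{1..n}. rank_one_act n I f v i + rank_one_act n I f w i)"
  if f: "f \<in> carrier (path_algebra n)"
proof -
  have fin: "finite {p. f p \<noteq> 0}" using f by (auto simp: path_algebra_carrier)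
  have "fst p \<in> {1..n}" if "f p \<noteq> 0" for p
    using path_start_mem path_algebra_supp[OF f that] by blast
  then show ?thesis
    unfolding rank_one_act_eq[OF fin order_refl]
    by (auto simp: fun_eq_iff restrict_def algebra_simps simp flip: sum.distrib intro!: sum.cong)
qed

lemma rank_one_act_path_elem:
  "rank_one_act n I (path_elem q) v = (\<lambda>i\<in>{1..n}. if path_end n q = i then path_weight I q * v (fst q) else 0)"
  by (subst rank_one_act_eq[of "{q}"]) (auto simp: path_elem_def)

lemma rank_one_act_scal:
  assumes "v \<in> {1..n} \<rightarrow>\<^sub>E UNIV"
  shows "rank_one_act n I (scal n r) v = (\<lambda>i\<in>{1..n}. r * v i)"
proof -
  have sub: "{p. scal n r p \<noteq> 0} \<subseteq> (\<lambda>j. (j, [])) ` {1..n}"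
    by (auto simp: scal_def path_algebra_simps split: if_splits)
  have *: "(\<Sum>p\<in>(\<lambda>j. (j, [])) ` {1..n}. if path_end n p = i then scal n r p * path_weight I p * v (fst p) else 0) = r * v i"
    if "i \<in> {1..n}" for i
    using that by (subst sum.reindex) (auto simp: inj_on_def scal_def path_algebra_simps path_weight_simps
        if_distrib cong: if_cong)
  show ?thesis
    by (subst rank_one_act_eq[OF _ sub]) (auto simp: * restrict_def fun_eq_iff simp del: atLeastAtMost_iff One_nat_def)
qed

lemma rank_one_act_arrow_sum:
  assumes s: "\<And>j w. s (j, w) = (if j \<in> {1..n} \<and> w = [a j] then 1 else 0)"
  shows "rank_one_act n I s v =
    (\<lambda>i\<in>{1..n}. \<Sum>j\<in>{1..n}. if arrow_target n (a j) = i then arrow_weight I (a j) * v j else 0)"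
proof -
  have sub: "{p. s p \<noteq> 0} \<subseteq> (\<lambda>j. (j, [a j])) ` {1..n}"
    by (auto simp: s split: if_splits)
  show ?thesis
    by (subst rank_one_act_eq[OF _ sub])
      (auto intro!: restrict_ext simp: sum.reindex inj_on_def s path_weight_simps intro!: sum.cong)
qed

text \<open>Prolonging by an arrow is injective on the support of g and multiplies the path weight
  by the weight of that arrow. Sorting the paths of g by their end vertex j then turns the left side
  into the action of s on the components of g v.\<close>

lemma rank_one_act_arrow_sum_mult:
  assumes s: "\<And>j w. s (j, w) = (if j \<in> {1..n} \<and> w = [a j] then 1 else 0)"
    and g: "g \<in> carrier (path_algebra n)"
  shows "rank_one_act n I (s \<otimes>\<^bsub>path_algebra n\<^esub> g) v = rank_one_act n I s (rank_one_act n I g v)"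
proof -
  let ?S = "{p. g p \<noteq> 0}"
  let ?e = "\<lambda>p. (fst p, a (path_end n p) # snd p)"
  have fin: "finite ?S" using g by (auto simp: path_algebra_carrier)
  have em: "path_end n p \<in> {1..n}" if "p \<in> ?S" for p
    using path_end_mem path_algebra_supp[OF g, of p] that by blast
  have sub: "{p. (s \<otimes>\<^bsub>path_algebra n\<^esub> g) p \<noteq> 0} \<subseteq> ?e ` ?S"
    by (auto simp: arrow_sum_mult[OF s] image_iff split: list.splits if_splits)
  have inj: "inj_on ?e ?S"
    by (auto simp: inj_on_def)
  have val: "(s \<otimes>\<^bsub>path_algebra n\<^esub> g) (?e p) = g p" if "p \<in> ?S" for p
    using em[OF that] by (simp add: arrow_sum_mult[OF s] del: atLeastAtMost_iff One_nat_def)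
  have "(\<Sum>p\<in>?e ` ?S. if path_end n p = i then (s \<otimes>\<^bsub>path_algebra n\<^esub> g) p * path_weight I p * v (fst p) else 0) =
      (\<Sum>j\<in>{1..n}. if arrow_target n (a j) = i then arrow_weight I (a j) * rank_one_act n I g v j else 0)" for i
  proof -
    have "(\<Sum>p\<in>?e ` ?S. if path_end n p = i then (s \<otimes>\<^bsub>path_algebra n\<^esub> g) p * path_weight I p * v (fst p) else 0) =
        (\<Sum>p\<in>?S. if arrow_target n (a (path_end n p)) = i
           then g p * (arrow_weight I (a (path_end n p)) * path_weight I p) * v (fst p) else 0)"
      unfolding sum.reindex[OF inj] o_def
      by (intro sum.cong refl) (use val in \<open>auto simp: path_weight_simps\<close>)
    also have "\<dots> = (\<Sum>p\<in>?S. \<Sum>j\<in>{1..n}. if path_end n p = j then if arrow_target n (a j) = i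
           then g p * (arrow_weight I (a j) * path_weight I p) * v (fst p) else 0 else 0)"
      using em by (intro sum.cong refl) (simp del: atLeastAtMost_iff One_nat_def)
    also have "\<dots> = (\<Sum>j\<in>{1..n}. \<Sum>p\<in>?S. if path_end n p = j then if arrow_target n (a j) = i
           then g p * (arrow_weight I (a j) * path_weight I p) * v (fst p) else 0 else 0)"
      by (rule sum.swap)
    also have "\<dots> = (\<Sum>j\<in>{1..n}. if arrow_target n (a j) = i then arrow_weight I (a j) * rank_one_act n I g v j else 0)"
      by (intro sum.cong refl)
        (auto simp: rank_one_act_eq[OF fin order_refl] sum_distrib_left mult_ac intro!: sum.cong sum.neutral)
    finally show ?thesis .
  qed
  then show ?thesis
    by (subst rank_one_act_eq[OF finite_imageI[OF fin] sub]) (simp add: rank_one_act_arrow_sum[OF s])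
qed

lemma rank_one_act_x:
  "rank_one_act n I (x_sum n) v = (\<lambda>i\<in>{1..n}. arrow_weight I (X i) * v (cpred n i))"
proof -
  have "(\<Sum>j\<in>{1..n}. if csucc n j = i then arrow_weight I (X (csucc n j)) * v j else 0) =
      arrow_weight I (X i) * v (cpred n i)" if i: "i \<in> {1..n}" for i
  proof -
    have "(\<Sum>j\<in>{1..n}. if csucc n j = i then arrow_weight I (X (csucc n j)) * v j else 0) =
        (\<Sum>j\<in>{1..n}. if j = cpred n i then arrow_weight I (X i) * v j else 0)"
      by (intro sum.cong refl) (use i csucc_cpred[of i n] cpred_csucc in \<open>auto simp del: One_nat_def\<close>)
    then show ?thesis using cpred_mem[OF i] by (simp del: atLeastAtMost_iff One_nat_def)
  qed
  then show ?thesis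
    by (subst rank_one_act_arrow_sum[of _ n "\<lambda>j. X (csucc n j)"])
      (auto simp: x_sum_def simp del: arrow_weight.simps intro!: restrict_ext)
qed

lemma rank_one_act_y:
  "rank_one_act n I (y_sum n) v = (\<lambda>i\<in>{1..n}. arrow_weight I (Y (csucc n i)) * v (csucc n i))"
proof -
  have "(\<Sum>j\<in>{1..n}. if cpred n j = i then arrow_weight I (Y j) * v j else 0) =
      arrow_weight I (Y (csucc n i)) * v (csucc n i)" if i: "i \<in> {1..n}" for i
  proof -
    have "(\<Sum>j\<in>{1..n}. if cpred n j = i then arrow_weight I (Y j) * v j else 0) =
        (\<Sum>j\<in>{1..n}. if j = csucc n i then arrow_weight I (Y j) * v j else 0)"
      by (intro sum.cong refl) (use i csucc_cpred cpred_csucc[of i n] in \<open>auto simp del: One_nat_def\<close>)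
    then show ?thesis using csucc_mem[OF i] by (simp del: atLeastAtMost_iff One_nat_def)
  qed
  then show ?thesis
    by (subst rank_one_act_arrow_sum[of _ n Y])
      (auto simp: y_sum_def simp del: arrow_weight.simps intro!: restrict_ext)
qed

lemma rank_one_act_idem:
  assumes "j \<in> {1..n}"
  shows "rank_one_act n I (path_elem (j, [])) v = (\<lambda>i\<in>{1..n}. if i = j then v i else 0)"
  by (auto simp: rank_one_act_path_elem path_weight_simps)

text \<open>Induction on the left factor along the generators of the path algebra. The right factor
  and the vector stay quantified, since for a product f1 f2 the hypothesis on f1 is applied to f2 g,
  and those on f1 and f2 to vectors that have already been moved.\<close>

lemma rank_one_act_mult:
  assumes f: "f \<in> carrier (path_algebra n)" and g: "g \<in> carrier (path_algebra n)"
    and v: "v \<in> {1..n} \<rightarrow>\<^sub>E UNIV"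
  shows "rank_one_act n I (f \<otimes>\<^bsub>path_algebra n\<^esub> g) v = rank_one_act n I f (rank_one_act n I g v)"
proof -
  interpret A: ring "path_algebra n :: (qpath \<Rightarrow> complex fps) ring" by (rule ring_path_algebra)
  have "\<forall>g\<in>carrier (path_algebra n). \<forall>v\<in>{1..n} \<rightarrow>\<^sub>E UNIV.
      rank_one_act n I (f \<otimes>\<^bsub>path_algebra n\<^esub> g) v = rank_one_act n I f (rank_one_act n I g v)"
    using f
  proof (induction rule: path_algebra_induct)
    case (scal r)
    show ?case
    proof safe
      fix g :: "qpath \<Rightarrow> complex fps" and v :: "nat \<Rightarrow> complex fps"
      assume g: "g \<in> carrier (path_algebra n)"
      have fin: "finite {p. g p \<noteq> 0}" using g by (auto simp: path_algebra_carrier)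
      have sub: "{p. r * g p \<noteq> 0} \<subseteq> {p. g p \<noteq> 0}" by auto
      show "rank_one_act n I (scal n r \<otimes>\<^bsub>path_algebra n\<^esub> g) v = rank_one_act n I (scal n r) (rank_one_act n I g v)"
        unfolding rank_one_act_scal[OF rank_one_act_closed] scal_mult(1)[OF g]
        unfolding rank_one_act_eq[OF fin sub] rank_one_act_eq[OF fin order_refl]
        by (auto intro!: restrict_ext sum.cong simp: sum_distrib_left mult_ac)
    qed
  next
    case (idem j)
    show ?case
    proof safe
      fix g :: "qpath \<Rightarrow> complex fps" and v :: "nat \<Rightarrow> complex fps"
      assume g: "g \<in> carrier (path_algebra n)"
      have fin: "finite {p. g p \<noteq> 0}" using g by (auto simp: path_algebra_carrier)
      have sub: "{p. (path_elem (j, []) \<otimes>\<^bsub>path_algebra n\<^esub> g) p \<noteq> 0} \<subseteq> {p. g p \<noteq> 0}"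
        by (auto simp: trivial_path_mult[OF idem])
      show "rank_one_act n I (path_elem (j, []) \<otimes>\<^bsub>path_algebra n\<^esub> g) v =
          rank_one_act n I (path_elem (j, [])) (rank_one_act n I g v)"
        unfolding rank_one_act_idem[OF idem] rank_one_act_eq[OF fin sub]
          rank_one_act_eq[OF fin order_refl]
        by (auto intro!: restrict_ext sum.cong sum.neutral simp: trivial_path_mult[OF idem])
    qed
  next
    case x
    show ?case by (auto simp: x_sum_def intro!: rank_one_act_arrow_sum_mult[of _ n "\<lambda>j. X (csucc n j)"])
  next
    case y
    show ?case by (auto simp: y_sum_def intro!: rank_one_act_arrow_sum_mult[of _ n Y])
  next
    case (add f1 f2)
    then show ?case
      by (auto simp: A.l_distr rank_one_act_add_left rank_one_act_closed)
  next
    case (mult f1 f2)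
    then show ?case
      by (auto simp: A.m_assoc rank_one_act_closed simp del: One_nat_def)
  qed
  then show ?thesis using g v by blast
qed

text \<open>M_I over the path algebra itself. In contrast to \<open>rank_one_module\<close>, no
  representative of a coset is chosen, and nothing is required of I.\<close>

definition rank_one_rep :: "nat \<Rightarrow> nat set \<Rightarrow> (qpath \<Rightarrow> complex fps, nat \<Rightarrow> complex fps) module" where
  "rank_one_rep n I = \<lparr>carrier = {1..n} \<rightarrow>\<^sub>E UNIV, mult = undefined, one = undefined,
     zero = (\<lambda>j\<in>{1..n}. 0), add = (\<lambda>v w. \<lambda>j\<in>{1..n}. v j + w j), smult = rank_one_act n I\<rparr>"

lemma rank_one_rep_simps:
  "carrier (rank_one_rep n I) = {1..n} \<rightarrow>\<^sub>E UNIV"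
  "\<zero>\<^bsub>rank_one_rep n I\<^esub> = (\<lambda>j\<in>{1..n}. 0)"
  "v \<oplus>\<^bsub>rank_one_rep n I\<^esub> w = (\<lambda>j\<in>{1..n}. v j + w j)"
  "f \<odot>\<^bsub>rank_one_rep n I\<^esub> v = rank_one_act n I f v"
  by (simp_all add: rank_one_rep_def)

lemma left_module_rank_one_rep: "left_module (path_algebra n) (rank_one_rep n I)"
proof (intro left_module.intro left_module_axioms.intro ring_path_algebra)
  show "abelian_group (rank_one_rep n I)"
    unfolding rank_one_rep_def by (rule abelian_group_vectors)
next
  fix v assume "v \<in> carrier (rank_one_rep n I)"
  then have v: "v \<in> {1..n} \<rightarrow>\<^sub>E UNIV" by (simp add: rank_one_rep_simps)
  have "\<one>\<^bsub>path_algebra n\<^esub> = (scal n 1 :: qpath \<Rightarrow> complex fps)" by (simp add: scal_def)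
  then show "\<one>\<^bsub>path_algebra n\<^esub> \<odot>\<^bsub>rank_one_rep n I\<^esub> v = v"
    using v by (simp add: rank_one_rep_simps rank_one_act_scal[OF v] PiE_iff extensional_restrict)
qed (auto simp: rank_one_rep_simps rank_one_act_closed rank_one_act_add_left rank_one_act_add_right rank_one_act_mult
    simp del: One_nat_def)

section \<open>The circle relations on rank one modules\<close>

lemma path_weight_x_path: "path_weight I (x_path n j m) = (\<Prod>s=1..m. arrow_weight I (X ((csucc n ^^ s) j)))"
  by (induction m) (auto simp: x_path_simps path_weight_simps path_weight_def mult.commute)

lemma path_weight_y_path: "path_weight I (y_path n j m) = (\<Prod>s<m. arrow_weight I (Y ((cpred n ^^ s) j)))"
  by (induction m) (auto simp: y_path_simps path_weight_simps path_weight_def mult.commute)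

text \<open>The x-path of length k and the y-path of length n - k from j use complementary sets of
  arrow indices. The first collects a factor t for each of its k indices outside I, the second for
  each of its n - k indices inside I, and these numbers agree because I has k elements.\<close>

lemma path_weight_relation:
  assumes I: "I \<in> k_subsets k n" and j: "j \<in> {1..n}" and k: "k \<le> n"
  shows "path_weight I (x_path n j k) = path_weight I (y_path n j (n - k))"
proof -
  let ?c = "\<lambda>s. (csucc n ^^ s) j"
  have bij: "bij_betw ?c {1..n} {1..n}" by (rule csucc_pow_bij[OF j])
  have I': "I \<subseteq> {1..n}" "card I = k" using I by (auto simp: k_subsets_def)
  have "I \<subseteq> ?c ` {1..n}" using bij I'(1) by (simp add: bij_betw_def)
  then have "?c ` {s \<in> {1..n}. ?c s \<in> I} = I" by blast
  then have "bij_betw ?c {s \<in> {1..n}. ?c s \<in> I} I"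
    using bij by (auto simp: bij_betw_def intro: inj_on_subset)
  then have "card {s \<in> {1..n}. ?c s \<in> I} = k" using I'(2) by (simp add: bij_betw_same_card)
  also have "{s \<in> {1..n}. ?c s \<in> I} = {s \<in> {1..k}. ?c s \<in> I} \<union> {s \<in> {k+1..n}. ?c s \<in> I}"
    using k by auto
  also have "card \<dots> = card {s \<in> {1..k}. ?c s \<in> I} + card {s \<in> {k+1..n}. ?c s \<in> I}"
    by (rule card_Un_disjoint) auto
  finally have c1: "card {s \<in> {1..k}. ?c s \<in> I} + card {s \<in> {k+1..n}. ?c s \<in> I} = k" .
  have "card {1..k} = card ({s \<in> {1..k}. ?c s \<in> I} \<union> {s \<in> {1..k}. ?c s \<notin> I})"
    by (rule arg_cong[of _ _ card]) auto
  also have "\<dots> = card {s \<in> {1..k}. ?c s \<in> I} + card {s \<in> {1..k}. ?c s \<notin> I}"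
    by (rule card_Un_disjoint) auto
  finally have c2: "card {s \<in> {1..k}. ?c s \<notin> I} = card {s \<in> {k+1..n}. ?c s \<in> I}" using c1 by simp
  have pow: "(\<Prod>s\<in>S. if P s then fps_X else (1 :: complex fps)) = fps_X ^ card {s \<in> S. P s}" if "finite S" for S :: "nat set" and P
    using that by (simp add: prod.If_cases Int_def)
  have "path_weight I (x_path n j k) = (\<Prod>s\<in>{1..k}. if ?c s \<notin> I then fps_X else 1)"
    unfolding path_weight_x_path by (intro prod.cong) auto
  also have "\<dots> = fps_X ^ card {s \<in> {k+1..n}. ?c s \<in> I}" by (simp add: pow c2[simplified])
  also have "\<dots> = (\<Prod>s\<in>{k+1..n}. if ?c s \<in> I then fps_X else 1)" by (simp add: pow)
  also have "\<dots> = (\<Prod>s<n - k. if (cpred n ^^ s) j \<in> I then fps_X else 1)"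
    by (rule prod.reindex_bij_witness[of _ "\<lambda>s. n - s" "\<lambda>s. n - s"]) (use cpred_pow[OF j] in auto)
  also have "\<dots> = path_weight I (y_path n j (n - k))"
    unfolding path_weight_y_path by (intro prod.cong) auto
  finally show ?thesis .
qed

lemma rank_one_act_circle_ideal:
  assumes I: "I \<in> k_subsets k n" and k: "k \<le> n" and f: "f \<in> circle_ideal k n fps_X"
    and v: "v \<in> {1..n} \<rightarrow>\<^sub>E UNIV"
  shows "rank_one_act n I f v = (\<lambda>j\<in>{1..n}. 0)"
proof -
  interpret M: left_module "path_algebra n" "rank_one_rep n I" by (rule left_module_rank_one_rep)
  have *: "rank_one_act n I (\<lambda>p. path_elem q p - s * path_elem q' p) v = (\<lambda>j\<in>{1..n}. 0)"
    if "path_end n q = path_end n q'" "fst q = fst q'" "path_weight I q = s * path_weight I q'" for q q' s v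
  proof (cases "q = q'")
    case True
    show ?thesis
      by (subst rank_one_act_eq[of "{q'}"])
        (use True that in \<open>auto simp: path_elem_def algebra_simps intro!: restrict_ext\<close>)
  next
    case False
    show ?thesis
      by (subst rank_one_act_eq[of "{q, q'}"])
        (use False that in \<open>auto simp: path_elem_def algebra_simps intro!: restrict_ext\<close>)
  qed
  have "circle_ideal k n fps_X \<subseteq> {a \<in> carrier (path_algebra n). \<forall>x\<in>carrier (rank_one_rep n I).
      a \<odot>\<^bsub>rank_one_rep n I\<^esub> x = \<zero>\<^bsub>rank_one_rep n I\<^esub>}"
  proof (rule circle_ideal_minimal[OF M.annihilator_ideal])
    have "rank_one_act n I r v = (\<lambda>j\<in>{1..n}. 0)" if r: "r \<in> circle_relations k n fps_X" for r v
    proof -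
      obtain j where j: "j \<in> {1..n}" and "r = (\<lambda>p. path_elem (j, [X j, Y j]) p - fps_X * path_elem (j, []) p) \<or>
          r = (\<lambda>p. path_elem (j, [Y (csucc n j), X (csucc n j)]) p - fps_X * path_elem (j, []) p) \<or>
          r = (\<lambda>p. path_elem (x_path n j k) p - path_elem (y_path n j (n - k)) p)"
        using r unfolding circle_relations_def by blast
      then show ?thesis
      proof (elim disjE)
        assume "r = (\<lambda>p. path_elem (j, [X j, Y j]) p - fps_X * path_elem (j, []) p)"
        then show ?thesis by (simp only:) (rule *, auto simp: path_weight_simps)
      next
        assume "r = (\<lambda>p. path_elem (j, [Y (csucc n j), X (csucc n j)]) p - fps_X * path_elem (j, []) p)"
        then show ?thesis using cpred_csucc[OF j] by (simp only:) (rule *, auto simp: path_weight_simps)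
      next
        assume "r = (\<lambda>p. path_elem (x_path n j k) p - path_elem (y_path n j (n - k)) p)"
        moreover have "path_end n (x_path n j k) = path_end n (y_path n j (n - k))"
          using k by (simp add: x_path(2)[OF j] y_path(2)[OF j] cpred_pow[OF j])
        ultimately show ?thesis
          using *[of "x_path n j k" "y_path n j (n - k)" 1] path_weight_relation[OF I j k]
          by (simp add: x_path(3)[OF j] y_path(3)[OF j])
      qed
    qed
    then show "circle_relations k n fps_X \<subseteq> {a \<in> carrier (path_algebra n). \<forall>x\<in>carrier (rank_one_rep n I).
        a \<odot>\<^bsub>rank_one_rep n I\<^esub> x = \<zero>\<^bsub>rank_one_rep n I\<^esub>}"
      by (auto simp: rank_one_rep_simps intro: subsetD[OF circle_relations_carrier])
  qed
  then show ?thesis using f v by (auto simp: rank_one_rep_simps)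
qed

text \<open>The representative picked by SOME differs from f by an element of the circle ideal,
  which acts as zero.\<close>

lemma rank_one_module_coset:
  assumes I: "I \<in> k_subsets k n" and k: "k \<le> n" and f: "f \<in> carrier (path_algebra n)"
    and v: "v \<in> {1..n} \<rightarrow>\<^sub>E UNIV"
  shows "(circle_ideal k n fps_X +>\<^bsub>path_algebra n\<^esub> f) \<odot>\<^bsub>rank_one_module n I\<^esub> v = rank_one_act n I f v"
proof -
  interpret I: ideal "circle_ideal k n (fps_X :: complex fps)" "path_algebra n" by (rule circle_ideal)
  let ?c = "circle_ideal k n fps_X +>\<^bsub>path_algebra n\<^esub> f"
  have "(SOME g. g \<in> ?c) \<in> ?c" by (rule someI[of _ f]) (use I.a_rcos_self f in blast)
  then obtain i where i: "i \<in> circle_ideal k n fps_X" and eq: "(SOME g. g \<in> ?c) = i \<oplus>\<^bsub>path_algebra n\<^esub> f"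
    by (auto simp: a_r_coset_def')
  have "rank_one_act n I (SOME g. g \<in> ?c) v = rank_one_act n I f v"
    using rank_one_act_closed[of n I f v] I.a_subset i f
    by (auto simp: eq rank_one_act_add_left rank_one_act_circle_ideal[OF I k i v] PiE_iff extensional_def fun_eq_iff
        intro!: restrict_ext)
  then show ?thesis by (simp add: rank_one_module_def)
qed

section \<open>Modules over an order\<close>

text \<open>Testing t suffices for torsion-freeness over power series, as a nonzero series is a unit
  times a power of t. The notion is phrased over the path algebra so that it applies to M_I and to
  restrictions of B-modules alike.\<close>

definition torsion_free :: "nat \<Rightarrow> (qpath \<Rightarrow> complex fps, 'e) module \<Rightarrow> bool" where
  "torsion_free n E \<longleftrightarrow> (\<forall>x\<in>carrier E. scal n fps_X \<odot>\<^bsub>E\<^esub> x = \<zero>\<^bsub>E\<^esub> \<longrightarrow> x = \<zero>\<^bsub>E\<^esub>)"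

lemma scal_mult_scal: "scal n r \<otimes>\<^bsub>path_algebra n\<^esub> scal n s = scal n (r * s)"
  by (subst scal_mult(1)[OF scal_closed]) (simp add: scal_def mult.assoc)

lemma scal_one: "scal n 1 = \<one>\<^bsub>path_algebra n\<^esub>"
  by (simp add: scal_def)

lemma scal_central:
  "f \<in> carrier (path_algebra n) \<Longrightarrow> scal n r \<otimes>\<^bsub>path_algebra n\<^esub> f = f \<otimes>\<^bsub>path_algebra n\<^esub> scal n r"
  by (simp add: scal_mult)

lemma torsion_free_power:
  assumes E: "left_module (path_algebra n) E" and tf: "torsion_free n E" and x: "x \<in> carrier E"
    and 0: "scal n (fps_X ^ N) \<odot>\<^bsub>E\<^esub> x = \<zero>\<^bsub>E\<^esub>"
  shows "x = \<zero>\<^bsub>E\<^esub>"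
proof -
  interpret E: left_module "path_algebra n" E by (rule E)
  show ?thesis using 0
  proof (induction N)
    case 0
    then show ?case using E.smult_one[OF x] by (metis scal_one power_0)
  next
    case (Suc N)
    have "scal n fps_X \<odot>\<^bsub>E\<^esub> (scal n (fps_X ^ N) \<odot>\<^bsub>E\<^esub> x) =
        (scal n fps_X \<otimes>\<^bsub>path_algebra n\<^esub> scal n (fps_X ^ N)) \<odot>\<^bsub>E\<^esub> x"
      by (rule E.smult_assoc[OF scal_closed scal_closed x, symmetric])
    also have "\<dots> = \<zero>\<^bsub>E\<^esub>" using Suc.prems by (simp only: scal_mult_scal power_Suc)
    finally have "scal n fps_X \<odot>\<^bsub>E\<^esub> (scal n (fps_X ^ N) \<odot>\<^bsub>E\<^esub> x) = \<zero>\<^bsub>E\<^esub>" .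
    then have "scal n (fps_X ^ N) \<odot>\<^bsub>E\<^esub> x = \<zero>\<^bsub>E\<^esub>"
      using tf E.smult_closed[OF scal_closed x] unfolding torsion_free_def by blast
    then show ?case by (rule Suc.IH)
  qed
qed

lemma (in abelian_group) eq_of_minus_zero:
  assumes x: "x \<in> carrier G" and y: "y \<in> carrier G" and 0: "x \<oplus> \<ominus> y = \<zero>"
  shows "x = y"
proof -
  have "x = x \<oplus> (\<ominus> y \<oplus> y)" using x y by (simp add: l_neg)
  also have "\<dots> = (x \<oplus> \<ominus> y) \<oplus> y" using x y by (simp add: a_assoc)
  also have "\<dots> = y" unfolding 0 by (rule l_zero[OF y])
  finally show ?thesis .
qed

lemma torsion_free_cancel:
  assumes E: "left_module (path_algebra n) E" and tf: "torsion_free n E"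
    and x: "x \<in> carrier E" and y: "y \<in> carrier E"
    and eq: "scal n (fps_X ^ N) \<odot>\<^bsub>E\<^esub> x = scal n (fps_X ^ N) \<odot>\<^bsub>E\<^esub> y"
  shows "x = y"
proof -
  interpret E: left_module "path_algebra n" E by (rule E)
  let ?t = "scal n (fps_X ^ N)"
  note c = E.M.a_inv_closed[OF y] E.smult_closed[OF scal_closed y, of "fps_X ^ N"]
  have "?t \<odot>\<^bsub>E\<^esub> (x \<oplus>\<^bsub>E\<^esub> \<ominus>\<^bsub>E\<^esub> y) = ?t \<odot>\<^bsub>E\<^esub> x \<oplus>\<^bsub>E\<^esub> ?t \<odot>\<^bsub>E\<^esub> (\<ominus>\<^bsub>E\<^esub> y)"
    by (rule E.smult_r_distr[OF scal_closed x c(1)])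
  also have "\<dots> = ?t \<odot>\<^bsub>E\<^esub> x \<oplus>\<^bsub>E\<^esub> \<ominus>\<^bsub>E\<^esub> (?t \<odot>\<^bsub>E\<^esub> y)"
    by (rule arg_cong[OF E.smult_r_minus[OF scal_closed y]])
  also have "\<dots> = \<zero>\<^bsub>E\<^esub>" unfolding eq by (rule E.M.r_neg[OF c(2)])
  finally have "x \<oplus>\<^bsub>E\<^esub> \<ominus>\<^bsub>E\<^esub> y = \<zero>\<^bsub>E\<^esub>"
    by (rule torsion_free_power[OF E tf E.M.a_closed[OF x c(1)]])
  then show ?thesis by (rule E.M.eq_of_minus_zero[OF x y])
qed

lemma torsion_free_rank_one_rep: "torsion_free n (rank_one_rep n I)"
  unfolding torsion_free_def rank_one_rep_simps
proof (intro ballI impI ext)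
  fix v :: "nat \<Rightarrow> complex fps" and j
  assume v: "v \<in> {1..n} \<rightarrow>\<^sub>E UNIV" and 0: "rank_one_act n I (scal n fps_X) v = (\<lambda>j\<in>{1..n}. 0)"
  show "v j = (\<lambda>j\<in>{1..n}. 0) j"
  proof (cases "j \<in> {1..n}")
    case True
    then show ?thesis using fun_cong[OF 0[unfolded rank_one_act_scal[OF v]], of j] by simp
  next
    case False
    then show ?thesis using PiE_arb[OF v False] by (simp only: restrict_apply if_False)
  qed
qed

section \<open>Direct sums and extensions of torsion-free modules\<close>

lemma direct_sum_module_simps:
  "carrier (direct_sum_module S F) = (\<Pi>\<^sub>E i\<in>S. carrier (F i))"
  "\<zero>\<^bsub>direct_sum_module S F\<^esub> = (\<lambda>i\<in>S. \<zero>\<^bsub>F i\<^esub>)"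
  "v \<oplus>\<^bsub>direct_sum_module S F\<^esub> w = (\<lambda>i\<in>S. v i \<oplus>\<^bsub>F i\<^esub> w i)"
  "a \<odot>\<^bsub>direct_sum_module S F\<^esub> v = (\<lambda>i\<in>S. a \<odot>\<^bsub>F i\<^esub> v i)"
  by (simp_all add: direct_sum_module_def)

lemma left_module_direct_sum:
  assumes R: "ring R" and F: "\<And>i. i \<in> S \<Longrightarrow> left_module R (F i)"
  shows "left_module R (direct_sum_module S F)"
proof -
  have ag: "abelian_group (F i)" if "i \<in> S" for i using F[OF that] by (simp add: left_module_def)
  then have am: "abelian_monoid (F i)" if "i \<in> S" for i using that by (simp add: abelian_group_def)
  show ?thesis
  proof (intro left_module.intro left_module_axioms.intro R)
    show "abelian_group (direct_sum_module S F)"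
    proof (rule abelian_groupI)
      fix x assume "x \<in> carrier (direct_sum_module S F)"
      then show "\<exists>y\<in>carrier (direct_sum_module S F). y \<oplus>\<^bsub>direct_sum_module S F\<^esub> x = \<zero>\<^bsub>direct_sum_module S F\<^esub>"
        using ag by (intro bexI[of _ "\<lambda>i\<in>S. \<ominus>\<^bsub>F i\<^esub> x i"])
          (auto simp: direct_sum_module_simps PiE_iff abelian_group.l_neg abelian_group.a_inv_closed
            intro!: restrict_ext)
    qed (auto simp: direct_sum_module_simps PiE_iff abelian_monoid.a_closed[OF am] abelian_monoid.a_assoc[OF am]
        abelian_monoid.zero_closed[OF am] abelian_monoid.l_zero[OF am] extensional_def fun_eq_iff
        intro: abelian_monoid.a_comm[OF am])
  qed (auto simp: direct_sum_module_simps PiE_iff extensional_def fun_eq_iff left_module.smult_closed[OF F]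
      left_module.smult_l_distr[OF F] left_module.smult_r_distr[OF F] left_module.smult_assoc[OF F]
      left_module.smult_one[OF F])
qed

lemma torsion_free_direct_sum:
  assumes tf: "\<And>i. i \<in> S \<Longrightarrow> torsion_free n (F i)"
  shows "torsion_free n (direct_sum_module S F)"
  unfolding torsion_free_def direct_sum_module_simps
proof (intro ballI impI ext)
  fix v i assume v: "v \<in> (\<Pi>\<^sub>E i\<in>S. carrier (F i))"
    and 0: "(\<lambda>i\<in>S. scal n fps_X \<odot>\<^bsub>F i\<^esub> v i) = (\<lambda>i\<in>S. \<zero>\<^bsub>F i\<^esub>)"
  show "v i = (\<lambda>i\<in>S. \<zero>\<^bsub>F i\<^esub>) i"
    using tf[of i] v fun_cong[OF 0, of i] by (cases "i \<in> S") (auto simp: torsion_free_def PiE_iff extensional_def)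
qed

lemma torsion_free_inj:
  assumes f: "f \<in> lmod_hom (path_algebra n) M N" and M: "left_module (path_algebra n) M"
    and N: "left_module (path_algebra n) N"
    and inj: "inj_on f (carrier M)" and tf: "torsion_free n N"
  shows "torsion_free n M"
  unfolding torsion_free_def
proof safe
  interpret M: left_module "path_algebra n" M by (rule M)
  fix x assume x: "x \<in> carrier M" "scal n fps_X \<odot>\<^bsub>M\<^esub> x = \<zero>\<^bsub>M\<^esub>"
  then have "scal n fps_X \<odot>\<^bsub>N\<^esub> f x = \<zero>\<^bsub>N\<^esub>"
    using lmod_homD(3)[OF f scal_closed[of n fps_X] x(1)] lmod_hom_zero[OF f M N] by simp
  then have "f x = f \<zero>\<^bsub>M\<^esub>"
    using tf lmod_homD(1)[OF f x(1)] lmod_hom_zero[OF f M N] by (simp add: torsion_free_def)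
  then show "x = \<zero>\<^bsub>M\<^esub>" using inj x(1) by (auto dest: inj_onD)
qed

text \<open>Needed for the middle term of an extension of B-modules: a section that is linear over
  the path algebra is then B-linear as well.\<close>

lemma torsion_free_extension:
  assumes ses: "short_exact (path_algebra n) N f E g M"
    and N: "left_module (path_algebra n) N" and E: "left_module (path_algebra n) E"
    and M: "left_module (path_algebra n) M"
    and tN: "torsion_free n N" and tM: "torsion_free n M"
  shows "torsion_free n E"
  unfolding torsion_free_def
proof safe
  interpret N: left_module "path_algebra n" N by (rule N)
  have f: "f \<in> lmod_hom (path_algebra n) N E" "inj_on f (carrier N)"
      "f ` carrier N = {e \<in> carrier E. g e = \<zero>\<^bsub>M\<^esub>}"
    and g: "g \<in> lmod_hom (path_algebra n) E M"
    using ses by (auto simp: short_exact_def)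
  fix x assume x: "x \<in> carrier E" "scal n fps_X \<odot>\<^bsub>E\<^esub> x = \<zero>\<^bsub>E\<^esub>"
  then have "scal n fps_X \<odot>\<^bsub>M\<^esub> g x = \<zero>\<^bsub>M\<^esub>"
    using lmod_homD(3)[OF g scal_closed[of n fps_X] x(1)] lmod_hom_zero[OF g E M] by simp
  then have "g x = \<zero>\<^bsub>M\<^esub>" using tM lmod_homD(1)[OF g x(1)] by (simp add: torsion_free_def)
  then obtain y where y: "y \<in> carrier N" "x = f y" using f(3) x(1) by blast
  then have "f (scal n fps_X \<odot>\<^bsub>N\<^esub> y) = f \<zero>\<^bsub>N\<^esub>"
    using x(2) lmod_homD(3)[OF f(1) scal_closed[of n fps_X] y(1)] lmod_hom_zero[OF f(1) N E] by simp
  then have "scal n fps_X \<odot>\<^bsub>N\<^esub> y = \<zero>\<^bsub>N\<^esub>"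
    using f(2) y(1) N.smult_closed[OF scal_closed[of n fps_X] y(1)] by (auto dest: inj_onD)
  then show "x = \<zero>\<^bsub>E\<^esub>"
    using tN y lmod_hom_zero[OF f(1) N E] by (auto simp: torsion_free_def)
qed

text \<open>\<open>N'\<close> is the \<open>C\<close>-module \<open>N\<close>, viewed as a module over the path algebra.\<close>

definition pulls_back ::
    "nat \<Rightarrow> nat \<Rightarrow> ((qpath \<Rightarrow> complex fps) set, 'm) module \<Rightarrow> (qpath \<Rightarrow> complex fps, 'm) module \<Rightarrow> bool" where
  "pulls_back k n N N' \<longleftrightarrow> carrier N = carrier N' \<and> add N = add N' \<and>
     (\<forall>f\<in>carrier (path_algebra n). \<forall>x\<in>carrier N.
        (circle_ideal k n fps_X +>\<^bsub>path_algebra n\<^esub> f) \<odot>\<^bsub>N\<^esub> x = f \<odot>\<^bsub>N'\<^esub> x)"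

text \<open>The path algebra surjects onto C, so linearity over the one is linearity over the
  other.\<close>

lemma lmod_hom_pulls_back:
  assumes "pulls_back k n M M'" "pulls_back k n N N'"
  shows "lmod_hom (Calg k n) M N = lmod_hom (path_algebra n) M' N'"
  using assms unfolding pulls_back_def lmod_hom_def circle_algebra_carrier by (auto simp: Pi_iff)

lemma pulls_back_as_C_module: "pulls_back k n (as_C_module k n M) (restrict_scalars (to_Cloc k n) M)"
  by (auto simp: pulls_back_def as_C_module_def restrict_scalars_def C_to_Cloc_coset)

lemma pulls_back_rank_one:
  assumes "I \<in> k_subsets k n" "k \<le> n"
  shows "pulls_back k n (rank_one_module n I) (rank_one_rep n I)"
  unfolding pulls_back_def
proof (intro conjI ballI)
  fix f :: "qpath \<Rightarrow> complex fps" and v :: "nat \<Rightarrow> complex fps"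
  assume f: "f \<in> carrier (path_algebra n)" and "v \<in> carrier (rank_one_module n I)"
  then have v: "v \<in> {1..n} \<rightarrow>\<^sub>E UNIV" unfolding rank_one_module_def by simp
  show "(circle_ideal k n fps_X +>\<^bsub>path_algebra n\<^esub> f) \<odot>\<^bsub>rank_one_module n I\<^esub> v =
      f \<odot>\<^bsub>rank_one_rep n I\<^esub> v"
    unfolding rank_one_rep_simps by (rule rank_one_module_coset[OF assms f v])
qed (simp_all add: rank_one_module_def rank_one_rep_def)

lemma pulls_back_direct_sum:
  assumes "\<And>i. i \<in> S \<Longrightarrow> pulls_back k n (F i) (F' i)"
  shows "pulls_back k n (direct_sum_module S F) (direct_sum_module S F')"
proof -
  have F: "carrier (F i) = carrier (F' i)" "add (F i) = add (F' i)"
    "\<And>f x. f \<in> carrier (path_algebra n) \<Longrightarrow> x \<in> carrier (F i) \<Longrightarrow>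
        (circle_ideal k n fps_X +>\<^bsub>path_algebra n\<^esub> f) \<odot>\<^bsub>F i\<^esub> x = f \<odot>\<^bsub>F' i\<^esub> x" if "i \<in> S" for i
    using assms[OF that] by (auto simp: pulls_back_def)
  have "(\<Pi>\<^sub>E i\<in>S. carrier (F i)) = (\<Pi>\<^sub>E i\<in>S. carrier (F' i))"
    using F(1) by (rule PiE_cong)
  moreover have "(\<lambda>v w. \<lambda>i\<in>S. v i \<oplus>\<^bsub>F i\<^esub> w i) = (\<lambda>v w. \<lambda>i\<in>S. v i \<oplus>\<^bsub>F' i\<^esub> w i)"
    by (intro ext restrict_ext) (simp add: F(2))
  ultimately show ?thesis
    unfolding pulls_back_def direct_sum_module_def by (auto simp: F(1) F(3) PiE_iff intro!: restrict_ext)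
qed

section \<open>Modules over an order and their restriction to the path algebra\<close>

locale circle_order =
  fixes k n :: nat and B :: "(qpath \<Rightarrow> complex fls) set set"
  assumes k: "k \<le> n" and order: "is_order k n B"
begin

abbreviation "BR \<equiv> order_ring k n B"
abbreviation "A \<equiv> path_algebra n :: (qpath \<Rightarrow> complex fps) ring"
abbreviation "res M \<equiv> restrict_scalars (to_Cloc k n) M"
abbreviation "Reg \<equiv> regular_module BR"

sublocale Cl: ring "Cloc k n" by (rule ring_circle_algebra)

lemma B_subring: "subring B (Cloc k n)" using order by (simp add: is_order_def)

sublocale BR: ring BR using Cl.subring_is_ring[OF B_subring] .

lemma B_carrier: "b \<in> B \<Longrightarrow> b \<in> carrier (Cloc k n)"
  using subringE(1)[OF B_subring] by blast

lemma to_Cloc_B: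
  assumes f: "f \<in> carrier A"
  shows "to_Cloc k n f \<in> B"
proof -
  have "circle_ideal k n fps_X +>\<^bsub>A\<^esub> f \<in> carrier (Calg k n)"
    unfolding circle_algebra_carrier using f by blast
  then show ?thesis
    using order C_to_Cloc_coset[OF f, of k] unfolding is_order_def by (metis image_subset_iff)
qed

lemma to_Cloc_BR: "to_Cloc k n \<in> ring_hom A BR"
  using to_Cloc_hom[of k n] to_Cloc_B by (auto simp: ring_hom_def)

lemma B_denominator:
  assumes "b \<in> B"
  shows "\<exists>N. \<exists>f\<in>carrier A. to_Cloc k n (scal n (fps_X ^ N)) \<otimes>\<^bsub>BR\<^esub> b = to_Cloc k n f"
  using Cloc_denominator[OF B_carrier[OF assms]] by simp

lemma left_module_res: "left_module BR M \<Longrightarrow> left_module A (res M)"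
  by (rule left_module_restrict_scalars[OF _ ring_path_algebra to_Cloc_BR])

lemma res_circle_ideal:
  assumes M: "left_module BR M" and f: "f \<in> circle_ideal k n fps_X" and x: "x \<in> carrier M"
  shows "f \<odot>\<^bsub>res M\<^esub> x = \<zero>\<^bsub>res M\<^esub>"
  using left_module.smult_l_null[OF M x] to_Cloc_zero[OF f] by (simp add: restrict_scalars_simps)

lemma lmod_hom_res: "lmod_hom BR M N \<subseteq> lmod_hom A (res M) (res N)"
  using to_Cloc_B by (auto simp: lmod_hom_def restrict_scalars_simps)

text \<open>A power of \<open>t\<close> moves \<open>b \<in> B\<close> into \<open>C\<close>, and \<open>t\<close> is injective on \<open>N\<close>.\<close>

lemma lmod_hom_extend:
  assumes h: "h \<in> lmod_hom A (res M) (res N)" and M: "left_module BR M" and N: "left_module BR N"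
    and tf: "torsion_free n (res N)"
  shows "h \<in> lmod_hom BR M N"
proof -
  interpret M: left_module BR M by (rule M)
  interpret N: left_module BR N by (rule N)
  have "h (b \<odot>\<^bsub>M\<^esub> x) = b \<odot>\<^bsub>N\<^esub> h x" if b: "b \<in> B" and x: "x \<in> carrier M" for b x
  proof -
    let ?t = "\<lambda>N. to_Cloc k n (scal n (fps_X ^ N))"
    obtain L f where f: "f \<in> carrier A" "?t L \<otimes>\<^bsub>BR\<^esub> b = to_Cloc k n f"
      using B_denominator[OF b] by blast
    have t: "?t L \<in> carrier BR" using to_Cloc_B scal_closed by auto
    have b': "b \<in> carrier BR" using b by simp
    have hx: "h x \<in> carrier N" and hbx: "h (b \<odot>\<^bsub>M\<^esub> x) \<in> carrier N"
      using lmod_homD(1)[OF h] x M.smult_closed[OF b' x] by (auto simp: restrict_scalars_simps)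
    have "?t L \<odot>\<^bsub>N\<^esub> h (b \<odot>\<^bsub>M\<^esub> x) = h (?t L \<odot>\<^bsub>M\<^esub> (b \<odot>\<^bsub>M\<^esub> x))"
      using lmod_homD(3)[OF h scal_closed[of n "fps_X ^ L"], of "b \<odot>\<^bsub>M\<^esub> x"] M.smult_closed[OF b' x]
      by (simp add: restrict_scalars_simps)
    also have "\<dots> = h (to_Cloc k n f \<odot>\<^bsub>M\<^esub> x)" using M.smult_assoc[OF t b' x] f(2) by simp
    also have "\<dots> = to_Cloc k n f \<odot>\<^bsub>N\<^esub> h x"
      using lmod_homD(3)[OF h f(1), of x] x by (simp add: restrict_scalars_simps)
    also have "\<dots> = ?t L \<odot>\<^bsub>N\<^esub> (b \<odot>\<^bsub>N\<^esub> h x)" using N.smult_assoc[OF t b' hx] f(2) by simp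
    finally show ?thesis
      using torsion_free_cancel[OF left_module_res[OF N] tf, of "h (b \<odot>\<^bsub>M\<^esub> x)" "b \<odot>\<^bsub>N\<^esub> h x" L] hbx
        N.smult_closed[OF b' hx] by (simp add: restrict_scalars_simps)
  qed
  then show ?thesis using h by (auto simp: lmod_hom_def restrict_scalars_simps)
qed

lemma Reg_simps:
  "carrier Reg = B" "\<zero>\<^bsub>Reg\<^esub> = \<zero>\<^bsub>BR\<^esub>" "x \<oplus>\<^bsub>Reg\<^esub> y = x \<oplus>\<^bsub>BR\<^esub> y" "b \<odot>\<^bsub>Reg\<^esub> x = b \<otimes>\<^bsub>BR\<^esub> x"
  by (simp_all add: regular_module_def)

lemma left_module_Reg: "left_module BR Reg"
proof (intro left_module.intro left_module_axioms.intro BR.ring_axioms)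
  show "abelian_group Reg"
  proof (rule abelian_groupI)
    fix x assume "x \<in> carrier Reg"
    then show "\<exists>y\<in>carrier Reg. y \<oplus>\<^bsub>Reg\<^esub> x = \<zero>\<^bsub>Reg\<^esub>"
      using BR.l_neg[of x] BR.a_inv_closed[of x] by (auto simp: regular_module_def)
  qed (use BR.a_closed BR.zero_closed BR.a_assoc BR.a_comm BR.l_zero in \<open>simp_all add: regular_module_def\<close>)
qed (use BR.m_closed BR.m_assoc BR.l_distr BR.r_distr BR.l_one in \<open>simp_all add: regular_module_def\<close>)

end

lemma (in left_module) submodule_of_closed:
  assumes sub: "H \<subseteq> carrier M" and z: "\<zero>\<^bsub>M\<^esub> \<in> H" and a: "\<And>x y. x \<in> H \<Longrightarrow> y \<in> H \<Longrightarrow> x \<oplus>\<^bsub>M\<^esub> y \<in> H"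
    and s: "\<And>a x. a \<in> carrier R \<Longrightarrow> x \<in> H \<Longrightarrow> a \<odot>\<^bsub>M\<^esub> x \<in> H"
  shows "submodule H R M"
proof (intro submodule.intro submodule_axioms.intro s)
  have "\<ominus>\<^bsub>M\<^esub> x \<in> H" if x: "x \<in> H" for x
  proof -
    have xc: "x \<in> carrier M" using x sub by blast
    have "(\<ominus> \<one>) \<odot>\<^bsub>M\<^esub> x = \<ominus>\<^bsub>M\<^esub> (\<one> \<odot>\<^bsub>M\<^esub> x)" by (rule smult_l_minus[OF R.one_closed xc])
    also have "\<dots> = \<ominus>\<^bsub>M\<^esub> x" unfolding smult_one[OF xc] ..
    finally show ?thesis using s[of "\<ominus> \<one>" x] x by simp
  qed
  then show "subgroup H (add_monoid M)"
    using sub z a by (intro M.add.subgroupI) (auto simp flip: a_inv_def)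
qed

context circle_order begin

lemma left_module_res_Reg: "left_module A (res Reg)"
  by (rule left_module_res[OF left_module_Reg])

end

section \<open>Rank one quotients of the order\<close>

locale rank_one_quotient = circle_order +
  fixes I :: "nat set" and \<Phi> :: "(qpath \<Rightarrow> complex fls) set \<Rightarrow> nat \<Rightarrow> complex fps"
  assumes I: "I \<in> k_subsets k n" and hom: "\<Phi> \<in> lmod_hom A (res Reg) (rank_one_rep n I)"
    and surj: "\<Phi> ` B = {1..n} \<rightarrow>\<^sub>E UNIV"
begin

text \<open>\<open>M\<^sub>I\<close> with the \<open>B\<close>-module structure of the quotient of \<open>B\<close> by the kernel of \<open>\<Phi>\<close>.\<close>

definition Q :: "((qpath \<Rightarrow> complex fls) set, nat \<Rightarrow> complex fps) module" where
  "Q = \<lparr>carrier = {1..n} \<rightarrow>\<^sub>E UNIV, mult = undefined, one = undefined,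
     zero = (\<lambda>j\<in>{1..n}. 0), add = (\<lambda>v w. \<lambda>j\<in>{1..n}. v j + w j),
     smult = (\<lambda>b v. \<Phi> (b \<otimes>\<^bsub>BR\<^esub> inv_into B \<Phi> v))\<rparr>"

lemma Q_simps:
  "carrier Q = {1..n} \<rightarrow>\<^sub>E UNIV" "\<zero>\<^bsub>Q\<^esub> = (\<lambda>j\<in>{1..n}. 0)" "v \<oplus>\<^bsub>Q\<^esub> w = (\<lambda>j\<in>{1..n}. v j + w j)"
  "b \<odot>\<^bsub>Q\<^esub> v = \<Phi> (b \<otimes>\<^bsub>BR\<^esub> inv_into B \<Phi> v)"
  by (simp_all add: Q_def)

lemma \<Phi>_closed: "x \<in> B \<Longrightarrow> \<Phi> x \<in> {1..n} \<rightarrow>\<^sub>E UNIV"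
  using surj by blast

lemma \<Phi>_surj: "v \<in> {1..n} \<rightarrow>\<^sub>E UNIV \<Longrightarrow> \<exists>x\<in>B. \<Phi> x = v"
  unfolding surj[symmetric] by blast

lemma B_mult: "x \<in> B \<Longrightarrow> y \<in> B \<Longrightarrow> x \<otimes>\<^bsub>BR\<^esub> y \<in> B"
  using BR.m_closed[of x y] by simp

lemma B_add: "x \<in> B \<Longrightarrow> y \<in> B \<Longrightarrow> x \<oplus>\<^bsub>BR\<^esub> y \<in> B"
  using BR.a_closed[of x y] by simp

lemma \<Phi>_add: "x \<in> B \<Longrightarrow> y \<in> B \<Longrightarrow> \<Phi> (x \<oplus>\<^bsub>BR\<^esub> y) = \<Phi> x \<oplus>\<^bsub>Q\<^esub> \<Phi> y"
  using lmod_homD(2)[OF hom, of x y] unfolding restrict_scalars_simps Reg_simps Q_simps rank_one_rep_simps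
  by blast

lemma \<Phi>_act: "x \<in> B \<Longrightarrow> f \<in> carrier A \<Longrightarrow> \<Phi> (to_Cloc k n f \<otimes>\<^bsub>BR\<^esub> x) = rank_one_act n I f (\<Phi> x)"
  using lmod_homD(3)[OF hom, of f x] unfolding restrict_scalars_simps Reg_simps rank_one_rep_simps
  by blast

text \<open>The kernel of \<Phi> is given only as a submodule over the path algebra. For b \<in> B
  some t^L b comes from that algebra, and t^L acts injectively on M_I, so the kernel is stable under
  b too.\<close>

lemma \<Phi>_well_defined:
  assumes b: "b \<in> B" and x: "x \<in> B" and y: "y \<in> B" and eq: "\<Phi> x = \<Phi> y"
  shows "\<Phi> (b \<otimes>\<^bsub>BR\<^esub> x) = \<Phi> (b \<otimes>\<^bsub>BR\<^esub> y)"
proof -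
  obtain L f where f: "f \<in> carrier A" "to_Cloc k n (scal n (fps_X ^ L)) \<otimes>\<^bsub>BR\<^esub> b = to_Cloc k n f"
    using B_denominator[OF b] by blast
  let ?t = "scal n (fps_X ^ L) :: qpath \<Rightarrow> complex fps"
  have t: "to_Cloc k n ?t \<in> B" by (rule to_Cloc_B[OF scal_closed])
  have *: "rank_one_act n I ?t (\<Phi> (b \<otimes>\<^bsub>BR\<^esub> z)) = rank_one_act n I f (\<Phi> z)" if z: "z \<in> B" for z
  proof -
    have "rank_one_act n I ?t (\<Phi> (b \<otimes>\<^bsub>BR\<^esub> z)) = \<Phi> (to_Cloc k n ?t \<otimes>\<^bsub>BR\<^esub> (b \<otimes>\<^bsub>BR\<^esub> z))"
      by (rule \<Phi>_act[OF B_mult[OF b z] scal_closed, symmetric])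
    also have "to_Cloc k n ?t \<otimes>\<^bsub>BR\<^esub> (b \<otimes>\<^bsub>BR\<^esub> z) = to_Cloc k n f \<otimes>\<^bsub>BR\<^esub> z"
      unfolding f(2)[symmetric] by (rule BR.m_assoc[symmetric]) (use t b z in simp_all)
    also have "\<Phi> \<dots> = rank_one_act n I f (\<Phi> z)" by (rule \<Phi>_act[OF z f(1)])
    finally show ?thesis .
  qed
  show ?thesis
    by (rule torsion_free_cancel[OF left_module_rank_one_rep[of n I] torsion_free_rank_one_rep[of n I], where N = L])
      (use * x y eq \<Phi>_closed B_mult b in \<open>simp_all add: rank_one_rep_simps\<close>)
qed

lemma Q_smult: "b \<in> B \<Longrightarrow> x \<in> B \<Longrightarrow> b \<odot>\<^bsub>Q\<^esub> \<Phi> x = \<Phi> (b \<otimes>\<^bsub>BR\<^esub> x)"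
  unfolding Q_simps by (rule \<Phi>_well_defined) (auto intro: inv_into_into f_inv_into_f)

lemma abelian_group_Q: "abelian_group Q"
  unfolding Q_def by (rule abelian_group_vectors)

lemma left_module_Q: "left_module BR Q"
proof (intro left_module.intro left_module_axioms.intro BR.ring_axioms abelian_group_Q)
  fix a v assume a: "a \<in> carrier BR" and v: "v \<in> carrier Q"
  obtain x where x: "x \<in> B" "v = \<Phi> x" using v \<Phi>_surj unfolding Q_simps by blast
  have a': "a \<in> B" using a by simp
  show "a \<odot>\<^bsub>Q\<^esub> v \<in> carrier Q"
    unfolding x(2) Q_smult[OF a' x(1)] Q_simps(1) by (rule \<Phi>_closed[OF B_mult[OF a' x(1)]])
  fix b assume b: "b \<in> carrier BR"
  have b': "b \<in> B" using b by simp
  have ab: "a \<oplus>\<^bsub>BR\<^esub> b \<in> B" "a \<otimes>\<^bsub>BR\<^esub> b \<in> B" by (rule B_add[OF a' b'], rule B_mult[OF a' b'])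
  have x': "x \<in> carrier BR" using x by simp
  show "(a \<oplus>\<^bsub>BR\<^esub> b) \<odot>\<^bsub>Q\<^esub> v = a \<odot>\<^bsub>Q\<^esub> v \<oplus>\<^bsub>Q\<^esub> b \<odot>\<^bsub>Q\<^esub> v"
    unfolding x(2) Q_smult[OF ab(1) x(1)] Q_smult[OF a' x(1)] Q_smult[OF b' x(1)] BR.l_distr[OF a b x']
    by (intro \<Phi>_add B_mult a' b' x(1))
  show "(a \<otimes>\<^bsub>BR\<^esub> b) \<odot>\<^bsub>Q\<^esub> v = a \<odot>\<^bsub>Q\<^esub> (b \<odot>\<^bsub>Q\<^esub> v)"
    unfolding x(2) Q_smult[OF ab(2) x(1)] Q_smult[OF b' x(1)] Q_smult[OF a' B_mult[OF b' x(1)]] BR.m_assoc[OF a b x'] ..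
next
  fix a v w assume a: "a \<in> carrier BR" and v: "v \<in> carrier Q" and w: "w \<in> carrier Q"
  obtain x where x: "x \<in> B" "v = \<Phi> x" using v \<Phi>_surj unfolding Q_simps by blast
  obtain y where y: "y \<in> B" "w = \<Phi> y" using w \<Phi>_surj unfolding Q_simps by blast
  have c: "a \<in> B" "x \<in> carrier BR" "y \<in> carrier BR" using a x y by simp_all
  show "a \<odot>\<^bsub>Q\<^esub> (v \<oplus>\<^bsub>Q\<^esub> w) = a \<odot>\<^bsub>Q\<^esub> v \<oplus>\<^bsub>Q\<^esub> a \<odot>\<^bsub>Q\<^esub> w"
    unfolding x(2) y(2) \<Phi>_add[OF x(1) y(1), symmetric] Q_smult[OF c(1) B_add[OF x(1) y(1)]]
      Q_smult[OF c(1) x(1)] Q_smult[OF c(1) y(1)] BR.r_distr[OF c(2,3) a]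
    by (intro \<Phi>_add B_mult c x(1) y(1))
next
  fix v assume v: "v \<in> carrier Q"
  obtain x where x: "x \<in> B" "v = \<Phi> x" using v \<Phi>_surj unfolding Q_simps by blast
  have c: "\<one>\<^bsub>BR\<^esub> \<in> B" "x \<in> carrier BR" using BR.one_closed x by simp_all
  show "\<one>\<^bsub>BR\<^esub> \<odot>\<^bsub>Q\<^esub> v = v"
    unfolding x(2) Q_smult[OF c(1) x(1)] BR.l_one[OF c(2)] ..
qed

lemma Q_act:
  assumes f: "f \<in> carrier A" and v: "v \<in> {1..n} \<rightarrow>\<^sub>E UNIV"
  shows "to_Cloc k n f \<odot>\<^bsub>Q\<^esub> v = rank_one_act n I f v"
proof -
  obtain x where x: "x \<in> B" "v = \<Phi> x" using v \<Phi>_surj by blast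
  show ?thesis unfolding x(2) Q_smult[OF to_Cloc_B[OF f] x(1)] by (rule \<Phi>_act[OF x(1) f])
qed

lemma lmod_hom_from_Q: "lmod_hom A (res Q) N = lmod_hom A (rank_one_rep n I) N"
  unfolding lmod_hom_def restrict_scalars_simps Q_simps(1-3) rank_one_rep_simps
  by (simp add: Q_act cong: conj_cong ball_cong)

lemma lmod_hom_to_Q: "lmod_hom A N (res Q) = lmod_hom A N (rank_one_rep n I)"
  unfolding lmod_hom_def restrict_scalars_simps Q_simps(1-3) rank_one_rep_simps
  by (auto simp: Q_act Pi_iff simp del: One_nat_def)

lemma torsion_free_Q: "torsion_free n (res Q)"
  using torsion_free_rank_one_rep[of n I] unfolding torsion_free_def restrict_scalars_simps Q_simps(1-3) rank_one_rep_simps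
  by (simp add: Q_act scal_closed)

lemma \<Phi>_BR_hom: "\<Phi> \<in> lmod_hom BR Reg Q"
  by (intro lmod_hom_extend left_module_Reg left_module_Q torsion_free_Q) (unfold lmod_hom_to_Q, rule hom)

lemma Q_iso: "lmod_iso (Calg k n) (rank_one_module n I) (as_C_module k n Q)"
proof -
  have "(\<lambda>v. v) \<in> lmod_hom A (rank_one_rep n I) (res Q)"
    unfolding lmod_hom_to_Q by (auto simp: lmod_hom_def)
  then have "(\<lambda>v. v) \<in> lmod_hom (Calg k n) (rank_one_module n I) (as_C_module k n Q)"
    unfolding lmod_hom_pulls_back[OF pulls_back_rank_one[OF I k] pulls_back_as_C_module] .
  moreover have "carrier (rank_one_module n I) = carrier (as_C_module k n Q)"
    unfolding as_C_module_def restrict_scalars_simps Q_simps by (simp add: rank_one_module_def)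
  ultimately show ?thesis unfolding lmod_iso_def bij_betw_def by (intro bexI[of _ "\<lambda>v. v"]) auto
qed

lemma as_R_module_Q:
  "carrier (as_R_module k n Q) = {1..n} \<rightarrow>\<^sub>E UNIV"
  "\<zero>\<^bsub>as_R_module k n Q\<^esub> = (\<lambda>j\<in>{1..n}. 0)"
  "v \<oplus>\<^bsub>as_R_module k n Q\<^esub> w = (\<lambda>j\<in>{1..n}. v j + w j)"
  "v \<in> {1..n} \<rightarrow>\<^sub>E UNIV \<Longrightarrow> r \<odot>\<^bsub>as_R_module k n Q\<^esub> v = (\<lambda>j\<in>{1..n}. r * v j)"
  unfolding as_R_module_def as_C_module_def restrict_scalars_simps Q_simps(1-3)
  by (rule refl)+ (use Q_act[OF scal_closed, of v r] rank_one_act_scal[of v n I r] C_to_Cloc_coset[OF scal_closed, of k n r]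
      in \<open>simp add: R_to_C_def scal_def\<close>)

lemma abelian_group_R_Q: "abelian_group (as_R_module k n Q)"
  unfolding as_R_module_def as_C_module_def restrict_scalars_def Q_def
  by simp (rule abelian_group_vectors[simplified])

lemma free_Q: "free_module fps_ring (as_R_module k n Q)"
proof -
  let ?W = "as_R_module k n Q"
  let ?d = "\<lambda>j. \<lambda>i\<in>{1..n}. if i = j then 1 else (0 :: complex fps)"
  let ?S = "?d ` {1..n}"
  have dinj: "j = j'" if "?d j = ?d j'" "j \<in> {1..n}" for j j'
    using fun_cong[OF that(1), of j] that(2) by (auto split: if_splits)
  have inj: "inj_on ?d {1..n}" by (rule inj_onI) (rule dinj)
  have lin: "finsum ?W (\<lambda>s. c s \<odot>\<^bsub>?W\<^esub> s) {s \<in> ?S. c s \<noteq> 0} = (\<lambda>i\<in>{1..n}. c (?d i))" for c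
  proof -
    have S: "s \<in> {1..n} \<rightarrow>\<^sub>E UNIV" if "s \<in> ?S" for s using that by auto
    have "finsum ?W (\<lambda>s. c s \<odot>\<^bsub>?W\<^esub> s) {s \<in> ?S. c s \<noteq> 0} =
        (\<lambda>i\<in>{1..n}. \<Sum>s\<in>{s \<in> ?S. c s \<noteq> 0}. (c s \<odot>\<^bsub>?W\<^esub> s) i)"
      by (rule finsum_vectors[OF abelian_group_R_Q as_R_module_Q(1-3)])
        (use S in \<open>auto simp: as_R_module_Q simp del: One_nat_def\<close>)
    also have "\<dots> = (\<lambda>i\<in>{1..n}. c (?d i))"
    proof (rule restrict_ext)
      fix i assume i: "i \<in> {1..n}"
      have "(\<Sum>s\<in>{s \<in> ?S. c s \<noteq> 0}. (c s \<odot>\<^bsub>?W\<^esub> s) i) = (\<Sum>s\<in>?S. c s * s i)"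
        by (rule sum.mono_neutral_cong_left) (use i S in \<open>auto simp: as_R_module_Q simp del: One_nat_def atLeastAtMost_iff\<close>)
      also have "\<dots> = (\<Sum>j\<in>{1..n}. c (?d j) * ?d j i)"
        unfolding sum.reindex[OF inj] o_def ..
      also have "\<dots> = (\<Sum>j\<in>{1..n}. if j = i then c (?d i) else 0)"
        using i by (intro sum.cong refl) auto
      also have "\<dots> = c (?d i)" using i by simp
      finally show "(\<Sum>s\<in>{s \<in> ?S. c s \<noteq> 0}. (c s \<odot>\<^bsub>?W\<^esub> s) i) = c (?d i)" .
    qed
    finally show ?thesis .
  qed
  show ?thesis
    unfolding free_module_def
  proof (intro exI[of _ ?S] conjI ballI)
    show "?S \<subseteq> carrier ?W" unfolding as_R_module_Q by auto
    fix x assume x: "x \<in> carrier ?W"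
    have zero: "\<zero>\<^bsub>fps_ring\<^esub> = 0" "carrier fps_ring = UNIV" by (simp_all add: fps_ring_def)
    \<comment> \<open>A coefficient function takes the basis vector itself as argument, so the index
      of a unit vector has to be recovered from the vector; the coefficient is the coordinate of x
      there.\<close>
    define c0 where "c0 = (\<lambda>s\<in>?S. x (THE j. j \<in> {1..n} \<and> s = ?d j))"
    have c0: "c0 (?d j) = x j" if j: "j \<in> {1..n}" for j
    proof -
      have "(THE j'. j' \<in> {1..n} \<and> ?d j = ?d j') = j"
        using j dinj by (intro the_equality) blast+
      then show ?thesis using j unfolding c0_def by simp
    qed
    show "\<exists>!c. c \<in> ?S \<rightarrow>\<^sub>E carrier fps_ring \<and> finite {s \<in> ?S. c s \<noteq> \<zero>\<^bsub>fps_ring\<^esub>} \<and>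
        x = (\<Oplus>\<^bsub>?W\<^esub>s\<in>{s \<in> ?S. c s \<noteq> \<zero>\<^bsub>fps_ring\<^esub>}. c s \<odot>\<^bsub>?W\<^esub> s)"
      unfolding zero lin
    proof (rule ex1I[of _ c0])
      have "x = (\<lambda>i\<in>{1..n}. c0 (?d i))"
      proof
        fix i show "x i = (\<lambda>i\<in>{1..n}. c0 (?d i)) i"
          using x c0[of i] unfolding as_R_module_Q by (cases "i \<in> {1..n}") (auto dest: PiE_arb)
      qed
      then show "c0 \<in> ?S \<rightarrow>\<^sub>E UNIV \<and> finite {s \<in> ?S. c0 s \<noteq> 0} \<and> x = (\<lambda>i\<in>{1..n}. c0 (?d i))"
        unfolding c0_def by simp
      fix c assume c: "c \<in> ?S \<rightarrow>\<^sub>E UNIV \<and> finite {s \<in> ?S. c s \<noteq> 0} \<and> x = (\<lambda>i\<in>{1..n}. c (?d i))"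
      show "c = c0"
      proof
        fix s show "c s = c0 s"
        proof (cases "s \<in> ?S")
          case True
          then obtain j where j: "j \<in> {1..n}" "s = ?d j" by blast
          have "x = (\<lambda>i\<in>{1..n}. c (?d i))" using c by blast
          then have "x j = c (?d j)" using j(1) by simp
          then show ?thesis unfolding j(2) c0[OF j(1)] by (rule sym)
        next
          case False
          then show ?thesis using PiE_arb[OF conjunct1[OF c] False] unfolding c0_def restrict_apply by (simp only: if_False)
        qed
      qed
    qed
  qed
qed

lemma in_CM_Q: "in_CM k n B Q"
  unfolding in_CM_def
proof (intro conjI left_module_Q free_Q)
  interpret Q: left_module BR Q by (rule left_module_Q)
  have one: "\<one>\<^bsub>BR\<^esub> \<in> B" using BR.one_closed by simp
  have m: "\<Phi> \<one>\<^bsub>BR\<^esub> \<in> carrier Q" unfolding Q_simps by (rule \<Phi>_closed[OF one])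
  \<comment> \<open>As a quotient of B, the module is cyclic, generated by the image of 1.\<close>
  show "fin_gen_module BR Q"
    unfolding fin_gen_module_def
  proof (intro exI[of _ "{\<Phi> \<one>\<^bsub>BR\<^esub>}"] conjI ballI)
    fix v assume "v \<in> carrier Q"
    then obtain b where b: "b \<in> B" "v = \<Phi> b" using \<Phi>_surj unfolding Q_simps by blast
    have "b \<odot>\<^bsub>Q\<^esub> \<Phi> \<one>\<^bsub>BR\<^esub> = v"
      unfolding Q_smult[OF b(1) one] b(2) using BR.r_one[of b] b(1) by simp
    moreover have "finsum Q (\<lambda>s. b \<odot>\<^bsub>Q\<^esub> s) {\<Phi> \<one>\<^bsub>BR\<^esub>} = b \<odot>\<^bsub>Q\<^esub> \<Phi> \<one>\<^bsub>BR\<^esub>"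
    proof -
      have "finsum Q (\<lambda>s. b \<odot>\<^bsub>Q\<^esub> s) (insert (\<Phi> \<one>\<^bsub>BR\<^esub>) {}) = b \<odot>\<^bsub>Q\<^esub> \<Phi> \<one>\<^bsub>BR\<^esub> \<oplus>\<^bsub>Q\<^esub> finsum Q (\<lambda>s. b \<odot>\<^bsub>Q\<^esub> s) {}"
        by (rule Q.M.finsum_insert) (use Q.smult_closed[of b, OF _ m] b(1) in auto)
      then show ?thesis using Q.smult_closed[of b, OF _ m] b(1) by simp
    qed
    ultimately show "\<exists>c\<in>{\<Phi> \<one>\<^bsub>BR\<^esub>} \<rightarrow> carrier BR. v = (\<Oplus>\<^bsub>Q\<^esub>s\<in>{\<Phi> \<one>\<^bsub>BR\<^esub>}. c s \<odot>\<^bsub>Q\<^esub> s)"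
      using b(1) by (intro bexI[of _ "\<lambda>_. b"]) auto
  qed (use m in auto)
qed

end

section \<open>Rank one direct summands of the order\<close>

context rank_one_quotient begin

text \<open>With the section S the module becomes a direct summand of B, hence projective.
  Explicitly, if e is a lift of \<Phi>(1) to the middle term, then v is lifted by S(v) e, because g
  (S(v) e) = S(v) \<Phi>(1) = \<Phi>(S(v)) = v.\<close>

lemma in_GP_of_splitting:
  assumes S: "S \<in> lmod_hom A (rank_one_rep n I) (res Reg)"
    and split: "\<And>v. v \<in> {1..n} \<rightarrow>\<^sub>E UNIV \<Longrightarrow> \<Phi> (S v) = v"
    and tf: "torsion_free n (res Reg)"
  shows "in_GP k n B Q"
  unfolding in_GP_def
proof (intro conjI in_CM_Q)
  have S': "S \<in> lmod_hom BR Q Reg"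
    by (rule lmod_hom_extend[OF _ left_module_Q left_module_Reg tf]) (unfold lmod_hom_from_Q, rule S)
  show "ext1_vanishes BR Q Reg"
    unfolding ext1_vanishes_def
  proof (intro allI impI)
    fix E :: "((qpath \<Rightarrow> complex fls) set, (qpath \<Rightarrow> complex fls) set \<times> (nat \<Rightarrow> complex fps)) module" and f g
    assume "left_module BR E \<and> short_exact BR Reg f E g Q"
    then have E: "left_module BR E" and g: "g \<in> lmod_hom BR E Q" "g ` carrier E = carrier Q"
      unfolding short_exact_def by blast+
    interpret E: left_module BR E by (rule E)
    have one: "\<one>\<^bsub>BR\<^esub> \<in> B" using BR.one_closed by simp
    have "\<Phi> \<one>\<^bsub>BR\<^esub> \<in> g ` carrier E" unfolding g(2) Q_simps by (rule \<Phi>_closed[OF one])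
    then obtain e where e: "e \<in> carrier E" "g e = \<Phi> \<one>\<^bsub>BR\<^esub>" by force
    have Sc: "S v \<in> B" if "v \<in> carrier Q" for v
      using lmod_homD(1)[OF S' that] unfolding Reg_simps .
    then have Sc': "S v \<in> carrier BR" if "v \<in> carrier Q" for v using that by simp
    have "(\<lambda>v. S v \<odot>\<^bsub>E\<^esub> e) \<in> lmod_hom BR Q E"
      unfolding lmod_hom_def
    proof (intro CollectI conjI ballI funcsetI)
      fix v assume v: "v \<in> carrier Q"
      show "S v \<odot>\<^bsub>E\<^esub> e \<in> carrier E" by (rule E.smult_closed[OF Sc'[OF v] e(1)])
      fix w assume w: "w \<in> carrier Q"
      show "S (v \<oplus>\<^bsub>Q\<^esub> w) \<odot>\<^bsub>E\<^esub> e = S v \<odot>\<^bsub>E\<^esub> e \<oplus>\<^bsub>E\<^esub> S w \<odot>\<^bsub>E\<^esub> e"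
        unfolding lmod_homD(2)[OF S' v w] Reg_simps by (rule E.smult_l_distr[OF Sc'[OF v] Sc'[OF w] e(1)])
    next
      fix b v assume b: "b \<in> carrier BR" and v: "v \<in> carrier Q"
      show "S (b \<odot>\<^bsub>Q\<^esub> v) \<odot>\<^bsub>E\<^esub> e = b \<odot>\<^bsub>E\<^esub> (S v \<odot>\<^bsub>E\<^esub> e)"
        unfolding lmod_homD(3)[OF S' b v] Reg_simps by (rule E.smult_assoc[OF b Sc'[OF v] e(1)])
    qed
    moreover have "g (S v \<odot>\<^bsub>E\<^esub> e) = v" if v: "v \<in> carrier Q" for v
    proof -
      have "g (S v \<odot>\<^bsub>E\<^esub> e) = S v \<odot>\<^bsub>Q\<^esub> \<Phi> \<one>\<^bsub>BR\<^esub>"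
        unfolding lmod_homD(3)[OF g(1) Sc'[OF v] e(1)] e(2) ..
      also have "\<dots> = \<Phi> (S v \<otimes>\<^bsub>BR\<^esub> \<one>\<^bsub>BR\<^esub>)" by (rule Q_smult[OF Sc[OF v] one])
      also have "\<dots> = v" unfolding BR.r_one[OF Sc'[OF v]] using v unfolding Q_simps by (rule split)
      finally show ?thesis .
    qed
    ultimately show "\<exists>s\<in>lmod_hom BR Q E. \<forall>v\<in>carrier Q. g (s v) = v"
      by (intro bexI[of _ "\<lambda>v. S v \<odot>\<^bsub>E\<^esub> e"] ballI)
  qed
qed

text \<open>B is the direct sum of the image of S and the kernel of \<Phi>, so m = 1 works in
  \<open>in_add\<close>. Elements of the free module of rank one are functions on {0};
  \<open>?e b\<close> is the function with value b.\<close>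

lemma in_add_of_splitting:
  assumes S: "S \<in> lmod_hom A (rank_one_rep n I) (res Reg)"
    and split: "\<And>v. v \<in> {1..n} \<rightarrow>\<^sub>E UNIV \<Longrightarrow> \<Phi> (S v) = v"
    and tf: "torsion_free n (res Reg)"
  shows "in_add BR Q"
proof -
  have S': "S \<in> lmod_hom BR Q Reg"
    by (rule lmod_hom_extend[OF _ left_module_Q left_module_Reg tf]) (unfold lmod_hom_from_Q, rule S)
  have B_Reg: "b \<in> carrier Reg" if "b \<in> B" for b unfolding Reg_simps by (rule that)
  interpret Q: left_module BR Q by (rule left_module_Q)
  interpret Rg: left_module BR Reg by (rule left_module_Reg)
  define F where "F = direct_sum_module {..<1::nat} (\<lambda>_. Reg)"
  have "left_module BR F" unfolding F_def by (rule left_module_direct_sum[OF BR.ring_axioms left_module_Reg])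
  then interpret F: left_module BR F .
  have idx: "{..<1::nat} = {0}" by auto
  note F_simps = direct_sum_module_simps[of "{..<1::nat}" "\<lambda>_. Reg", folded F_def, unfolded idx]
  let ?e = "\<lambda>b. \<lambda>i\<in>{0::nat}. b :: (qpath \<Rightarrow> complex fls) set"
  have ec: "?e b \<in> carrier F" if "b \<in> B" for b using that unfolding F_simps Reg_simps by simp
  have e0: "z = ?e (z 0)" "z 0 \<in> B" if "z \<in> carrier F" for z
  proof -
    show "z 0 \<in> B" using that unfolding F_simps Reg_simps by (rule PiE_mem) simp
    show "z = ?e (z 0)"
    proof
      fix i show "z i = ?e (z 0) i"
        using PiE_arb[OF that[unfolded F_simps], of i] by (cases "i = 0") simp_all
    qed
  qed
  have einj: "b = b'" if "?e b = ?e b'" for b b' using fun_cong[OF that, of 0] by simp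
  have eadd: "?e b \<oplus>\<^bsub>F\<^esub> ?e b' = ?e (b \<oplus>\<^bsub>Reg\<^esub> b')" for b b'
    unfolding F_simps by (rule restrict_ext) simp
  have esm: "a \<odot>\<^bsub>F\<^esub> ?e b = ?e (a \<odot>\<^bsub>Reg\<^esub> b)" for a b
    unfolding F_simps by (rule restrict_ext) simp
  have ez: "\<zero>\<^bsub>F\<^esub> = ?e \<zero>\<^bsub>Reg\<^esub>" unfolding F_simps ..
  define P where "P = (\<lambda>v. ?e (S v)) ` carrier Q"
  define K where "K = ?e ` {b \<in> B. \<Phi> b = \<zero>\<^bsub>Q\<^esub>}"
  have Sc: "S v \<in> B" if "v \<in> carrier Q" for v
    using lmod_homD(1)[OF S' that] unfolding Reg_simps .
  have S0: "S \<zero>\<^bsub>Q\<^esub> = \<zero>\<^bsub>Reg\<^esub>" by (rule lmod_hom_zero[OF S' left_module_Q left_module_Reg])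
  have \<Phi>0: "\<Phi> \<zero>\<^bsub>Reg\<^esub> = \<zero>\<^bsub>Q\<^esub>" by (rule lmod_hom_zero[OF \<Phi>_BR_hom left_module_Reg left_module_Q])
  have z: "\<zero>\<^bsub>Reg\<^esub> \<in> B" using Rg.M.zero_closed unfolding Reg_simps(1) .
  have \<Phi>S: "\<Phi> (S v) = v" if "v \<in> carrier Q" for v using that unfolding Q_simps by (rule split)
  have "submodule P BR F"
  proof (rule F.submodule_of_closed)
    show "P \<subseteq> carrier F" unfolding P_def using ec Sc by blast
    show "\<zero>\<^bsub>F\<^esub> \<in> P" unfolding P_def ez S0[symmetric] using Q.M.zero_closed by blast
  next
    fix x y assume "x \<in> P" "y \<in> P"
    then obtain v w where v: "v \<in> carrier Q" "w \<in> carrier Q" and xy: "x = ?e (S v)" "y = ?e (S w)"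
      unfolding P_def by blast
    show "x \<oplus>\<^bsub>F\<^esub> y \<in> P"
      unfolding xy eadd lmod_homD(2)[OF S' v, symmetric] P_def using Q.M.a_closed[OF v] by (rule imageI)
  next
    fix a x assume a: "a \<in> carrier BR" and "x \<in> P"
    then obtain v where v: "v \<in> carrier Q" and x: "x = ?e (S v)" unfolding P_def by blast
    show "a \<odot>\<^bsub>F\<^esub> x \<in> P"
      unfolding x esm lmod_homD(3)[OF S' a v, symmetric] P_def using Q.smult_closed[OF a v] by (rule imageI)
  qed
  moreover have "submodule K BR F"
  proof (rule F.submodule_of_closed)
    show "K \<subseteq> carrier F" unfolding K_def using ec by blast
    show "\<zero>\<^bsub>F\<^esub> \<in> K" unfolding K_def ez using z \<Phi>0 by blast
  next
    fix x y assume "x \<in> K" "y \<in> K"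
    then obtain b c where b: "b \<in> B" "\<Phi> b = \<zero>\<^bsub>Q\<^esub>" and c: "c \<in> B" "\<Phi> c = \<zero>\<^bsub>Q\<^esub>" and xy: "x = ?e b" "y = ?e c"
      unfolding K_def by blast
    have "\<Phi> (b \<oplus>\<^bsub>Reg\<^esub> c) = \<zero>\<^bsub>Q\<^esub> \<oplus>\<^bsub>Q\<^esub> \<zero>\<^bsub>Q\<^esub>"
      unfolding lmod_homD(2)[OF \<Phi>_BR_hom B_Reg[OF b(1)] B_Reg[OF c(1)]] b(2) c(2) ..
    also have "\<dots> = \<zero>\<^bsub>Q\<^esub>" by (rule Q.M.l_zero[OF Q.M.zero_closed])
    finally have "\<Phi> (b \<oplus>\<^bsub>Reg\<^esub> c) = \<zero>\<^bsub>Q\<^esub>" .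
    then show "x \<oplus>\<^bsub>F\<^esub> y \<in> K"
      unfolding xy eadd K_def using B_add[OF b(1) c(1)] unfolding Reg_simps by blast
  next
    fix a x assume a: "a \<in> carrier BR" and "x \<in> K"
    then obtain b where b: "b \<in> B" "\<Phi> b = \<zero>\<^bsub>Q\<^esub>" and x: "x = ?e b" unfolding K_def by blast
    have "\<Phi> (a \<odot>\<^bsub>Reg\<^esub> b) = \<zero>\<^bsub>Q\<^esub>"
      unfolding lmod_homD(3)[OF \<Phi>_BR_hom a B_Reg[OF b(1)]] b(2) by (rule Q.smult_r_null[OF a])
    moreover have "a \<in> B" using a by simp
    ultimately show "a \<odot>\<^bsub>F\<^esub> x \<in> K"
      unfolding x esm K_def using B_mult[OF _ b(1)] unfolding Reg_simps by blast
  qed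
  moreover have "P \<inter> K = {\<zero>\<^bsub>F\<^esub>}"
  proof
    show "P \<inter> K \<subseteq> {\<zero>\<^bsub>F\<^esub>}"
    proof
      fix x assume "x \<in> P \<inter> K"
      then obtain v b where v: "v \<in> carrier Q" and b: "\<Phi> b = \<zero>\<^bsub>Q\<^esub>" and x: "x = ?e (S v)" "x = ?e b"
        unfolding P_def K_def by blast
      have "S v = b" by (rule einj) (rule trans[OF x(1)[symmetric] x(2)])
      then have "v = \<zero>\<^bsub>Q\<^esub>" using \<Phi>S[OF v] b by metis
      then show "x \<in> {\<zero>\<^bsub>F\<^esub>}" unfolding x(1) ez S0[symmetric] by simp
    qed
    have "\<zero>\<^bsub>F\<^esub> \<in> P" unfolding P_def ez S0[symmetric] using Q.M.zero_closed by blast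
    moreover have "\<zero>\<^bsub>F\<^esub> \<in> K" unfolding K_def ez using z \<Phi>0 by blast
    ultimately show "{\<zero>\<^bsub>F\<^esub>} \<subseteq> P \<inter> K" by blast
  qed
  moreover have "P <+>\<^bsub>F\<^esub> K = carrier F"
  proof
    show "P <+>\<^bsub>F\<^esub> K \<subseteq> carrier F"
    proof
      fix x assume "x \<in> P <+>\<^bsub>F\<^esub> K"
      then obtain p q where p: "p \<in> P" and q: "q \<in> K" and x: "x = p \<oplus>\<^bsub>F\<^esub> q" unfolding set_add_def' by blast
      have "p \<in> carrier F" using p ec Sc unfolding P_def by blast
      moreover have "q \<in> carrier F" using q ec unfolding K_def by blast
      ultimately show "x \<in> carrier F" unfolding x by (rule F.M.a_closed)
    qed
    show "carrier F \<subseteq> P <+>\<^bsub>F\<^esub> K"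
    proof
      fix x assume x: "x \<in> carrier F"
      let ?b = "x 0"
      have b: "?b \<in> carrier Reg" using e0(2)[OF x] unfolding Reg_simps .
      have v: "\<Phi> ?b \<in> carrier Q" by (rule lmod_homD(1)[OF \<Phi>_BR_hom b])
      have s: "S (\<Phi> ?b) \<in> carrier Reg" by (rule lmod_homD(1)[OF S' v])
      \<comment> \<open>The remainder b - S(\<Phi> b) lies in the kernel, since \<Phi> S is the
        identity.\<close>
      let ?c = "\<ominus>\<^bsub>Reg\<^esub> S (\<Phi> ?b) \<oplus>\<^bsub>Reg\<^esub> ?b"
      have ms: "\<ominus>\<^bsub>Reg\<^esub> S (\<Phi> ?b) \<in> carrier Reg" by (rule Rg.M.a_inv_closed[OF s])
      have c: "?c \<in> carrier Reg" by (rule Rg.M.a_closed[OF ms b])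
      have "\<Phi> ?c = \<ominus>\<^bsub>Q\<^esub> \<Phi> (S (\<Phi> ?b)) \<oplus>\<^bsub>Q\<^esub> \<Phi> ?b"
        unfolding lmod_homD(2)[OF \<Phi>_BR_hom ms b] lmod_hom_minus[OF \<Phi>_BR_hom left_module_Reg left_module_Q s] ..
      also have "\<dots> = \<zero>\<^bsub>Q\<^esub>" unfolding \<Phi>S[OF v] by (rule Q.M.l_neg[OF v])
      finally have "?e ?c \<in> K" using c unfolding K_def Reg_simps by blast
      moreover have "?e (S (\<Phi> ?b)) \<in> P" unfolding P_def using v by blast
      moreover have "x = ?e (S (\<Phi> ?b)) \<oplus>\<^bsub>F\<^esub> ?e ?c"
      proof -
        have "S (\<Phi> ?b) \<oplus>\<^bsub>Reg\<^esub> ?c = (S (\<Phi> ?b) \<oplus>\<^bsub>Reg\<^esub> \<ominus>\<^bsub>Reg\<^esub> S (\<Phi> ?b)) \<oplus>\<^bsub>Reg\<^esub> ?b"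
          by (rule Rg.M.a_assoc[OF s ms b, symmetric])
        also have "\<dots> = ?b" unfolding Rg.M.r_neg[OF s] by (rule Rg.M.l_zero[OF b])
        finally show ?thesis unfolding eadd using e0(1)[OF x] by simp
      qed
      ultimately show "x \<in> P <+>\<^bsub>F\<^esub> K" unfolding set_add_def' by blast
    qed
  qed
  moreover have "lmod_iso BR Q (F\<lparr>carrier := P\<rparr>)"
    unfolding lmod_iso_def
  proof (rule bexI[of _ "\<lambda>v. ?e (S v)"])
    have "inj_on (\<lambda>v. ?e (S v)) (carrier Q)"
    proof (rule inj_onI)
      fix v w assume v: "v \<in> carrier Q" "w \<in> carrier Q" and eq: "?e (S v) = ?e (S w)"
      show "v = w" using \<Phi>S[OF v(1)] \<Phi>S[OF v(2)] einj[OF eq] by metis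
    qed
    then show "bij_betw (\<lambda>v. ?e (S v)) (carrier Q) (carrier (F\<lparr>carrier := P\<rparr>))"
      unfolding bij_betw_def P_def by simp
    show "(\<lambda>v. ?e (S v)) \<in> lmod_hom BR Q (F\<lparr>carrier := P\<rparr>)"
      unfolding lmod_hom_def
    proof (intro CollectI conjI ballI funcsetI)
      fix v assume v: "v \<in> carrier Q"
      show "?e (S v) \<in> carrier (F\<lparr>carrier := P\<rparr>)" unfolding P_def using v by simp
      fix w assume w: "w \<in> carrier Q"
      show "?e (S (v \<oplus>\<^bsub>Q\<^esub> w)) = ?e (S v) \<oplus>\<^bsub>F\<lparr>carrier := P\<rparr>\<^esub> ?e (S w)"
        using eadd[of "S v" "S w"] lmod_homD(2)[OF S' v w] by simp
    next
      fix b v assume b: "b \<in> carrier BR" and v: "v \<in> carrier Q"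
      show "?e (S (b \<odot>\<^bsub>Q\<^esub> v)) = b \<odot>\<^bsub>F\<lparr>carrier := P\<rparr>\<^esub> ?e (S v)"
        using esm[of b "S v"] lmod_homD(3)[OF S' b v] by simp
    qed
  qed
  ultimately show ?thesis
    unfolding in_add_def Let_def F_def by blast
qed

end

section \<open>Extensions of rank one modules\<close>

lemma (in left_module) smult_finsum:
  assumes a: "a \<in> carrier R" and T: "finite T" and g: "\<And>i. i \<in> T \<Longrightarrow> g i \<in> carrier M"
  shows "a \<odot>\<^bsub>M\<^esub> finsum M g T = finsum M (\<lambda>i. a \<odot>\<^bsub>M\<^esub> g i) T"
  using T g
proof (induction T)
  case empty
  then show ?case using smult_r_null[OF a] by simp
next
  case (insert x T)
  have c: "g \<in> T \<rightarrow> carrier M" "g x \<in> carrier M" using insert.prems by auto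
  have c': "(\<lambda>i. a \<odot>\<^bsub>M\<^esub> g i) \<in> T \<rightarrow> carrier M" "a \<odot>\<^bsub>M\<^esub> g x \<in> carrier M"
    using c smult_closed[OF a] by auto
  show ?case
    unfolding M.finsum_insert[OF insert.hyps c] M.finsum_insert[OF insert.hyps c']
      smult_r_distr[OF a c(2) M.finsum_closed[OF c(1)]]
    using insert.IH insert.prems by simp
qed

lemma lmod_hom_finsum:
  assumes f: "f \<in> lmod_hom R M N" and M: "left_module R M" and N: "left_module R N"
    and T: "finite T" and g: "\<And>i. i \<in> T \<Longrightarrow> g i \<in> carrier M"
  shows "f (finsum M g T) = finsum N (\<lambda>i. f (g i)) T"
  using T g
proof (induction T)
  interpret M: left_module R M by (rule M)
  interpret N: left_module R N by (rule N)
  case empty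
  then show ?case using lmod_hom_zero[OF f M N] by simp
next
  case (insert x T)
  interpret M: left_module R M by (rule M)
  interpret N: left_module R N by (rule N)
  have c: "g \<in> T \<rightarrow> carrier M" "g x \<in> carrier M" using insert.prems by auto
  have c': "(\<lambda>i. f (g i)) \<in> T \<rightarrow> carrier N" "f (g x) \<in> carrier N"
    using c lmod_homD(1)[OF f] by auto
  show ?case
    unfolding M.M.finsum_insert[OF insert.hyps c] N.M.finsum_insert[OF insert.hyps c']
      lmod_homD(2)[OF f c(2) M.M.finsum_closed[OF c(1)]]
    using insert.IH insert.prems by simp
qed

text \<open>The scalars that commute with an additive map are closed under sums and products, so by
  \<open>path_algebra_induct\<close> linearity has to be tested on generators only.\<close>

lemma lmod_hom_by_generators:
  fixes M :: "(qpath \<Rightarrow> complex fps, 'm) module" and N :: "(qpath \<Rightarrow> complex fps, 'n) module"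
  assumes M: "left_module (path_algebra n) M" and N: "left_module (path_algebra n) N"
    and cl: "\<And>v. v \<in> carrier M \<Longrightarrow> h v \<in> carrier N"
    and add: "\<And>v w. v \<in> carrier M \<Longrightarrow> w \<in> carrier M \<Longrightarrow> h (v \<oplus>\<^bsub>M\<^esub> w) = h v \<oplus>\<^bsub>N\<^esub> h w"
    and scal: "\<And>r v. v \<in> carrier M \<Longrightarrow> h (scal n r \<odot>\<^bsub>M\<^esub> v) = scal n r \<odot>\<^bsub>N\<^esub> h v"
    and idem: "\<And>j v. j \<in> {1..n} \<Longrightarrow> v \<in> carrier M \<Longrightarrow> h (path_elem (j, []) \<odot>\<^bsub>M\<^esub> v) = path_elem (j, []) \<odot>\<^bsub>N\<^esub> h v"
    and x: "\<And>v. v \<in> carrier M \<Longrightarrow> h (x_sum n \<odot>\<^bsub>M\<^esub> v) = x_sum n \<odot>\<^bsub>N\<^esub> h v"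
    and y: "\<And>v. v \<in> carrier M \<Longrightarrow> h (y_sum n \<odot>\<^bsub>M\<^esub> v) = y_sum n \<odot>\<^bsub>N\<^esub> h v"
  shows "h \<in> lmod_hom (path_algebra n) M N"
proof -
  interpret M: left_module "path_algebra n" M by (rule M)
  interpret N: left_module "path_algebra n" N by (rule N)
  have "\<forall>v\<in>carrier M. h (f \<odot>\<^bsub>M\<^esub> v) = f \<odot>\<^bsub>N\<^esub> h v" if "f \<in> carrier (path_algebra n)" for f
    using that
  proof (induction rule: path_algebra_induct)
    case (scal r)
    show ?case using assms(5) by blast
  next
    case (idem j)
    then show ?case using assms(6) by blast
  next
    case x
    show ?case using assms(7) by blast
  next
    case y
    show ?case using assms(8) by blast
  next
    case (add f g)
    show ?case
    proof
      fix v assume v: "v \<in> carrier M"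
      show "h ((f \<oplus>\<^bsub>path_algebra n\<^esub> g) \<odot>\<^bsub>M\<^esub> v) = (f \<oplus>\<^bsub>path_algebra n\<^esub> g) \<odot>\<^bsub>N\<^esub> h v"
        unfolding M.smult_l_distr[OF add.hyps v] N.smult_l_distr[OF add.hyps cl[OF v]]
          assms(4)[OF M.smult_closed[OF add.hyps(1) v] M.smult_closed[OF add.hyps(2) v]]
        using add.IH v by metis
    qed
  next
    case (mult f g)
    show ?case
    proof
      fix v assume v: "v \<in> carrier M"
      show "h ((f \<otimes>\<^bsub>path_algebra n\<^esub> g) \<odot>\<^bsub>M\<^esub> v) = (f \<otimes>\<^bsub>path_algebra n\<^esub> g) \<odot>\<^bsub>N\<^esub> h v"
        unfolding M.smult_assoc[OF mult.hyps v] N.smult_assoc[OF mult.hyps cl[OF v]]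
        using mult.IH v M.smult_closed[OF mult.hyps(2) v] by metis
    qed
  qed
  then show ?thesis unfolding lmod_hom_def using cl add by blast
qed

lemma trivial_path_path_elem:
  assumes "j \<in> {1..n}"
  shows "path_elem (j, []) \<otimes>\<^bsub>path_algebra n\<^esub> path_elem q = (if path_end n q = j then path_elem q else (\<lambda>_. 0))"
  by (rule ext, unfold trivial_path_mult[OF assms]) (auto simp: path_elem_def)

section \<open>Representations of the circular quiver and maps out of M_I\<close>

locale path_rep = left_module "path_algebra n :: (qpath \<Rightarrow> complex fps) ring" E
  for n :: nat and E :: "(qpath \<Rightarrow> complex fps, 'e) module"
begin

abbreviation act (infixr \<open>\<cdot>\<close> 75) where "f \<cdot> z \<equiv> f \<odot>\<^bsub>E\<^esub> z"

text \<open>The space e_j E of the representation at the vertex j, where e_j is the trivial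
  path.\<close>

definition vertex_space :: "nat \<Rightarrow> 'e set" where
  "vertex_space j = {z \<in> carrier E. path_elem (j, []) \<cdot> z = z}"

lemma vertex_spaceD: "z \<in> vertex_space j \<Longrightarrow> z \<in> carrier E" "z \<in> vertex_space j \<Longrightarrow> path_elem (j, []) \<cdot> z = z"
  by (simp_all add: vertex_space_def)

lemma trivial_path_closed: "j \<in> {1..n} \<Longrightarrow> path_elem (j, []) \<in> carrier (path_algebra n)"
  by (rule path_elem_closed) simp

text \<open>On e_j E the elements x and y act as the single arrows leaving j. This is what makes
  iterates of x and y interchangeable with straight paths.\<close>

lemma act_eq_path_elem:
  assumes j: "j \<in> {1..n}" and z: "z \<in> vertex_space j"
    and f: "f \<in> carrier (path_algebra n)" and q: "is_path n q"
    and eq: "f \<otimes>\<^bsub>path_algebra n\<^esub> path_elem (j, []) = path_elem q"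
  shows "f \<cdot> z = path_elem q \<cdot> z"
proof -
  have "f \<cdot> z = f \<cdot> path_elem (j, []) \<cdot> z" unfolding vertex_spaceD(2)[OF z] ..
  also have "\<dots> = path_elem q \<cdot> z"
    unfolding smult_assoc[OF f trivial_path_closed[OF j] vertex_spaceD(1)[OF z], symmetric] eq ..
  finally show ?thesis .
qed

lemma path_elem_vertex_space:
  assumes q: "is_path n q" and z: "z \<in> carrier E"
  shows "path_elem q \<cdot> z \<in> vertex_space (path_end n q)"
proof -
  have "path_elem (path_end n q, []) \<cdot> path_elem q \<cdot> z = path_elem q \<cdot> z"
    unfolding smult_assoc[OF trivial_path_closed[OF path_end_mem[OF q]] path_elem_closed[OF q] z, symmetric]
      trivial_path_path_elem[OF path_end_mem[OF q]] by simp
  then show ?thesis using smult_closed[OF path_elem_closed[OF q] z] by (simp add: vertex_space_def)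
qed

lemma vertex_space_add:
  assumes j: "j \<in> {1..n}" and z: "z \<in> vertex_space j" and w: "w \<in> vertex_space j"
  shows "z \<oplus>\<^bsub>E\<^esub> w \<in> vertex_space j"
  using smult_r_distr[OF trivial_path_closed[OF j] vertex_spaceD(1)[OF z] vertex_spaceD(1)[OF w]]
    M.a_closed[OF vertex_spaceD(1)[OF z] vertex_spaceD(1)[OF w]]
  unfolding vertex_space_def[of j] vertex_spaceD(2)[OF z] vertex_spaceD(2)[OF w] by simp

lemma vertex_space_minus:
  assumes j: "j \<in> {1..n}" and z: "z \<in> vertex_space j"
  shows "\<ominus>\<^bsub>E\<^esub> z \<in> vertex_space j"
  using smult_r_minus[OF trivial_path_closed[OF j] vertex_spaceD(1)[OF z]]
    M.a_inv_closed[OF vertex_spaceD(1)[OF z]]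
  unfolding vertex_space_def[of j] vertex_spaceD(2)[OF z] by simp

lemma scal_act_commute:
  assumes f: "f \<in> carrier (path_algebra n)" and z: "z \<in> carrier E"
  shows "f \<cdot> scal n r \<cdot> z = scal n r \<cdot> f \<cdot> z"
  unfolding smult_assoc[OF f scal_closed z, symmetric] smult_assoc[OF scal_closed f z, symmetric]
    scal_central[OF f] ..

lemma scal_scal_act: "z \<in> carrier E \<Longrightarrow> scal n r \<cdot> scal n s \<cdot> z = scal n (r * s) \<cdot> z"
  using smult_assoc[OF scal_closed[of n r] scal_closed[of n s]] unfolding scal_mult_scal by simp

lemma scal_one_act: "z \<in> carrier E \<Longrightarrow> scal n 1 \<cdot> z = z"
  unfolding scal_one by (rule smult_one)

lemma scal_zero_act: "z \<in> carrier E \<Longrightarrow> scal n 0 \<cdot> z = \<zero>\<^bsub>E\<^esub>"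
  using smult_l_null unfolding path_algebra_simps scal_def by simp

lemma scal_add_act: "z \<in> carrier E \<Longrightarrow> scal n (r + s) \<cdot> z = scal n r \<cdot> z \<oplus>\<^bsub>E\<^esub> scal n s \<cdot> z"
  using smult_l_distr[OF scal_closed[of n r] scal_closed[of n s]]
  unfolding path_algebra_simps(2) scal_def distrib_right .

lemma x_vertex_space:
  assumes j: "j \<in> {1..n}" and z: "z \<in> vertex_space j"
  shows "x_sum n \<cdot> z \<in> vertex_space (csucc n j)"
proof -
  have q: "is_path n (j, [X (csucc n j)])" using j csucc_mem[OF j] cpred_csucc[OF j] by simp
  show ?thesis
    using path_elem_vertex_space[OF q vertex_spaceD(1)[OF z]]
      act_eq_path_elem[OF j z x_sum_closed q] x_sum_path_elem[of n j "[]", where 'a = "complex fps"] j by simp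
qed

lemma y_vertex_space:
  assumes j: "j \<in> {1..n}" and z: "z \<in> vertex_space j"
  shows "y_sum n \<cdot> z \<in> vertex_space (cpred n j)"
proof -
  have q: "is_path n (j, [Y j])" using j by simp
  show ?thesis
    using path_elem_vertex_space[OF q vertex_spaceD(1)[OF z]]
      act_eq_path_elem[OF j z y_sum_closed q] y_sum_path_elem[of n j "[]", where 'a = "complex fps"] j by simp
qed

definition xpow :: "nat \<Rightarrow> 'e \<Rightarrow> 'e" where "xpow m = ((\<lambda>z. x_sum n \<cdot> z) ^^ m)"
definition ypow :: "nat \<Rightarrow> 'e \<Rightarrow> 'e" where "ypow m = ((\<lambda>z. y_sum n \<cdot> z) ^^ m)"

lemma xpow_simps: "xpow 0 z = z" "xpow (Suc m) z = x_sum n \<cdot> xpow m z"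
  by (simp_all add: xpow_def)

lemma ypow_simps: "ypow 0 z = z" "ypow (Suc m) z = y_sum n \<cdot> ypow m z"
  by (simp_all add: ypow_def)

lemma xpow_Suc_right: "xpow (Suc m) z = xpow m (x_sum n \<cdot> z)"
  unfolding xpow_def funpow_Suc_right by simp

lemma ypow_Suc_right: "ypow (Suc m) z = ypow m (y_sum n \<cdot> z)"
  unfolding ypow_def funpow_Suc_right by simp

lemma ypow_add: "ypow (m + m') z = ypow m (ypow m' z)"
  by (simp add: ypow_def funpow_add)

lemma xpow_closed: "z \<in> carrier E \<Longrightarrow> xpow m z \<in> carrier E"
  by (induction m) (simp_all add: xpow_simps smult_closed x_sum_closed)

lemma ypow_closed: "z \<in> carrier E \<Longrightarrow> ypow m z \<in> carrier E"
  by (induction m) (simp_all add: ypow_simps smult_closed y_sum_closed)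

lemma xpow_add_distrib:
  "z \<in> carrier E \<Longrightarrow> w \<in> carrier E \<Longrightarrow> xpow m (z \<oplus>\<^bsub>E\<^esub> w) = xpow m z \<oplus>\<^bsub>E\<^esub> xpow m w"
  by (induction m) (simp_all add: xpow_simps smult_r_distr x_sum_closed xpow_closed)

lemma xpow_minus: "z \<in> carrier E \<Longrightarrow> xpow m (\<ominus>\<^bsub>E\<^esub> z) = \<ominus>\<^bsub>E\<^esub> xpow m z"
  by (induction m) (simp_all add: xpow_simps smult_r_minus x_sum_closed xpow_closed)

lemma ypow_add_distrib:
  "z \<in> carrier E \<Longrightarrow> w \<in> carrier E \<Longrightarrow> ypow m (z \<oplus>\<^bsub>E\<^esub> w) = ypow m z \<oplus>\<^bsub>E\<^esub> ypow m w"
  by (induction m) (simp_all add: ypow_simps smult_r_distr y_sum_closed ypow_closed)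

lemma xpow_path:
  assumes j: "j \<in> {1..n}" and z: "z \<in> vertex_space j"
  shows "xpow m z = path_elem (x_path n j m) \<cdot> z"
proof (induction m)
  case 0
  then show ?case using vertex_spaceD[OF z] by (simp add: xpow_simps x_path_simps)
next
  case (Suc m)
  have p: "x_path n j m = (j, snd (x_path n j m))" using x_path(3)[OF j, of m] by (cases "x_path n j m") simp
  have "x_sum n \<otimes>\<^bsub>path_algebra n\<^esub> path_elem (x_path n j m) = (path_elem (x_path n j (Suc m)) :: qpath \<Rightarrow> complex fps)"
    using x_sum_path_elem[of n j "snd (x_path n j m)"] x_path[OF j, of m] unfolding p[symmetric] x_path_simps by simp
  then show ?case
    unfolding xpow_simps Suc.IH
      smult_assoc[OF x_sum_closed path_elem_closed[OF x_path(1)[OF j]] vertex_spaceD(1)[OF z], symmetric] by simp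
qed

lemma ypow_path:
  assumes j: "j \<in> {1..n}" and z: "z \<in> vertex_space j"
  shows "ypow m z = path_elem (y_path n j m) \<cdot> z"
proof (induction m)
  case 0
  then show ?case using vertex_spaceD[OF z] by (simp add: ypow_simps y_path_simps)
next
  case (Suc m)
  have p: "y_path n j m = (j, snd (y_path n j m))" using y_path(3)[OF j, of m] by (cases "y_path n j m") simp
  have "y_sum n \<otimes>\<^bsub>path_algebra n\<^esub> path_elem (y_path n j m) = (path_elem (y_path n j (Suc m)) :: qpath \<Rightarrow> complex fps)"
    using y_sum_path_elem[of n j "snd (y_path n j m)"] y_path[OF j, of m] unfolding p[symmetric] y_path_simps by simp
  then show ?case
    unfolding ypow_simps Suc.IH
      smult_assoc[OF y_sum_closed path_elem_closed[OF y_path(1)[OF j]] vertex_spaceD(1)[OF z], symmetric] by simp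
qed

lemma ypow_vertex_space: "j \<in> {1..n} \<Longrightarrow> z \<in> vertex_space j \<Longrightarrow> ypow m z \<in> vertex_space ((cpred n ^^ m) j)"
  unfolding ypow_path using path_elem_vertex_space[OF y_path(1)[of j n m] vertex_spaceD(1)[of z j]]
  by (simp add: y_path(2))

text \<open>M_I is free over power series on the unit vectors; this is the map that sends the j-th
  of them to s j. It is linear over the path algebra as soon as the s j satisfy the relations of
  M_I, see \<open>from_basis_hom\<close>.\<close>

definition from_basis :: "(nat \<Rightarrow> 'e) \<Rightarrow> (nat \<Rightarrow> complex fps) \<Rightarrow> 'e" where
  "from_basis s v = finsum E (\<lambda>j. scal n (v j) \<cdot> s j) {1..n}"

lemma from_basis_hom:
  assumes s: "\<And>j. j \<in> {1..n} \<Longrightarrow> s j \<in> vertex_space j"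
    and x: "\<And>i. i \<in> {1..n} \<Longrightarrow> x_sum n \<cdot> s (cpred n i) = scal n (arrow_weight I (X i)) \<cdot> s i"
    and y: "\<And>i. i \<in> {1..n} \<Longrightarrow> y_sum n \<cdot> s i = scal n (arrow_weight I (Y i)) \<cdot> s (cpred n i)"
  shows "from_basis s \<in> lmod_hom (path_algebra n) (rank_one_rep n I) E"
proof -
  interpret V: left_module "path_algebra n" "rank_one_rep n I" by (rule left_module_rank_one_rep)
  have sc: "s j \<in> carrier E" if "j \<in> {1..n}" for j using vertex_spaceD(1)[OF s[OF that]] .
  have tc: "scal n r \<cdot> s j \<in> carrier E" if "j \<in> {1..n}" for j r by (rule smult_closed[OF scal_closed sc[OF that]])
  have cl: "from_basis s v \<in> carrier E" for v
    unfolding from_basis_def by (rule M.finsum_closed) (use tc in auto)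
  have add: "from_basis s (\<lambda>j\<in>{1..n}. v j + w j) = from_basis s v \<oplus>\<^bsub>E\<^esub> from_basis s w" for v w
  proof -
    have "from_basis s (\<lambda>j\<in>{1..n}. v j + w j) = finsum E (\<lambda>j. scal n (v j) \<cdot> s j \<oplus>\<^bsub>E\<^esub> scal n (w j) \<cdot> s j) {1..n}"
      unfolding from_basis_def
      by (rule M.finsum_cong') (use tc scal_add_act[OF sc] in \<open>auto simp del: One_nat_def\<close>)
    also have "\<dots> = from_basis s v \<oplus>\<^bsub>E\<^esub> from_basis s w"
      unfolding from_basis_def by (rule M.finsum_addf) (use tc in auto)
    finally show ?thesis .
  qed
  have push: "f \<cdot> from_basis s v = finsum E (\<lambda>j. scal n (v j) \<cdot> f \<cdot> s j) {1..n}"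
    if f: "f \<in> carrier (path_algebra n)" for f v
  proof -
    have "f \<cdot> from_basis s v = finsum E (\<lambda>j. f \<cdot> scal n (v j) \<cdot> s j) {1..n}"
      unfolding from_basis_def by (rule smult_finsum[OF f]) (use tc in auto)
    also have "\<dots> = finsum E (\<lambda>j. scal n (v j) \<cdot> f \<cdot> s j) {1..n}"
    proof (rule M.finsum_cong')
      fix j assume "j \<in> {1..n}"
      then show "f \<cdot> scal n (v j) \<cdot> s j = scal n (v j) \<cdot> f \<cdot> s j" by (rule scal_act_commute[OF f sc])
    next
      show "(\<lambda>j. scal n (v j) \<cdot> f \<cdot> s j) \<in> {1..n} \<rightarrow> carrier E"
        using smult_closed[OF scal_closed smult_closed[OF f sc]] by blast
    qed simp
    finally show ?thesis .
  qed
  \<comment> \<open>An arrow changes the vertex by one, so for x and for y one of the two sums has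
    to be shifted cyclically before they can be compared term by term.\<close>
  have reindex: "finsum E h {1..n} = finsum E (\<lambda>i. h (cpred n i)) {1..n}" if "h \<in> {1..n} \<rightarrow> carrier E" for h
  proof -
    have inj: "inj_on (cpred n) {1..n}" by (rule inj_on_inverseI[of _ "csucc n"]) (rule csucc_cpred)
    have im: "cpred n ` {1..n} = {1..n}"
      using inj cpred_mem by (intro endo_inj_surj) auto
    show ?thesis using M.finsum_reindex[of h "cpred n" "{1..n}"] that inj unfolding im by simp
  qed
  show ?thesis
  proof (rule lmod_hom_by_generators[OF left_module_rank_one_rep left_module_axioms], unfold rank_one_rep_simps)
    show "from_basis s v \<in> carrier E" for v by (rule cl)
    show "from_basis s (\<lambda>j\<in>{1..n}. v j + w j) = from_basis s v \<oplus>\<^bsub>E\<^esub> from_basis s w" for v w by (rule add)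
  next
    fix r and v :: "nat \<Rightarrow> complex fps" assume v: "v \<in> {1..n} \<rightarrow>\<^sub>E UNIV"
    show "from_basis s (rank_one_act n I (scal n r) v) = scal n r \<cdot> from_basis s v"
      unfolding push[OF scal_closed] rank_one_act_scal[OF v] unfolding from_basis_def
    proof (rule M.finsum_cong')
      show "(\<lambda>j. scal n (v j) \<cdot> scal n r \<cdot> s j) \<in> {1..n} \<rightarrow> carrier E"
        using smult_closed[OF scal_closed tc] by blast
      fix j assume j: "j \<in> {1..n}"
      show "scal n ((\<lambda>i\<in>{1..n}. r * v i) j) \<cdot> s j = scal n (v j) \<cdot> scal n r \<cdot> s j"
        unfolding scal_scal_act[OF sc[OF j]] restrict_apply'[OF j] mult.commute[of r] ..
    qed simp
  next
    fix i and v :: "nat \<Rightarrow> complex fps" assume idem: "i \<in> {1..n}"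
    show "from_basis s (rank_one_act n I (path_elem (i, [])) v) = path_elem (i, []) \<cdot> from_basis s v"
      unfolding push[OF trivial_path_closed[OF idem]] rank_one_act_idem[OF idem] unfolding from_basis_def
    proof (rule M.finsum_cong')
      show "(\<lambda>j. scal n (v j) \<cdot> path_elem (i, []) \<cdot> s j) \<in> {1..n} \<rightarrow> carrier E"
        using smult_closed[OF scal_closed smult_closed[OF trivial_path_closed[OF idem] sc]] by blast
      fix j assume j: "j \<in> {1..n}"
      show "scal n ((\<lambda>l\<in>{1..n}. if l = i then v l else 0) j) \<cdot> s j = scal n (v j) \<cdot> path_elem (i, []) \<cdot> s j"
      proof (cases "j = i")
        case True
        then show ?thesis using vertex_spaceD(2)[OF s[OF j]] j by simp
      next
        case False
        have "path_elem (i, []) \<cdot> s j = path_elem (i, []) \<cdot> path_elem (j, []) \<cdot> s j"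
          unfolding vertex_spaceD(2)[OF s[OF j]] ..
        also have "\<dots> = (\<lambda>_. 0) \<cdot> s j"
          unfolding smult_assoc[OF trivial_path_closed[OF idem] trivial_path_closed[OF j] sc[OF j], symmetric]
            trivial_path_path_elem[OF idem] using False by simp
        also have "\<dots> = \<zero>\<^bsub>E\<^esub>" using smult_l_null[OF sc[OF j]] unfolding path_algebra_simps .
        finally have "path_elem (i, []) \<cdot> s j = \<zero>\<^bsub>E\<^esub>" .
        then have "scal n (v j) \<cdot> path_elem (i, []) \<cdot> s j = \<zero>\<^bsub>E\<^esub>" using smult_r_null[OF scal_closed[of n "v j"]] by simp
        then show ?thesis using scal_zero_act[OF sc[OF j]] j False by simp
      qed
    qed simp
  next
    fix v :: "nat \<Rightarrow> complex fps"
    have cl1: "(\<lambda>j. scal n (v j) \<cdot> x_sum n \<cdot> s j) \<in> {1..n} \<rightarrow> carrier E"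
      using smult_closed[OF scal_closed smult_closed[OF x_sum_closed sc]] by blast
    show "from_basis s (rank_one_act n I (x_sum n) v) = x_sum n \<cdot> from_basis s v"
      unfolding push[OF x_sum_closed] rank_one_act_x reindex[OF cl1] unfolding from_basis_def
    proof (rule M.finsum_cong')
      show "(\<lambda>i. scal n (v (cpred n i)) \<cdot> x_sum n \<cdot> s (cpred n i)) \<in> {1..n} \<rightarrow> carrier E"
        using smult_closed[OF scal_closed smult_closed[OF x_sum_closed sc[OF cpred_mem]]] by blast
      fix i assume i: "i \<in> {1..n}"
      show "scal n ((\<lambda>i\<in>{1..n}. arrow_weight I (X i) * v (cpred n i)) i) \<cdot> s i =
          scal n (v (cpred n i)) \<cdot> x_sum n \<cdot> s (cpred n i)"
        unfolding assms(2)[OF i] scal_scal_act[OF sc[OF i]] restrict_apply'[OF i]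
          mult.commute[of _ "v (cpred n i)"] ..
    qed simp
  next
    fix v :: "nat \<Rightarrow> complex fps"
    let ?w = "\<lambda>i\<in>{1..n}. arrow_weight I (Y (csucc n i)) * v (csucc n i)"
    have cl1: "(\<lambda>j. scal n (?w j) \<cdot> s j) \<in> {1..n} \<rightarrow> carrier E" using tc by blast
    show "from_basis s (rank_one_act n I (y_sum n) v) = y_sum n \<cdot> from_basis s v"
      unfolding push[OF y_sum_closed] rank_one_act_y unfolding from_basis_def reindex[OF cl1]
    proof (rule M.finsum_cong')
      show "(\<lambda>j. scal n (v j) \<cdot> y_sum n \<cdot> s j) \<in> {1..n} \<rightarrow> carrier E"
        using smult_closed[OF scal_closed smult_closed[OF y_sum_closed sc]] by blast
      fix i assume i: "i \<in> {1..n}"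
      show "scal n (?w (cpred n i)) \<cdot> s (cpred n i) = scal n (v i) \<cdot> y_sum n \<cdot> s i"
        unfolding assms(3)[OF i] scal_scal_act[OF sc[OF cpred_mem[OF i]]] restrict_apply'[OF cpred_mem[OF i]]
          csucc_cpred[OF i] mult.commute[of _ "v i"] ..
    qed simp
  qed
qed

lemma from_basis_section:
  assumes s: "\<And>j. j \<in> {1..n} \<Longrightarrow> s j \<in> carrier E"
    and g: "g \<in> lmod_hom (path_algebra n) E (rank_one_rep n I)"
    and gs: "\<And>j. j \<in> {1..n} \<Longrightarrow> g (s j) = (\<lambda>i\<in>{1..n}. if i = j then 1 else 0)"
    and v: "v \<in> {1..n} \<rightarrow>\<^sub>E UNIV"
  shows "g (from_basis s v) = v"
proof -
  interpret V: left_module "path_algebra n" "rank_one_rep n I" by (rule left_module_rank_one_rep)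
  have E: "left_module (path_algebra n) E" by unfold_locales
  have ag: "abelian_group (rank_one_rep n I)" by unfold_locales
  let ?d = "\<lambda>j. \<lambda>i\<in>{1..n}. if i = j then 1 else (0 :: complex fps)"
  have "g (from_basis s v) = finsum (rank_one_rep n I) (\<lambda>j. g (scal n (v j) \<cdot> s j)) {1..n}"
    unfolding from_basis_def
    by (rule lmod_hom_finsum[OF g E left_module_rank_one_rep]) (use smult_closed[OF scal_closed s] in auto)
  also have "\<dots> = finsum (rank_one_rep n I) (\<lambda>j. \<lambda>i\<in>{1..n}. if i = j then v j else 0) {1..n}"
  proof (rule V.M.finsum_cong')
    fix j assume j: "j \<in> {1..n}"
    have d: "?d j \<in> {1..n} \<rightarrow>\<^sub>E UNIV" by simp
    show "g (scal n (v j) \<cdot> s j) = (\<lambda>i\<in>{1..n}. if i = j then v j else 0)"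
      unfolding lmod_homD(3)[OF g scal_closed s[OF j]] gs[OF j] rank_one_rep_simps rank_one_act_scal[OF d]
      by (rule restrict_ext) simp
  qed (auto simp: rank_one_rep_simps)
  also have "\<dots> = (\<lambda>i\<in>{1..n}. \<Sum>j\<in>{1..n}. (\<lambda>i\<in>{1..n}. if i = j then v j else 0) i)"
    by (rule finsum_vectors[OF ag rank_one_rep_simps(1-3)]) (auto simp: rank_one_rep_simps)
  also have "\<dots> = v"
  proof
    fix i
    show "(\<lambda>i\<in>{1..n}. \<Sum>j\<in>{1..n}. (\<lambda>i\<in>{1..n}. if i = j then v j else 0) i) i = v i"
      using PiE_arb[OF v, of i] by (cases "i \<in> {1..n}") simp_all
  qed
  finally show ?thesis .
qed

end

section \<open>Sections onto M_I in torsion-free modules\<close>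

locale circle_rep = path_rep n E
  for n :: nat and E :: "(qpath \<Rightarrow> complex fps, 'e) module" +
  fixes k :: nat
  assumes annihilated: "f \<in> circle_ideal k n fps_X \<Longrightarrow> z \<in> carrier E \<Longrightarrow> f \<odot>\<^bsub>E\<^esub> z = \<zero>\<^bsub>E\<^esub>"
    and tf: "torsion_free n E"
begin

lemma relation_act:
  assumes r: "(\<lambda>p. path_elem q p - s * path_elem q' p) \<in> circle_relations k n fps_X"
    and q: "is_path n q" and q': "is_path n q'" and z: "z \<in> carrier E"
  shows "path_elem q \<cdot> z = scal n s \<cdot> path_elem q' \<cdot> z"
proof -
  let ?r = "\<lambda>p. path_elem q p - s * path_elem q' p"
  have r': "?r \<in> circle_ideal k n fps_X" using r circle_relations_ideal by blast
  have rc: "?r \<in> carrier (path_algebra n)" using r circle_relations_carrier by blast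
  have sq: "scal n s \<otimes>\<^bsub>path_algebra n\<^esub> path_elem q' = (\<lambda>p. s * path_elem q' p)"
    by (rule scal_mult(1)[OF path_elem_closed[OF q']])
  have sc: "scal n s \<otimes>\<^bsub>path_algebra n\<^esub> path_elem q' \<in> carrier (path_algebra n)"
    by (rule path_algebra_mult_closed[OF scal_closed path_elem_closed[OF q']])
  have "?r \<oplus>\<^bsub>path_algebra n\<^esub> (scal n s \<otimes>\<^bsub>path_algebra n\<^esub> path_elem q') = path_elem q"
    unfolding sq path_algebra_simps by auto
  then have "path_elem q \<cdot> z = ?r \<cdot> z \<oplus>\<^bsub>E\<^esub> (scal n s \<otimes>\<^bsub>path_algebra n\<^esub> path_elem q') \<cdot> z"
    using smult_l_distr[OF rc sc z] by metis
  also have "\<dots> = (scal n s \<otimes>\<^bsub>path_algebra n\<^esub> path_elem q') \<cdot> z"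
    unfolding annihilated[OF r' z] by (rule M.l_zero[OF smult_closed[OF sc z]])
  also have "\<dots> = scal n s \<cdot> path_elem q' \<cdot> z" by (rule smult_assoc[OF scal_closed path_elem_closed[OF q'] z])
  finally show ?thesis .
qed

lemma x_y_act:
  assumes j: "j \<in> {1..n}" and z: "z \<in> vertex_space j"
  shows "x_sum n \<cdot> y_sum n \<cdot> z = scal n fps_X \<cdot> z"
proof -
  have zc: "z \<in> carrier E" by (rule vertex_spaceD(1)[OF z])
  have "y_sum n \<cdot> z = path_elem (j, [Y j]) \<cdot> z"
    by (rule act_eq_path_elem[OF j z y_sum_closed]) (use j y_sum_path_elem[of n j "[]"] in simp_all)
  then have "x_sum n \<cdot> y_sum n \<cdot> z = (x_sum n \<otimes>\<^bsub>path_algebra n\<^esub> path_elem (j, [Y j])) \<cdot> z"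
    using smult_assoc[OF x_sum_closed path_elem_closed[of n "(j, [Y j])"] zc] j by simp
  also have "x_sum n \<otimes>\<^bsub>path_algebra n\<^esub> path_elem (j, [Y j]) = (path_elem (j, [X j, Y j]) :: qpath \<Rightarrow> complex fps)"
    using x_sum_path_elem[of n j "[Y j]"] j csucc_cpred[OF j] by simp
  also have "path_elem (j, [X j, Y j]) \<cdot> z = scal n fps_X \<cdot> path_elem (j, []) \<cdot> z"
  proof (rule relation_act[OF _ _ _ zc])
    show "(\<lambda>p. path_elem (j, [X j, Y j]) p - fps_X * path_elem (j, []) p) \<in> circle_relations k n (fps_X :: complex fps)"
      unfolding circle_relations_def using j by blast
    show "is_path n (j, [X j, Y j])" by (rule is_path_two_cycles(1)[OF j])
    show "is_path n (j, [])" using j by simp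
  qed
  finally show ?thesis unfolding vertex_spaceD(2)[OF z] .
qed

lemma y_x_act:
  assumes j: "j \<in> {1..n}" and z: "z \<in> vertex_space j"
  shows "y_sum n \<cdot> x_sum n \<cdot> z = scal n fps_X \<cdot> z"
proof -
  have zc: "z \<in> carrier E" by (rule vertex_spaceD(1)[OF z])
  let ?j = "csucc n j"
  have p: "is_path n (j, [X ?j])" using j csucc_mem[OF j] cpred_csucc[OF j] by simp
  have "x_sum n \<cdot> z = path_elem (j, [X ?j]) \<cdot> z"
    by (rule act_eq_path_elem[OF j z x_sum_closed p]) (use j x_sum_path_elem[of n j "[]"] in simp_all)
  then have "y_sum n \<cdot> x_sum n \<cdot> z = (y_sum n \<otimes>\<^bsub>path_algebra n\<^esub> path_elem (j, [X ?j])) \<cdot> z"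
    using smult_assoc[OF y_sum_closed path_elem_closed[OF p] zc] by simp
  also have "y_sum n \<otimes>\<^bsub>path_algebra n\<^esub> path_elem (j, [X ?j]) = (path_elem (j, [Y ?j, X ?j]) :: qpath \<Rightarrow> complex fps)"
    using y_sum_path_elem[OF p] by simp
  also have "path_elem (j, [Y ?j, X ?j]) \<cdot> z = scal n fps_X \<cdot> path_elem (j, []) \<cdot> z"
  proof (rule relation_act[OF _ _ _ zc])
    show "(\<lambda>p. path_elem (j, [Y ?j, X ?j]) p - fps_X * path_elem (j, []) p) \<in> circle_relations k n (fps_X :: complex fps)"
      unfolding circle_relations_def using j by blast
    show "is_path n (j, [Y ?j, X ?j])" by (rule is_path_two_cycles(2)[OF j])
    show "is_path n (j, [])" using j by simp
  qed
  finally show ?thesis unfolding vertex_spaceD(2)[OF z] .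
qed

lemma xpow_eq_ypow:
  assumes j: "j \<in> {1..n}" and z: "z \<in> vertex_space j"
  shows "xpow k z = ypow (n - k) z"
proof -
  have zc: "z \<in> carrier E" by (rule vertex_spaceD(1)[OF z])
  have "path_elem (x_path n j k) \<cdot> z = scal n 1 \<cdot> path_elem (y_path n j (n - k)) \<cdot> z"
  proof (rule relation_act[OF _ x_path(1)[OF j] y_path(1)[OF j] zc])
    show "(\<lambda>p. path_elem (x_path n j k) p - 1 * path_elem (y_path n j (n - k)) p) \<in> circle_relations k n (fps_X :: complex fps)"
      unfolding circle_relations_def mult_1 using j by blast
  qed
  then show ?thesis
    unfolding xpow_path[OF j z] ypow_path[OF j z] scal_one_act[OF smult_closed[OF path_elem_closed[OF y_path(1)[OF j]] zc]] .
qed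

lemma xpow_ypow:
  assumes j: "j \<in> {1..n}" and z: "z \<in> vertex_space j"
  shows "xpow m (ypow m z) = scal n (fps_X ^ m) \<cdot> z"
  using j z
proof (induction m arbitrary: j z)
  case 0
  show ?case using scal_one_act[OF vertex_spaceD(1)[OF 0(2)]] by (simp add: xpow_simps ypow_simps)
next
  case (Suc m)
  have yz: "y_sum n \<cdot> z \<in> vertex_space (cpred n j)" by (rule y_vertex_space[OF Suc.prems])
  have zc: "z \<in> carrier E" by (rule vertex_spaceD(1)[OF Suc.prems(2)])
  have "xpow (Suc m) (ypow (Suc m) z) = x_sum n \<cdot> scal n (fps_X ^ m) \<cdot> y_sum n \<cdot> z"
    unfolding xpow_simps ypow_Suc_right Suc.IH[OF cpred_mem[OF Suc.prems(1)] yz] ..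
  also have "\<dots> = scal n (fps_X ^ m) \<cdot> scal n fps_X \<cdot> z"
    unfolding scal_act_commute[OF x_sum_closed vertex_spaceD(1)[OF yz]] x_y_act[OF Suc.prems] ..
  also have "\<dots> = scal n (fps_X ^ Suc m) \<cdot> z" unfolding scal_scal_act[OF zc] power_Suc2 ..
  finally show ?case .
qed

lemma xpow_add: "xpow (m + m') z = xpow m (xpow m' z)"
  by (simp add: xpow_def funpow_add)

end

abbreviation unit_vector :: "nat \<Rightarrow> nat \<Rightarrow> nat \<Rightarrow> complex fps" where
  "unit_vector n j \<equiv> \<lambda>i\<in>{1..n}. if i = j then 1 else 0"

text \<open>Only the relations in which an arrow acts as 1 are demanded of the family; those with
  weight t follow from xy = t = yx. Likewise g is prescribed at one vertex c only: going round the
  cycle, x determines g (s i) from its predecessor, because the weight of x_i is nonzero and can be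
  cancelled in M_I.\<close>

lemma (in circle_rep) section_of_family:
  assumes g: "g \<in> lmod_hom (path_algebra n) E (rank_one_rep n I)"
    and s: "\<And>j. j \<in> {1..n} \<Longrightarrow> s j \<in> vertex_space j"
    and x: "\<And>i. i \<in> {1..n} \<Longrightarrow> i \<in> I \<Longrightarrow> x_sum n \<cdot> s (cpred n i) = s i"
    and y: "\<And>i. i \<in> {1..n} \<Longrightarrow> i \<notin> I \<Longrightarrow> y_sum n \<cdot> s i = s (cpred n i)"
    and c: "c \<in> {1..n}" and gc: "g (s c) = unit_vector n c"
  shows "\<exists>h\<in>lmod_hom (path_algebra n) (rank_one_rep n I) E. \<forall>v\<in>carrier (rank_one_rep n I). g (h v) = v"
proof -
  have sc: "s j \<in> carrier E" if "j \<in> {1..n}" for j using vertex_spaceD(1)[OF s[OF that]] .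
  have rx: "x_sum n \<cdot> s (cpred n i) = scal n (arrow_weight I (X i)) \<cdot> s i" if i: "i \<in> {1..n}" for i
  proof (cases "i \<in> I")
    case True
    then show ?thesis using x[OF i True] scal_one_act[OF sc[OF i]] by simp
  next
    case False
    then show ?thesis using x_y_act[OF i s[OF i]] y[OF i False] by simp
  qed
  have ry: "y_sum n \<cdot> s i = scal n (arrow_weight I (Y i)) \<cdot> s (cpred n i)" if i: "i \<in> {1..n}" for i
  proof (cases "i \<in> I")
    case False
    then show ?thesis using y[OF i False] scal_one_act[OF sc[OF cpred_mem[OF i]]] by simp
  next
    case True
    then show ?thesis using y_x_act[OF cpred_mem[OF i] s[OF cpred_mem[OF i]]] x[OF i True] by simp
  qed
  have step: "g (s i) = unit_vector n i" if i: "i \<in> {1..n}" and IH: "g (s (cpred n i)) = unit_vector n (cpred n i)" for i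
  proof -
    let ?w = "arrow_weight I (X i)"
    have gi: "g (s i) \<in> {1..n} \<rightarrow>\<^sub>E UNIV" using lmod_homD(1)[OF g sc[OF i]] unfolding rank_one_rep_simps .
    have "g (x_sum n \<cdot> s (cpred n i)) = rank_one_act n I (x_sum n) (unit_vector n (cpred n i))"
      using lmod_homD(3)[OF g x_sum_closed sc[OF cpred_mem[OF i]]] unfolding rank_one_rep_simps IH .
    moreover have "g (scal n ?w \<cdot> s i) = (\<lambda>j\<in>{1..n}. ?w * g (s i) j)"
      using lmod_homD(3)[OF g scal_closed[of n ?w] sc[OF i]] unfolding rank_one_rep_simps rank_one_act_scal[OF gi] .
    ultimately have eq: "(\<lambda>j\<in>{1..n}. ?w * g (s i) j) = rank_one_act n I (x_sum n) (unit_vector n (cpred n i))"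
      unfolding rx[OF i] by simp
    show ?thesis
    proof
      fix j show "g (s i) j = unit_vector n i j"
      proof (cases "j \<in> {1..n}")
        case True
        have "?w * g (s i) j = (if cpred n j = cpred n i then arrow_weight I (X j) else 0)"
          using fun_cong[OF eq, of j] True cpred_mem[OF True] unfolding rank_one_act_x by (simp del: arrow_weight.simps)
        moreover have "cpred n j = cpred n i \<longleftrightarrow> j = i" using csucc_cpred[OF True] csucc_cpred[OF i] by metis
        moreover have "?w \<noteq> 0" by simp
        ultimately show ?thesis using True by (auto simp del: arrow_weight.simps)
      next
        case False
        show ?thesis using PiE_arb[OF gi False] False by (simp only: restrict_apply if_False)
      qed
    qed
  qed
  have all: "g (s ((csucc n ^^ p) c)) = unit_vector n ((csucc n ^^ p) c)" for p
  proof (induction p)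
    case 0
    show ?case using gc by simp
  next
    case (Suc p)
    have m: "(csucc n ^^ p) c \<in> {1..n}" by (rule csucc_pow_mem[OF c])
    show ?case using step[OF csucc_mem[OF m], unfolded cpred_csucc[OF m], OF Suc.IH] by (simp only: funpow.simps comp_apply)
  qed
  have gs: "g (s j) = unit_vector n j" if j: "j \<in> {1..n}" for j
  proof -
    have "j \<in> (\<lambda>p. (csucc n ^^ p) c) ` {1..n}" using csucc_pow_bij[OF c] j unfolding bij_betw_def by blast
    then show ?thesis using all by blast
  qed
  show ?thesis
  proof (rule bexI[of _ "from_basis s"])
    show "from_basis s \<in> lmod_hom (path_algebra n) (rank_one_rep n I) E"
      by (rule from_basis_hom[OF s rx ry])
    show "\<forall>v\<in>carrier (rank_one_rep n I). g (from_basis s v) = v"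
      unfolding rank_one_rep_simps using from_basis_section[OF sc g gs] by blast
  qed
qed

lemma cpred_pow_small: "s < j \<Longrightarrow> (cpred n ^^ s) j = j - s"
  by (induction s) (auto simp: cpred_def)

lemma csucc_pow_small: "1 \<le> j \<Longrightarrow> j + s \<le> n \<Longrightarrow> (csucc n ^^ s) j = j + s"
  by (induction s) (auto simp: csucc_def)

text \<open>Only the relation at the vertex \<open>a\<close> is assumed: the one at \<open>b\<close> follows from \<open>x\<^sup>2 = y\<^bsup>n - 2\<^esup>\<close>.\<close>

lemma (in circle_rep) section_of_generators:
  assumes k2: "k = 2" and ab: "1 \<le> a" "a < b" "b \<le> n"
    and g: "g \<in> lmod_hom (path_algebra n) E (rank_one_rep n {a, b})"
    and u: "u \<in> vertex_space (cpred n a)" and v: "v \<in> vertex_space (b - 1)"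
    and rel: "x_sum n \<cdot> u = ypow (b - 1 - a) v" and gu: "g u = unit_vector n (cpred n a)"
  shows "\<exists>h\<in>lmod_hom (path_algebra n) (rank_one_rep n {a, b}) E.
    \<forall>v\<in>carrier (rank_one_rep n {a, b}). g (h v) = v"
proof -
  let ?m = "b - 1 - a"
  \<comment> \<open>Off a and b every y-arrow acts as 1 on M_{a,b}, so the family is forced on each
    of the two arcs: descending y-powers of v on a, ..., b - 1 and of u on the remaining vertices.
    On the latter \<open>d j\<close> counts the y-steps from a - 1, taken cyclically, down to
    j.\<close>
  define d where "d j = (if j < a then a - 1 - j else a - 1 + n - j)" for j
  define s where "s j = (if a \<le> j \<and> j < b then ypow (b - 1 - j) v else ypow (d j) u)" for j
  have a': "a \<in> {1..n}" "b - 1 \<in> {1..n}" "b \<in> {1..n}" using ab by auto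
  have ca: "cpred n a \<in> {1..n}" by (rule cpred_mem[OF a'(1)])
  have uc: "u \<in> carrier E" and vc: "v \<in> carrier E" using vertex_spaceD(1)[OF u] vertex_spaceD(1)[OF v] .
  have pd: "(cpred n ^^ d j) (cpred n a) = j" if "j \<in> {1..n}" "\<not> (a \<le> j \<and> j < b)" for j
  proof (cases "j < a")
    case True
    then have "cpred n a = a - 1" "d j < a - 1" using that by (auto simp: cpred_def d_def)
    then show ?thesis using True that cpred_pow_small[of "d j" "a - 1" n] by (simp add: d_def)
  next
    case False
    have dj: "d j = a - 1 + n - j" "d j < n" "b \<le> j" "j \<le> n" using that False ab by (auto simp: d_def)
    show ?thesis
    proof (cases "a = 1")
      case True
      then show ?thesis using dj cpred_pow_small[of "d j" n n] ab by (simp add: cpred_def)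
    next
      case False
      have "(cpred n ^^ d j) (cpred n a) = (csucc n ^^ (n - d j)) (cpred n a)"
        using cpred_pow[OF ca, of "d j"] dj(2) by simp
      also have "\<dots> = cpred n a + (n - d j)"
        by (rule csucc_pow_small) (use False ab dj in \<open>auto simp: cpred_def\<close>)
      also have "\<dots> = j" using False ab dj by (auto simp: cpred_def)
      finally show ?thesis .
    qed
  qed
  have s_vs: "s j \<in> vertex_space j" if j: "j \<in> {1..n}" for j
  proof (cases "a \<le> j \<and> j < b")
    case True
    have "(cpred n ^^ (b - 1 - j)) (b - 1) = b - 1 - (b - 1 - j)"
      by (rule cpred_pow_small) (use True ab in auto)
    also have "\<dots> = j" using True by auto
    finally show ?thesis using ypow_vertex_space[OF a'(2) v, of "b - 1 - j"] True by (simp add: s_def)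
  next
    case False
    then have "s j = ypow (d j) u" by (simp only: s_def if_False)
    then show ?thesis using ypow_vertex_space[OF ca u, of "d j"] pd[OF j False] by simp
  qed
  have s_ca: "s (cpred n a) = u"
  proof -
    have "\<not> (a \<le> cpred n a \<and> cpred n a < b)" "d (cpred n a) = 0"
      using ab by (auto simp: cpred_def d_def)
    then show ?thesis by (simp only: s_def if_False ypow_simps)
  qed
  have "a \<le> b - 1 \<and> b - 1 < b" using ab by auto
  then have s_b1: "s (b - 1) = v" by (simp only: s_def if_True simp_thms diff_self_eq_0 ypow_simps)
  have s_a: "s a = ypow ?m v" using ab by (simp add: s_def)
  have s_b: "s b = ypow (a - 1 + n - b) u" using ab by (simp add: s_def d_def)
  \<comment> \<open>The relation at b, multiplied by t^m with m = b - 1 - a: t^m x v = x^(m+1) y^m v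
    = x^(m+2) u = x^m y^(n-2) u = t^m y^(n-2-m) u. Torsion-freeness removes t^m.\<close>
  have xv: "x_sum n \<cdot> v = ypow (a - 1 + n - b) u"
  proof (rule torsion_free_cancel[OF left_module_axioms tf, where N = ?m])
    show "x_sum n \<cdot> v \<in> carrier E" by (rule smult_closed[OF x_sum_closed vc])
    show "ypow (a - 1 + n - b) u \<in> carrier E" by (rule ypow_closed[OF uc])
    have w: "ypow (a - 1 + n - b) u \<in> vertex_space ((cpred n ^^ (a - 1 + n - b)) (cpred n a))"
      by (rule ypow_vertex_space[OF ca u])
    have "scal n (fps_X ^ ?m) \<cdot> x_sum n \<cdot> v = x_sum n \<cdot> scal n (fps_X ^ ?m) \<cdot> v"
      by (rule scal_act_commute[OF x_sum_closed vc, symmetric])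
    also have "\<dots> = xpow (Suc ?m) (ypow ?m v)" unfolding xpow_simps xpow_ypow[OF a'(2) v] ..
    also have "\<dots> = xpow (?m + 2) u" unfolding rel[symmetric] xpow_Suc_right[symmetric] by simp
    also have "\<dots> = xpow ?m (ypow (n - 2) u)" unfolding xpow_add using xpow_eq_ypow[OF ca u] k2 by simp
    also have "n - 2 = ?m + (a - 1 + n - b)" using ab by simp
    also have "xpow ?m (ypow (?m + (a - 1 + n - b)) u) = scal n (fps_X ^ ?m) \<cdot> ypow (a - 1 + n - b) u"
      unfolding ypow_add by (rule xpow_ypow[OF cpred_pow_mem[OF ca] w])
    finally show "scal n (fps_X ^ ?m) \<cdot> x_sum n \<cdot> v = scal n (fps_X ^ ?m) \<cdot> ypow (a - 1 + n - b) u" .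
  qed
  show ?thesis
  proof (rule section_of_family[OF g s_vs _ _ ca])
    fix i assume i: "i \<in> {1..n}" "i \<in> {a, b}"
    have "cpred n b = b - 1" using ab by (simp add: cpred_def)
    then show "x_sum n \<cdot> s (cpred n i) = s i"
      using i(2) s_ca s_b1 s_a s_b rel xv by auto
  next
    fix i assume i: "i \<in> {1..n}" "i \<notin> {a, b}"
    show "y_sum n \<cdot> s i = s (cpred n i)"
    proof (cases "a \<le> i \<and> i < b")
      case True
      then have "a \<le> cpred n i \<and> cpred n i < b" "b - 1 - cpred n i = Suc (b - 1 - i)"
        using i ab by (auto simp: cpred_def)
      then show ?thesis using True by (simp add: s_def ypow_simps)
    next
      case False
      then have "\<not> (a \<le> cpred n i \<and> cpred n i < b)" "d (cpred n i) = Suc (d i)"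
        using i ab by (auto simp: cpred_def d_def)
      then show ?thesis using False by (simp only: s_def if_False ypow_simps)
    qed
  next
    show "g (s (cpred n a)) = unit_vector n (cpred n a)" unfolding s_ca by (rule gu)
  qed
qed

section \<open>Removing the obstruction for noncrossing pairs\<close>

lemma path_weight_y_interval:
  assumes "1 \<le> a" "a < b" "b \<le> n"
  shows "path_weight J (y_path n (b - 1) (b - 1 - a)) = fps_X ^ card (J \<inter> {a+1..b-1})"
proof -
  have "path_weight J (y_path n (b - 1) (b - 1 - a)) = (\<Prod>s<b - 1 - a. if b - 1 - s \<in> J then fps_X else 1)"
    unfolding path_weight_y_path by (intro prod.cong refl) (use assms in \<open>auto simp: cpred_pow_small\<close>)
  also have "\<dots> = (\<Prod>j\<in>{a+1..b-1}. if j \<in> J then fps_X else 1)"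
    by (rule prod.reindex_bij_witness[of _ "\<lambda>j. b - 1 - j" "\<lambda>s. b - 1 - s"]) (use assms in auto)
  also have "\<dots> = fps_X ^ card (J \<inter> {a+1..b-1})"
    by (simp add: prod.If_cases Int_commute)
  finally show ?thesis .
qed

lemma path_weight_x_interval:
  assumes "1 \<le> a" "a < b" "b \<le> n"
  shows "path_weight J (x_path n a (b - a)) = fps_X ^ card ({a+1..b} - J)"
proof -
  have "path_weight J (x_path n a (b - a)) = (\<Prod>s=1..b - a. if a + s \<in> J then 1 else fps_X)"
    unfolding path_weight_x_path by (intro prod.cong refl) (use assms in \<open>auto simp: csucc_pow_small\<close>)
  also have "\<dots> = (\<Prod>j\<in>{a+1..b}. if j \<in> J then 1 else fps_X)"
    by (rule prod.reindex_bij_witness[of _ "\<lambda>j. j - a" "\<lambda>s. a + s"]) (use assms in auto)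
  also have "\<dots> = fps_X ^ card ({a+1..b} - J)"
    by (simp add: prod.If_cases Diff_eq)
  finally show ?thesis .
qed

text \<open>For a < b and a 2-subset J this says that the chords {a,b} and J do not cross, which is
  weak separation of 2-subsets. Chords with a common end do not count as crossing.\<close>

definition separated :: "nat \<Rightarrow> nat \<Rightarrow> nat set \<Rightarrow> bool" where
  "separated a b J \<longleftrightarrow> \<not> (\<exists>c\<in>J. \<exists>d\<in>J. a < c \<and> c < b \<and> (d < a \<or> b < d))"

text \<open>Here c is the obstruction in M_J at the vertex a. If x_a acts as 1 it is absorbed by p,
  and if J has no element strictly between a and b it is absorbed by q. Otherwise noncrossing and a
  \<notin> J put J inside {a+1..b}; then the x-path from a to b has weight t^(b-a-2), so the
  hypothesis \<open>eq\<close> makes c divisible by t, which is the weight of x_a.\<close>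

lemma correction_exists:
  fixes c \<mu> :: "complex fps"
  assumes ab: "1 \<le> a" "a < b" "b \<le> n" and J: "J \<in> k_subsets 2 n" and sep: "separated a b J"
    and eq: "fps_X ^ card ({a+1..b} - J) * c = fps_X ^ (b - 1 - a) * \<mu>"
  shows "\<exists>p q. arrow_weight J (X a) * p + c = fps_X ^ card (J \<inter> {a+1..b-1}) * q"
proof (cases "a \<in> J")
  case True
  then show ?thesis by (intro exI[of _ "- c"] exI[of _ 0]) simp
next
  case aJ: False
  show ?thesis
  proof (cases "J \<inter> {a+1..b-1} = {}")
    case True
    show ?thesis by (intro exI[of _ 0] exI[of _ c]) (simp only: True card.empty power_0 mult_1 mult_zero_right add_0)
  next
    case False
    then obtain e where "e \<in> J \<inter> {a+1..b-1}" by blast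
    then have e: "e \<in> J" "a < e" "e < b" using ab by auto
    have "J \<subseteq> {a+1..b}"
    proof
      fix d assume d: "d \<in> J"
      then have "a \<le> d" "d \<le> b" using sep e unfolding separated_def by force+
      moreover have "d \<noteq> a" using d aJ by auto
      ultimately show "d \<in> {a+1..b}" by auto
    qed
    moreover have "card J = 2" "finite J" using J by (auto simp: k_subsets_def intro: finite_subset)
    ultimately have "card ({a+1..b} - J) = b - a - 2" by (simp add: card_Diff_subset)
    \<comment> \<open>Guards the truncated subtraction in b - a - 2, which can now be seen to be one
      less than b - 1 - a.\<close>
    moreover have "2 \<le> b - a"
      using card_mono[OF _ \<open>J \<subseteq> {a+1..b}\<close>] \<open>card J = 2\<close> by simp
    ultimately have "b - 1 - a = Suc (card ({a+1..b} - J))" by simp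
    then have "c = fps_X * \<mu>" using eq by (simp add: mult.assoc)
    then show ?thesis using aJ by (intro exI[of _ "- \<mu>"] exI[of _ 0]) simp
  qed
qed

lemma left_module_sum_rank_one_rep: "left_module (path_algebra n) (direct_sum_module S (\<lambda>i. rank_one_rep n (J i)))"
  by (rule left_module_direct_sum[OF ring_path_algebra left_module_rank_one_rep])

text \<open>\<open>correction_exists\<close> in each summand. The corrections are concentrated at
  the single vertices a - 1 and b - 1, so that adding them to lifts of the two generators keeps
  these lifts in their vertex spaces.\<close>

lemma sum_correction_exists:
  fixes S :: "'i set" and J :: "'i \<Rightarrow> nat set" and n a b :: nat
  defines "N \<equiv> direct_sum_module S (\<lambda>i. rank_one_rep n (J i))"
  assumes ab: "1 \<le> a" "a < b" "b \<le> n"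
    and J: "\<And>i. i \<in> S \<Longrightarrow> J i \<in> k_subsets 2 n" and sep: "\<And>i. i \<in> S \<Longrightarrow> separated a b (J i)"
    and \<nu>: "\<nu> \<in> carrier N" "path_elem (a, []) \<odot>\<^bsub>N\<^esub> \<nu> = \<nu>" and \<mu>: "\<mu> \<in> carrier N"
    and eq: "path_elem (x_path n a (b - a)) \<odot>\<^bsub>N\<^esub> \<nu> = scal n (fps_X ^ (b - 1 - a)) \<odot>\<^bsub>N\<^esub> \<mu>"
  shows "\<exists>p q. p \<in> carrier N \<and> q \<in> carrier N \<and>
    path_elem (cpred n a, []) \<odot>\<^bsub>N\<^esub> p = p \<and> path_elem (b - 1, []) \<odot>\<^bsub>N\<^esub> q = q \<and>
    x_sum n \<odot>\<^bsub>N\<^esub> p \<oplus>\<^bsub>N\<^esub> \<nu> = path_elem (y_path n (b - 1) (b - 1 - a)) \<odot>\<^bsub>N\<^esub> q"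
proof -
  have m: "a \<in> {1..n}" "b - 1 \<in> {1..n}" "b \<in> {1..n}" using ab by auto
  have ca: "cpred n a \<in> {1..n}" by (rule cpred_mem[OF m(1)])
  have ends: "path_end n (x_path n a (b - a)) = b" "fst (x_path n a (b - a)) = a"
    "path_end n (y_path n (b - 1) (b - 1 - a)) = a" "fst (y_path n (b - 1) (b - 1 - a)) = b - 1"
    using x_path[OF m(1), of "b - a"] y_path[OF m(2), of "b - 1 - a"] ab
    by (simp_all add: csucc_pow_small cpred_pow_small)
  note N_simps = direct_sum_module_simps[of S "\<lambda>i. rank_one_rep n (J i)", folded N_def, unfolded rank_one_rep_simps]
  have comp: "\<nu> i \<in> {1..n} \<rightarrow>\<^sub>E UNIV" "\<mu> i \<in> {1..n} \<rightarrow>\<^sub>E UNIV" if "i \<in> S" for i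
    using \<nu>(1) \<mu> that unfolding N_simps by blast+
  have "\<exists>p q. arrow_weight (J i) (X a) * p + \<nu> i a = fps_X ^ card (J i \<inter> {a+1..b-1}) * q" if i: "i \<in> S" for i
  proof (rule correction_exists[OF ab J[OF i] sep[OF i]])
    have "rank_one_act n (J i) (path_elem (x_path n a (b - a))) (\<nu> i) =
        rank_one_act n (J i) (scal n (fps_X ^ (b - 1 - a))) (\<mu> i)"
      using fun_cong[OF eq, of i] i unfolding N_simps by simp
    then have "(\<lambda>l\<in>{1..n}. if b = l then fps_X ^ card ({a+1..b} - J i) * \<nu> i a else 0) =
        (\<lambda>l\<in>{1..n}. fps_X ^ (b - 1 - a) * \<mu> i l)"
      unfolding rank_one_act_path_elem rank_one_act_scal[OF comp(2)[OF i]] ends path_weight_x_interval[OF ab] .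
    from fun_cong[OF this, of b] show "fps_X ^ card ({a+1..b} - J i) * \<nu> i a = fps_X ^ (b - 1 - a) * \<mu> i b"
      unfolding restrict_apply'[OF m(3)] if_P[OF refl] .
  qed
  then have "\<forall>i. \<exists>p q. i \<in> S \<longrightarrow> arrow_weight (J i) (X a) * p + \<nu> i a = fps_X ^ card (J i \<inter> {a+1..b-1}) * q"
    by blast
  then obtain P R where PR: "\<And>i. i \<in> S \<Longrightarrow> arrow_weight (J i) (X a) * P i + \<nu> i a = fps_X ^ card (J i \<inter> {a+1..b-1}) * R i"
    by metis
  define p where "p = (\<lambda>i\<in>S. \<lambda>l\<in>{1..n}. if l = cpred n a then P i else 0)"
  define q where "q = (\<lambda>i\<in>S. \<lambda>l\<in>{1..n}. if l = b - 1 then R i else 0)"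
  have \<nu>a: "\<nu> i l = 0" if "i \<in> S" "l \<in> {1..n}" "l \<noteq> a" for i l
  proof -
    have "rank_one_act n (J i) (path_elem (a, [])) (\<nu> i) = \<nu> i"
      using fun_cong[OF \<nu>(2), of i] that(1) unfolding N_simps by simp
    from fun_cong[OF this, of l] show ?thesis
      unfolding rank_one_act_idem[OF m(1)] restrict_apply'[OF that(2)] using that(3) by simp
  qed
  have "p \<in> carrier N" "q \<in> carrier N" unfolding N_simps p_def q_def by (intro restrict_PiE_iff[THEN iffD2] ballI; simp)+
  moreover have "path_elem (cpred n a, []) \<odot>\<^bsub>N\<^esub> p = p"
    unfolding N_simps rank_one_act_idem[OF ca]
  proof (unfold p_def, rule restrict_ext)
    fix i assume "i \<in> S"
    then show "(\<lambda>l\<in>{1..n}. if l = cpred n a then (\<lambda>i\<in>S. \<lambda>l\<in>{1..n}. if l = cpred n a then P i else 0) i l else 0) =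
        (\<lambda>l\<in>{1..n}. if l = cpred n a then P i else 0)"
      by (intro restrict_ext) simp
  qed
  moreover have "path_elem (b - 1, []) \<odot>\<^bsub>N\<^esub> q = q"
    unfolding N_simps rank_one_act_idem[OF m(2)]
  proof (unfold q_def, rule restrict_ext)
    fix i assume "i \<in> S"
    then show "(\<lambda>l\<in>{1..n}. if l = b - 1 then (\<lambda>i\<in>S. \<lambda>l\<in>{1..n}. if l = b - 1 then R i else 0) i l else 0) =
        (\<lambda>l\<in>{1..n}. if l = b - 1 then R i else 0)"
      by (intro restrict_ext) simp
  qed
  moreover have "x_sum n \<odot>\<^bsub>N\<^esub> p \<oplus>\<^bsub>N\<^esub> \<nu> = path_elem (y_path n (b - 1) (b - 1 - a)) \<odot>\<^bsub>N\<^esub> q"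
    unfolding N_simps
  proof (rule restrict_ext)
    fix i assume i: "i \<in> S"
    show "(\<lambda>l\<in>{1..n}. (\<lambda>i\<in>S. rank_one_act n (J i) (x_sum n) (p i)) i l + \<nu> i l) =
        rank_one_act n (J i) (path_elem (y_path n (b - 1) (b - 1 - a))) (q i)"
      unfolding rank_one_act_path_elem ends path_weight_y_interval[OF ab] restrict_apply'[OF i]
    proof (rule restrict_ext)
      fix l assume l: "l \<in> {1..n}"
      have pl: "p i (cpred n l) = (if l = a then P i else 0)"
      proof -
        have "cpred n l = cpred n a \<longleftrightarrow> l = a" using csucc_cpred[OF l] csucc_cpred[OF m(1)] by metis
        then show ?thesis unfolding p_def restrict_apply'[OF i] restrict_apply'[OF cpred_mem[OF l]] by simp
      qed
      have qb: "q i (b - 1) = R i" unfolding q_def restrict_apply'[OF i] restrict_apply'[OF m(2)] by simp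
      show "rank_one_act n (J i) (x_sum n) (p i) l + \<nu> i l =
          (if a = l then fps_X ^ card (J i \<inter> {a+1..b-1}) * q i (b - 1) else 0)"
        unfolding rank_one_act_x restrict_apply'[OF l] pl qb
        using PR[OF i] \<nu>a[OF i l] by (cases "l = a") (auto simp del: arrow_weight.simps)
    qed
  qed
  ultimately show ?thesis by blast
qed

lemma (in abelian_monoid) add_rearrange:
  "y \<in> carrier G \<Longrightarrow> p \<in> carrier G \<Longrightarrow> x \<in> carrier G \<Longrightarrow> m \<in> carrier G \<Longrightarrow>
    y \<oplus> (p \<oplus> (x \<oplus> m)) = (x \<oplus> p) \<oplus> (m \<oplus> y)"
  by (simp add: a_ac)

text \<open>
  \<open>M\<^bsub>{a,b}\<^esub>\<close> is generated at the vertices \<open>a - 1\<close> and \<open>b - 1\<close>.  Arbitrary lifts \<open>u0\<close>, \<open>v0\<close> of the generators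
  violate the relation at the vertex \<open>a\<close> by \<open>\<alpha>\<close>.  Multiplying by \<open>x\<^bsup>b - a\<^esup>\<close> and using \<open>x\<^sup>2 = y\<^bsup>n - 2\<^esup>\<close> shows
  that \<open>x\<^bsup>b - a\<^esup> \<alpha>\<close> is divisible by \<open>t\<^bsup>b - 1 - a\<^esup>\<close>, which makes it possible to correct the lifts.
\<close>

lemma (in circle_rep) extension_splits:
  fixes S :: "'i set" and J :: "'i \<Rightarrow> nat set"
  assumes k2: "k = 2" and ab: "1 \<le> a" "a < b" "b \<le> n"
    and J: "\<And>i. i \<in> S \<Longrightarrow> J i \<in> k_subsets 2 n" and sep: "\<And>i. i \<in> S \<Longrightarrow> separated a b (J i)"
    and ses: "short_exact (path_algebra n) (direct_sum_module S (\<lambda>i. rank_one_rep n (J i))) f E g (rank_one_rep n {a, b})"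
  shows "\<exists>h\<in>lmod_hom (path_algebra n) (rank_one_rep n {a, b}) E.
    \<forall>v\<in>carrier (rank_one_rep n {a, b}). g (h v) = v"
proof -
  define N where "N = direct_sum_module S (\<lambda>i. rank_one_rep n (J i))"
  let ?I = "{a, b}" let ?m = "b - 1 - a" let ?m' = "a - 1 + n - b"
  have m: "a \<in> {1..n}" "b - 1 \<in> {1..n}" "b \<in> {1..n}" using ab by auto
  have ca: "cpred n a \<in> {1..n}" by (rule cpred_mem[OF m(1)])
  have E: "left_module (path_algebra n) E" by (rule left_module_axioms)
  have N: "left_module (path_algebra n) N" unfolding N_def by (rule left_module_sum_rank_one_rep)
  interpret N: left_module "path_algebra n" N by (rule N)
  interpret V: left_module "path_algebra n" "rank_one_rep n ?I" by (rule left_module_rank_one_rep)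
  have f: "f \<in> lmod_hom (path_algebra n) N E" "inj_on f (carrier N)"
      "f ` carrier N = {e \<in> carrier E. g e = \<zero>\<^bsub>rank_one_rep n ?I\<^esub>}"
    and g: "g \<in> lmod_hom (path_algebra n) E (rank_one_rep n ?I)" "g ` carrier E = carrier (rank_one_rep n ?I)"
    using ses unfolding short_exact_def N_def by blast+
  have fc: "f y \<in> carrier E" if "y \<in> carrier N" for y by (rule lmod_homD(1)[OF f(1) that])
  have gf: "g (f y) = \<zero>\<^bsub>rank_one_rep n ?I\<^esub>" if "y \<in> carrier N" for y using f(3) that by blast
  \<comment> \<open>Any preimage of the unit vector may be multiplied by the trivial path at j; this
    puts it into the vertex space and does not change its image.\<close>
  have lift: "\<exists>z\<in>vertex_space j. g z = unit_vector n j" if j: "j \<in> {1..n}" for j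
  proof -
    have "unit_vector n j \<in> g ` carrier E" unfolding g(2) rank_one_rep_simps by simp
    then obtain z where z: "z \<in> carrier E" "g z = unit_vector n j" by force
    have p: "is_path n (j, [])" using j by simp
    have "g (path_elem (j, []) \<cdot> z) = unit_vector n j"
      unfolding lmod_homD(3)[OF g(1) path_elem_closed[OF p] z(1)] z(2) rank_one_rep_simps rank_one_act_idem[OF j]
      by (rule restrict_ext) simp
    then show ?thesis using path_elem_vertex_space[OF p z(1)] by force
  qed
  obtain u0 where u0: "u0 \<in> vertex_space (cpred n a)" "g u0 = unit_vector n (cpred n a)" using lift[OF ca] by blast
  obtain v0 where v0: "v0 \<in> vertex_space (b - 1)" "g v0 = unit_vector n (b - 1)" using lift[OF m(2)] by blast
  have uc: "u0 \<in> carrier E" and vc: "v0 \<in> carrier E" using vertex_spaceD(1)[OF u0(1)] vertex_spaceD(1)[OF v0(1)] .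
  have xu: "x_sum n \<cdot> u0 \<in> vertex_space a" using x_vertex_space[OF ca u0(1)] unfolding csucc_cpred[OF m(1)] .
  have yv: "ypow ?m v0 \<in> vertex_space a"
    using ypow_vertex_space[OF m(2) v0(1), of ?m] cpred_pow_small[of ?m "b - 1" n] ab by simp
  note xuc = vertex_spaceD(1)[OF xu] and yvc = vertex_spaceD(1)[OF yv]
  have myc: "\<ominus>\<^bsub>E\<^esub> ypow ?m v0 \<in> carrier E" by (rule M.a_inv_closed[OF yvc])
  define \<alpha> where "\<alpha> = x_sum n \<cdot> u0 \<oplus>\<^bsub>E\<^esub> \<ominus>\<^bsub>E\<^esub> ypow ?m v0"
  have \<alpha>: "\<alpha> \<in> vertex_space a"
    unfolding \<alpha>_def by (rule vertex_space_add[OF m(1) xu vertex_space_minus[OF m(1) yv]])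
  note \<alpha>c = vertex_spaceD(1)[OF \<alpha>]
  have g\<alpha>: "g \<alpha> = \<zero>\<^bsub>rank_one_rep n ?I\<^esub>"
  proof -
    have "g (x_sum n \<cdot> u0) = unit_vector n a"
      unfolding lmod_homD(3)[OF g(1) x_sum_closed uc] u0(2) rank_one_rep_simps rank_one_act_x
    proof (rule restrict_ext)
      fix i assume i: "i \<in> {1..n}"
      have "cpred n i = cpred n a \<longleftrightarrow> i = a" using csucc_cpred[OF i] csucc_cpred[OF m(1)] by metis
      then show "arrow_weight ?I (X i) * unit_vector n (cpred n a) (cpred n i) = (if i = a then 1 else 0)"
        unfolding restrict_apply'[OF cpred_mem[OF i]] by simp
    qed
    moreover have "g (ypow ?m v0) = unit_vector n a"
    proof -
      have "?I \<inter> {a+1..b-1} = {}" using ab by auto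
      then have w: "path_weight ?I (y_path n (b - 1) ?m) = 1"
        unfolding path_weight_y_interval[OF ab] by (simp only: card.empty power_0)
      have e: "path_end n (y_path n (b - 1) ?m) = a" "fst (y_path n (b - 1) ?m) = b - 1"
        using y_path[OF m(2), of ?m] ab by (simp_all add: cpred_pow_small)
      show ?thesis
        unfolding ypow_path[OF m(2) v0(1)] lmod_homD(3)[OF g(1) path_elem_closed[OF y_path(1)[OF m(2)]] vc] v0(2)
          rank_one_rep_simps rank_one_act_path_elem w e restrict_apply'[OF m(2)]
        by (rule restrict_ext) simp
    qed
    ultimately have "g (x_sum n \<cdot> u0) = g (ypow ?m v0)" by simp
    then show ?thesis
      unfolding \<alpha>_def lmod_homD(2)[OF g(1) xuc myc] lmod_hom_minus[OF g(1) E left_module_rank_one_rep yvc]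
      using V.M.r_neg[OF lmod_homD(1)[OF g(1) yvc]] by simp
  qed
  have preimage: "\<exists>y\<in>carrier N. f y = z" if "z \<in> carrier E" "g z = \<zero>\<^bsub>rank_one_rep n ?I\<^esub>" for z
  proof -
    have "z \<in> f ` carrier N" unfolding f(3) using that by (intro CollectI conjI)
    then show ?thesis by (rule imageE) (intro bexI, rule sym)
  qed
  from preimage[OF \<alpha>c g\<alpha>] obtain \<nu> where \<nu>: "\<nu> \<in> carrier N" "f \<nu> = \<alpha>" by (rule bexE)
  \<comment> \<open>The violation of the relation at b. It is the witness for the divisibility:
    x^(b-a) \<alpha> = t^(b-1-a) \<beta>. Since g annihilates \<alpha>, it annihilates \<beta> up to
    a power of t, hence altogether, and \<beta> comes from N like \<alpha>.\<close>
  define \<beta> where "\<beta> = ypow ?m' u0 \<oplus>\<^bsub>E\<^esub> \<ominus>\<^bsub>E\<^esub> (x_sum n \<cdot> v0)"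
  have yuc: "ypow ?m' u0 \<in> carrier E" and xvc: "x_sum n \<cdot> v0 \<in> carrier E"
    by (rule ypow_closed[OF uc], rule smult_closed[OF x_sum_closed vc])
  have mxc: "\<ominus>\<^bsub>E\<^esub> (x_sum n \<cdot> v0) \<in> carrier E" by (rule M.a_inv_closed[OF xvc])
  have \<beta>c: "\<beta> \<in> carrier E" unfolding \<beta>_def by (rule M.a_closed[OF yuc mxc])
  let ?t = "scal n (fps_X ^ ?m) :: qpath \<Rightarrow> complex fps"
  have sm: "b - a = Suc ?m" using ab by simp
  have x\<alpha>: "path_elem (x_path n a (b - a)) \<cdot> \<alpha> = ?t \<cdot> \<beta>"
  proof -
    have "xpow (Suc ?m) (x_sum n \<cdot> u0) = xpow (?m + 2) u0" unfolding xpow_Suc_right[symmetric] by simp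
    also have "\<dots> = xpow ?m (ypow (n - 2) u0)" unfolding xpow_add using xpow_eq_ypow[OF ca u0(1)] k2 by simp
    also have "n - 2 = ?m + ?m'" using ab by simp
    also have "xpow ?m (ypow (?m + ?m') u0) = ?t \<cdot> ypow ?m' u0"
      unfolding ypow_add by (rule xpow_ypow[OF cpred_pow_mem[OF ca] ypow_vertex_space[OF ca u0(1)]])
    finally have 1: "xpow (Suc ?m) (x_sum n \<cdot> u0) = ?t \<cdot> ypow ?m' u0" .
    have 2: "xpow (Suc ?m) (ypow ?m v0) = ?t \<cdot> x_sum n \<cdot> v0"
      unfolding xpow_simps xpow_ypow[OF m(2) v0(1)] by (rule scal_act_commute[OF x_sum_closed vc])
    have "path_elem (x_path n a (b - a)) \<cdot> \<alpha> = xpow (Suc ?m) \<alpha>" unfolding sm by (rule xpow_path[OF m(1) \<alpha>, symmetric])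
    also have "\<dots> = ?t \<cdot> ypow ?m' u0 \<oplus>\<^bsub>E\<^esub> \<ominus>\<^bsub>E\<^esub> (?t \<cdot> x_sum n \<cdot> v0)"
      unfolding \<alpha>_def xpow_add_distrib[OF xuc myc] xpow_minus[OF yvc] 1 2 ..
    also have "\<dots> = ?t \<cdot> \<beta>"
      unfolding \<beta>_def smult_r_distr[OF scal_closed yuc mxc] smult_r_minus[OF scal_closed xvc] ..
    finally show ?thesis .
  qed
  have xpc: "path_elem (x_path n a (b - a)) \<in> carrier (path_algebra n)" by (rule path_elem_closed[OF x_path(1)[OF m(1)]])
  have "?t \<odot>\<^bsub>rank_one_rep n ?I\<^esub> g \<beta> = \<zero>\<^bsub>rank_one_rep n ?I\<^esub>"
    unfolding lmod_homD(3)[OF g(1) scal_closed \<beta>c, symmetric] x\<alpha>[symmetric] lmod_homD(3)[OF g(1) xpc \<alpha>c] g\<alpha>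
    by (rule V.smult_r_null[OF xpc])
  then have "g \<beta> = \<zero>\<^bsub>rank_one_rep n ?I\<^esub>"
    by (rule torsion_free_power[OF left_module_rank_one_rep torsion_free_rank_one_rep lmod_homD(1)[OF g(1) \<beta>c]])
  from preimage[OF \<beta>c this] obtain \<mu> where \<mu>: "\<mu> \<in> carrier N" "f \<mu> = \<beta>" by (rule bexE)
  have ea: "path_elem (a, []) \<in> carrier (path_algebra n)" by (rule trivial_path_closed[OF m(1)])
  have \<nu>a: "path_elem (a, []) \<odot>\<^bsub>N\<^esub> \<nu> = \<nu>"
  proof (rule inj_onD[OF f(2) _ N.smult_closed[OF ea \<nu>(1)] \<nu>(1)])
    show "f (path_elem (a, []) \<odot>\<^bsub>N\<^esub> \<nu>) = f \<nu>"
      unfolding lmod_homD(3)[OF f(1) ea \<nu>(1)] \<nu>(2) by (rule vertex_spaceD(2)[OF \<alpha>])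
  qed
  have eq: "path_elem (x_path n a (b - a)) \<odot>\<^bsub>N\<^esub> \<nu> = ?t \<odot>\<^bsub>N\<^esub> \<mu>"
  proof (rule inj_onD[OF f(2) _ N.smult_closed[OF xpc \<nu>(1)] N.smult_closed[OF scal_closed \<mu>(1)]])
    show "f (path_elem (x_path n a (b - a)) \<odot>\<^bsub>N\<^esub> \<nu>) = f (?t \<odot>\<^bsub>N\<^esub> \<mu>)"
      unfolding lmod_homD(3)[OF f(1) xpc \<nu>(1)] lmod_homD(3)[OF f(1) scal_closed \<mu>(1)] \<nu>(2) \<mu>(2) by (rule x\<alpha>)
  qed
  obtain p q where p: "p \<in> carrier N" "path_elem (cpred n a, []) \<odot>\<^bsub>N\<^esub> p = p"
    and q: "q \<in> carrier N" "path_elem (b - 1, []) \<odot>\<^bsub>N\<^esub> q = q"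
    and pq: "x_sum n \<odot>\<^bsub>N\<^esub> p \<oplus>\<^bsub>N\<^esub> \<nu> = path_elem (y_path n (b - 1) ?m) \<odot>\<^bsub>N\<^esub> q"
    using sum_correction_exists[where n = n and S = S and J = J and \<nu> = \<nu> and \<mu> = \<mu>, folded N_def,
        OF ab J sep \<nu>(1) \<nu>a \<mu>(1) eq] by metis
  have fp: "f p \<in> vertex_space (cpred n a)" and fq: "f q \<in> vertex_space (b - 1)"
    unfolding vertex_space_def
    using fc[OF p(1)] fc[OF q(1)] lmod_homD(3)[OF f(1) trivial_path_closed[OF ca] p(1)] lmod_homD(3)[OF f(1) trivial_path_closed[OF m(2)] q(1)]
    unfolding p(2) q(2) by simp_all
  have ypc: "path_elem (y_path n (b - 1) ?m) \<in> carrier (path_algebra n)" by (rule path_elem_closed[OF y_path(1)[OF m(2)]])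
  \<comment> \<open>The corrected lifts. The added terms come from N, so the images under g remain
    the unit vectors.\<close>
  define u where "u = u0 \<oplus>\<^bsub>E\<^esub> f p"
  define v where "v = v0 \<oplus>\<^bsub>E\<^esub> f q"
  have rel: "x_sum n \<cdot> u = ypow ?m v"
  proof -
    have xp: "x_sum n \<odot>\<^bsub>N\<^esub> p \<in> carrier N" by (rule N.smult_closed[OF x_sum_closed p(1)])
    have xfc: "x_sum n \<cdot> f p \<in> carrier E" by (rule smult_closed[OF x_sum_closed fc[OF p(1)]])
    have "ypow ?m (f q) = f (path_elem (y_path n (b - 1) ?m) \<odot>\<^bsub>N\<^esub> q)"
      unfolding ypow_path[OF m(2) fq] lmod_homD(3)[OF f(1) ypc q(1)] ..
    also have "\<dots> = x_sum n \<cdot> f p \<oplus>\<^bsub>E\<^esub> \<alpha>"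
      unfolding pq[symmetric] lmod_homD(2)[OF f(1) xp \<nu>(1)] lmod_homD(3)[OF f(1) x_sum_closed p(1)] \<nu>(2) ..
    finally have yq: "ypow ?m (f q) = x_sum n \<cdot> f p \<oplus>\<^bsub>E\<^esub> \<alpha>" .
    have "ypow ?m v = ypow ?m v0 \<oplus>\<^bsub>E\<^esub> (x_sum n \<cdot> f p \<oplus>\<^bsub>E\<^esub> \<alpha>)"
      unfolding v_def ypow_add_distrib[OF vc fc[OF q(1)]] yq ..
    also have "\<dots> = (x_sum n \<cdot> u0 \<oplus>\<^bsub>E\<^esub> x_sum n \<cdot> f p) \<oplus>\<^bsub>E\<^esub> (\<ominus>\<^bsub>E\<^esub> ypow ?m v0 \<oplus>\<^bsub>E\<^esub> ypow ?m v0)"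
      unfolding \<alpha>_def by (rule M.add_rearrange[OF yvc xfc xuc myc])
    also have "\<dots> = x_sum n \<cdot> u0 \<oplus>\<^bsub>E\<^esub> x_sum n \<cdot> f p"
      unfolding M.l_neg[OF yvc] by (rule M.r_zero[OF M.a_closed[OF xuc xfc]])
    also have "\<dots> = x_sum n \<cdot> u" unfolding u_def smult_r_distr[OF x_sum_closed uc fc[OF p(1)]] ..
    finally show ?thesis by (rule sym)
  qed
  have gu: "g u = unit_vector n (cpred n a)"
    unfolding u_def lmod_homD(2)[OF g(1) uc fc[OF p(1)]] gf[OF p(1)] V.M.r_zero[OF lmod_homD(1)[OF g(1) uc]] by (rule u0(2))
  show ?thesis
    by (rule section_of_generators[OF k2 ab g(1) _ _ rel gu])
      (unfold u_def v_def, rule vertex_space_add[OF ca u0(1) fp], rule vertex_space_add[OF m(2) v0(1) fq])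
qed

section \<open>Homomorphisms between sums of rank one modules\<close>

text \<open>A homomorphism between rank one modules is multiplication by one power series at each
  vertex, so a homomorphism out of a finite sum of them is given by the family c i j.\<close>

definition weighted_sum :: "'i set \<Rightarrow> nat \<Rightarrow> ('i \<Rightarrow> nat \<Rightarrow> complex fps) \<Rightarrow> ('i \<Rightarrow> nat \<Rightarrow> complex fps) \<Rightarrow> nat \<Rightarrow> complex fps" where
  "weighted_sum S n c z = (\<lambda>j\<in>{1..n}. \<Sum>i\<in>S. c i j * z i j)"

lemma weighted_sum_hom:
  assumes c: "\<And>i j. i \<in> S \<Longrightarrow> j \<in> {1..n} \<Longrightarrow>
    c i j * arrow_weight (J i) (X j) = arrow_weight I (X j) * c i (cpred n j)"
  shows "weighted_sum S n c \<in> lmod_hom (path_algebra n) (direct_sum_module S (\<lambda>i. rank_one_rep n (J i))) (rank_one_rep n I)"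
proof (rule lmod_hom_by_generators[OF left_module_sum_rank_one_rep left_module_rank_one_rep])
  note simps = direct_sum_module_simps rank_one_rep_simps
  \<comment> \<open>Compatibility with y follows from that with x: the weights of x_l and y_l have
    product t on every rank one module, and t can be cancelled.\<close>
  have cy: "c i j * arrow_weight (J i) (Y (csucc n j)) = arrow_weight I (Y (csucc n j)) * c i (csucc n j)"
    if i: "i \<in> S" and j: "j \<in> {1..n}" for i j
  proof -
    have w: "arrow_weight K (X l) * arrow_weight K (Y l) = fps_X" for K l by simp
    let ?l = "csucc n j"
    have "fps_X * (arrow_weight I (Y ?l) * c i ?l) = (c i ?l * arrow_weight (J i) (X ?l)) * (arrow_weight (J i) (Y ?l) * arrow_weight I (Y ?l))"
      unfolding w[of "J i" ?l, symmetric] by (simp only: mult_ac)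
    also have "\<dots> = arrow_weight I (X ?l) * c i j * (arrow_weight (J i) (Y ?l) * arrow_weight I (Y ?l))"
      unfolding c[OF i csucc_mem[OF j]] cpred_csucc[OF j] ..
    also have "\<dots> = fps_X * (c i j * arrow_weight (J i) (Y ?l))"
      unfolding w[of I ?l, symmetric] by (simp only: mult_ac)
    finally show ?thesis by simp
  qed
  fix v assume "v \<in> carrier (direct_sum_module S (\<lambda>i. rank_one_rep n (J i)))"
  then have v: "v i \<in> {1..n} \<rightarrow>\<^sub>E UNIV" if "i \<in> S" for i using that unfolding simps by blast
  show "weighted_sum S n c v \<in> carrier (rank_one_rep n I)" unfolding simps weighted_sum_def by simp
  {
    fix r
    show "weighted_sum S n c (scal n r \<odot>\<^bsub>direct_sum_module S (\<lambda>i. rank_one_rep n (J i))\<^esub> v) =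
        scal n r \<odot>\<^bsub>rank_one_rep n I\<^esub> weighted_sum S n c v"
      unfolding simps weighted_sum_def rank_one_act_scal[OF restrict_PiE_iff[THEN iffD2, OF ballI[OF UNIV_I]]]
      by (rule restrict_ext) (use rank_one_act_scal[OF v] in \<open>auto simp: sum_distrib_left mult_ac intro!: sum.cong simp del: One_nat_def\<close>)
  next
    fix l assume l: "l \<in> {1..n}"
    show "weighted_sum S n c (path_elem (l, []) \<odot>\<^bsub>direct_sum_module S (\<lambda>i. rank_one_rep n (J i))\<^esub> v) =
        path_elem (l, []) \<odot>\<^bsub>rank_one_rep n I\<^esub> weighted_sum S n c v"
      unfolding simps weighted_sum_def rank_one_act_idem[OF l]
      by (rule restrict_ext) (auto intro!: sum.cong sum.neutral)
  next
    show "weighted_sum S n c (x_sum n \<odot>\<^bsub>direct_sum_module S (\<lambda>i. rank_one_rep n (J i))\<^esub> v) =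
        x_sum n \<odot>\<^bsub>rank_one_rep n I\<^esub> weighted_sum S n c v"
      unfolding simps weighted_sum_def rank_one_act_x
    proof (rule restrict_ext)
      fix j assume j: "j \<in> {1..n}"
      have "(\<Sum>i\<in>S. c i j * (\<lambda>i\<in>S. \<lambda>i'\<in>{1..n}. arrow_weight (J i) (X i') * v i (cpred n i')) i j) =
          (\<Sum>i\<in>S. arrow_weight I (X j) * (c i (cpred n j) * v i (cpred n j)))"
      proof (rule sum.cong[OF refl])
        fix i assume i: "i \<in> S"
        show "c i j * (\<lambda>i\<in>S. \<lambda>i'\<in>{1..n}. arrow_weight (J i) (X i') * v i (cpred n i')) i j =
            arrow_weight I (X j) * (c i (cpred n j) * v i (cpred n j))"
          unfolding restrict_apply'[OF i] restrict_apply'[OF j] mult.assoc[symmetric] c[OF i j] ..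
      qed
      then show "(\<Sum>i\<in>S. c i j * (\<lambda>i\<in>S. \<lambda>i'\<in>{1..n}. arrow_weight (J i) (X i') * v i (cpred n i')) i j) =
          arrow_weight I (X j) * (\<lambda>j\<in>{1..n}. \<Sum>i\<in>S. c i j * v i j) (cpred n j)"
        unfolding restrict_apply'[OF cpred_mem[OF j]] sum_distrib_left .
    qed
  next
    show "weighted_sum S n c (y_sum n \<odot>\<^bsub>direct_sum_module S (\<lambda>i. rank_one_rep n (J i))\<^esub> v) =
        y_sum n \<odot>\<^bsub>rank_one_rep n I\<^esub> weighted_sum S n c v"
      unfolding simps weighted_sum_def rank_one_act_y
    proof (rule restrict_ext)
      fix j assume j: "j \<in> {1..n}"
      have "(\<Sum>i\<in>S. c i j * (\<lambda>i\<in>S. \<lambda>i'\<in>{1..n}. arrow_weight (J i) (Y (csucc n i')) * v i (csucc n i')) i j) =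
          (\<Sum>i\<in>S. arrow_weight I (Y (csucc n j)) * (c i (csucc n j) * v i (csucc n j)))"
      proof (rule sum.cong[OF refl])
        fix i assume i: "i \<in> S"
        show "c i j * (\<lambda>i\<in>S. \<lambda>i'\<in>{1..n}. arrow_weight (J i) (Y (csucc n i')) * v i (csucc n i')) i j =
            arrow_weight I (Y (csucc n j)) * (c i (csucc n j) * v i (csucc n j))"
          unfolding restrict_apply'[OF i] restrict_apply'[OF j] mult.assoc[symmetric] cy[OF i j] ..
      qed
      then show "(\<Sum>i\<in>S. c i j * (\<lambda>i\<in>S. \<lambda>i'\<in>{1..n}. arrow_weight (J i) (Y (csucc n i')) * v i (csucc n i')) i j) =
          arrow_weight I (Y (csucc n j)) * (\<lambda>j\<in>{1..n}. \<Sum>i\<in>S. c i j * v i j) (csucc n j)"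
        unfolding restrict_apply'[OF csucc_mem[OF j]] sum_distrib_left .
    qed
  next
    fix w assume "w \<in> carrier (direct_sum_module S (\<lambda>i. rank_one_rep n (J i)))"
    show "weighted_sum S n c (v \<oplus>\<^bsub>direct_sum_module S (\<lambda>i. rank_one_rep n (J i))\<^esub> w) =
        weighted_sum S n c v \<oplus>\<^bsub>rank_one_rep n I\<^esub> weighted_sum S n c w"
      unfolding simps weighted_sum_def
      by (rule restrict_ext) (auto simp: algebra_simps simp flip: sum.distrib intro!: sum.cong simp del: One_nat_def)
  }
qed

definition summand_incl :: "'i set \<Rightarrow> nat \<Rightarrow> 'i \<Rightarrow> (nat \<Rightarrow> complex fps) \<Rightarrow> 'i \<Rightarrow> nat \<Rightarrow> complex fps" where
  "summand_incl S n i v = (\<lambda>l\<in>S. if l = i then v else (\<lambda>j\<in>{1..n}. 0))"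

lemma summand_incl_hom:
  assumes i: "i \<in> S"
  shows "summand_incl S n i \<in> lmod_hom (path_algebra n) (rank_one_rep n (J i)) (direct_sum_module S (\<lambda>i. rank_one_rep n (J i)))"
proof -
  note simps = direct_sum_module_simps rank_one_rep_simps
  have z: "rank_one_act n (J l) f (\<lambda>j\<in>{1..n}. 0) = (\<lambda>j\<in>{1..n}. 0)" if "f \<in> carrier (path_algebra n)" for l f
    using left_module.smult_r_null[OF left_module_rank_one_rep that] unfolding rank_one_rep_simps .
  show ?thesis
    unfolding lmod_hom_def simps summand_incl_def
  proof (intro CollectI conjI ballI funcsetI)
    fix v :: "nat \<Rightarrow> complex fps" assume v: "v \<in> {1..n} \<rightarrow>\<^sub>E UNIV"
    show "(\<lambda>l\<in>S. if l = i then v else (\<lambda>j\<in>{1..n}. 0)) \<in> S \<rightarrow>\<^sub>E ({1..n} \<rightarrow>\<^sub>E UNIV)"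
      using v by (simp add: restrict_PiE_iff)
    fix w :: "nat \<Rightarrow> complex fps" assume w: "w \<in> {1..n} \<rightarrow>\<^sub>E UNIV"
    show "(\<lambda>l\<in>S. if l = i then \<lambda>j\<in>{1..n}. v j + w j else (\<lambda>j\<in>{1..n}. 0)) =
        (\<lambda>l\<in>S. \<lambda>j\<in>{1..n}. (\<lambda>l\<in>S. if l = i then v else (\<lambda>j\<in>{1..n}. 0)) l j +
          (\<lambda>l\<in>S. if l = i then w else (\<lambda>j\<in>{1..n}. 0)) l j)"
      by (rule restrict_ext) (auto intro!: restrict_ext)
  next
    fix f :: "qpath \<Rightarrow> complex fps" and v :: "nat \<Rightarrow> complex fps" assume f: "f \<in> carrier (path_algebra n)"
    show "(\<lambda>l\<in>S. if l = i then rank_one_act n (J i) f v else (\<lambda>j\<in>{1..n}. 0)) =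
        (\<lambda>l\<in>S. rank_one_act n (J l) f ((\<lambda>l\<in>S. if l = i then v else (\<lambda>j\<in>{1..n}. 0)) l))"
      by (rule restrict_ext) (simp add: z[OF f] del: One_nat_def)
  qed
qed

section \<open>Orders that decompose into rank one modules\<close>

locale necklace_order = circle_order k n B
  for k n :: nat and B :: "(qpath \<Rightarrow> complex fls) set set" +
  fixes \<I> :: "nat \<Rightarrow> nat set" and \<Theta> :: "(qpath \<Rightarrow> complex fls) set \<Rightarrow> nat \<Rightarrow> nat \<Rightarrow> complex fps"
  assumes \<I>: "\<And>i. i \<in> {1..n} \<Longrightarrow> \<I> i \<in> k_subsets k n"
    and \<Theta>: "\<Theta> \<in> lmod_hom A (res Reg) (direct_sum_module {1..n} (\<lambda>i. rank_one_rep n (\<I> i)))"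
    and \<Theta>_bij: "bij_betw \<Theta> B (carrier (direct_sum_module {1..n} (\<lambda>i. rank_one_rep n (\<I> i))))"
begin

abbreviation "DS \<equiv> direct_sum_module {1..n} (\<lambda>i. rank_one_rep n (\<I> i))"
abbreviation "\<Theta>' \<equiv> inv_into B \<Theta>"

lemma left_module_DS: "left_module A DS"
  by (rule left_module_sum_rank_one_rep)

lemma torsion_free_DS: "torsion_free n DS"
  by (rule torsion_free_direct_sum) (rule torsion_free_rank_one_rep)

lemma res_Reg_carrier: "carrier (res Reg) = B"
  by (simp only: restrict_scalars_simps Reg_simps)

lemma torsion_free_Reg: "torsion_free n (res Reg)"
proof (rule torsion_free_inj[OF \<Theta> left_module_res_Reg left_module_DS _ torsion_free_DS])
  show "inj_on \<Theta> (carrier (res Reg))" unfolding res_Reg_carrier using \<Theta>_bij by (rule bij_betw_imp_inj_on)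
qed

lemma \<Theta>': "\<Theta>' \<in> lmod_hom A DS (res Reg)"
  using lmod_hom_inv[OF \<Theta> left_module_res_Reg] \<Theta>_bij unfolding res_Reg_carrier by blast

lemma \<Theta>_\<Theta>': "z \<in> carrier DS \<Longrightarrow> \<Theta> (\<Theta>' z) = z"
  by (rule bij_betw_inv_into_right[OF \<Theta>_bij])

lemma \<Theta>'_\<Theta>: "b \<in> B \<Longrightarrow> \<Theta>' (\<Theta> b) = b"
  by (rule bij_betw_inv_into_left[OF \<Theta>_bij])

text \<open>Through the isomorphism \<open>\<Theta>\<close> a surjection of the sum of the M_{I_i}
  onto M_I becomes one of B, and this is what equips M_I with a B-action.\<close>

lemma quotient_of_weights:
  assumes I: "I \<in> k_subsets k n"
    and c: "\<And>i j. i \<in> {1..n} \<Longrightarrow> j \<in> {1..n} \<Longrightarrow>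
      c i j * arrow_weight (\<I> i) (X j) = arrow_weight I (X j) * c i (cpred n j)"
    and surj: "\<And>v. v \<in> {1..n} \<rightarrow>\<^sub>E UNIV \<Longrightarrow> \<exists>z\<in>carrier DS. weighted_sum {1..n} n c z = v"
  shows "rank_one_quotient k n B I (\<lambda>b. weighted_sum {1..n} n c (\<Theta> b))"
proof (intro rank_one_quotient.intro rank_one_quotient_axioms.intro circle_order_axioms I)
  have h: "weighted_sum {1..n} n c \<in> lmod_hom A DS (rank_one_rep n I)"
    by (rule weighted_sum_hom) (rule c)
  show "(\<lambda>b. weighted_sum {1..n} n c (\<Theta> b)) \<in> lmod_hom A (res Reg) (rank_one_rep n I)"
    by (rule lmod_hom_compose[OF \<Theta> h])
  show "(\<lambda>b. weighted_sum {1..n} n c (\<Theta> b)) ` B = {1..n} \<rightarrow>\<^sub>E UNIV"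
  proof
    show "(\<lambda>b. weighted_sum {1..n} n c (\<Theta> b)) ` B \<subseteq> {1..n} \<rightarrow>\<^sub>E UNIV"
      unfolding weighted_sum_def by auto
    show "{1..n} \<rightarrow>\<^sub>E UNIV \<subseteq> (\<lambda>b. weighted_sum {1..n} n c (\<Theta> b)) ` B"
    proof
      fix v :: "nat \<Rightarrow> complex fps" assume "v \<in> {1..n} \<rightarrow>\<^sub>E UNIV"
      from surj[OF this] obtain z where z: "z \<in> carrier DS" "weighted_sum {1..n} n c z = v" by (rule bexE)
      have "\<Theta>' z \<in> B" using lmod_homD(1)[OF \<Theta>' z(1)] unfolding res_Reg_carrier .
      then show "v \<in> (\<lambda>b. weighted_sum {1..n} n c (\<Theta> b)) ` B"
        using \<Theta>_\<Theta>'[OF z(1)] z(2) by (intro image_eqI[of _ _ "\<Theta>' z"]) simp_all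
    qed
  qed
qed

text \<open>The projection of B to its i-th summand, given by Kronecker delta weights, has the
  inclusion as a section, so both splitting criteria apply.\<close>

lemma necklace_module:
  assumes i: "i \<in> {1..n}"
  shows "rank_one_in_GP k n B (\<I> i)" "rank_one_in_add k n B (\<I> i)"
proof -
  define c :: "nat \<Rightarrow> nat \<Rightarrow> complex fps" where "c l j = (if l = i then 1 else 0)" for l j
  have incl: "summand_incl {1..n} n i \<in> lmod_hom A (rank_one_rep n (\<I> i)) DS"
    by (rule summand_incl_hom[OF i])
  have ws: "weighted_sum {1..n} n c (summand_incl {1..n} n i v) = v" if v: "v \<in> {1..n} \<rightarrow>\<^sub>E UNIV" for v
  proof
    fix j show "weighted_sum {1..n} n c (summand_incl {1..n} n i v) j = v j"
    proof (cases "j \<in> {1..n}")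
      case True
      have "weighted_sum {1..n} n c (summand_incl {1..n} n i v) j = (\<Sum>l\<in>{1..n}. if l = i then v j else 0)"
        unfolding weighted_sum_def restrict_apply'[OF True]
        by (rule sum.cong[OF refl]) (simp add: c_def summand_incl_def)
      then show ?thesis using i by simp
    next
      case False
      show ?thesis using PiE_arb[OF v False] False unfolding weighted_sum_def by (simp only: restrict_apply if_False)
    qed
  qed
  interpret q: rank_one_quotient k n B "\<I> i" "\<lambda>b. weighted_sum {1..n} n c (\<Theta> b)"
  proof (rule quotient_of_weights[OF \<I>[OF i]])
    fix l j assume "l \<in> {1..n}" "j \<in> {1..n}"
    show "c l j * arrow_weight (\<I> l) (X j) = arrow_weight (\<I> i) (X j) * c l (cpred n j)"
      by (cases "l = i") (simp_all add: c_def del: arrow_weight.simps)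
  next
    fix v :: "nat \<Rightarrow> complex fps" assume v: "v \<in> {1..n} \<rightarrow>\<^sub>E UNIV"
    show "\<exists>z\<in>carrier DS. weighted_sum {1..n} n c z = v"
      using ws[OF v] lmod_homD(1)[OF incl, unfolded rank_one_rep_simps, OF v] by (rule bexI)
  qed
  have S: "(\<lambda>v. \<Theta>' (summand_incl {1..n} n i v)) \<in> lmod_hom A (rank_one_rep n (\<I> i)) (res Reg)"
    by (rule lmod_hom_compose[OF incl \<Theta>'])
  have split: "weighted_sum {1..n} n c (\<Theta> (\<Theta>' (summand_incl {1..n} n i v))) = v" if v: "v \<in> {1..n} \<rightarrow>\<^sub>E UNIV" for v
    unfolding \<Theta>_\<Theta>'[OF lmod_homD(1)[OF incl, unfolded rank_one_rep_simps, OF v]] by (rule ws[OF v])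
  show "rank_one_in_GP k n B (\<I> i)"
    unfolding rank_one_in_GP_def
    using q.in_GP_of_splitting[OF S split torsion_free_Reg] q.Q_iso by (intro exI conjI)
  show "rank_one_in_add k n B (\<I> i)"
    unfolding rank_one_in_add_def
    using q.in_CM_Q q.in_add_of_splitting[OF S split torsion_free_Reg] q.Q_iso by (intro exI conjI)
qed

text \<open>Over the path algebra an extension of M_{a,b} by B becomes one by the sum of the
  M_{I_i}, which splits by noncrossing. The middle term is torsion-free, so the section found there
  is B-linear.\<close>

lemma in_GP_of_separated:
  assumes k2: "k = 2" and ab: "1 \<le> a" "a < b" "b \<le> n"
    and quot: "rank_one_quotient k n B {a, b} \<Phi>"
    and sep: "\<And>i. i \<in> {1..n} \<Longrightarrow> separated a b (\<I> i)"
  shows "rank_one_in_GP k n B {a, b}"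
proof -
  interpret q: rank_one_quotient k n B "{a, b}" \<Phi> by (rule quot)
  have ext: "ext1_vanishes BR q.Q Reg"
    unfolding ext1_vanishes_def
  proof (intro allI impI)
    fix E :: "((qpath \<Rightarrow> complex fls) set, (qpath \<Rightarrow> complex fls) set \<times> (nat \<Rightarrow> complex fps)) module" and f g
    assume "left_module BR E \<and> short_exact BR Reg f E g q.Q"
    then have E: "left_module BR E" and f: "f \<in> lmod_hom BR Reg E" "inj_on f (carrier Reg)"
      "f ` carrier Reg = {e \<in> carrier E. g e = \<zero>\<^bsub>q.Q\<^esub>}"
      and g: "g \<in> lmod_hom BR E q.Q" "g ` carrier E = carrier q.Q"
      unfolding short_exact_def by blast+
    have f': "f \<in> lmod_hom A (res Reg) (res E)" using lmod_hom_res f(1) by blast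
    have g': "g \<in> lmod_hom A (res E) (rank_one_rep n {a, b})"
      using lmod_hom_res g(1) unfolding q.lmod_hom_to_Q[symmetric] by blast
    have im: "\<Theta>' ` carrier DS = B" by (rule bij_betw_imp_surj_on[OF bij_betw_inv_into[OF \<Theta>_bij]])
    have inj: "inj_on \<Theta>' (carrier DS)" by (rule bij_betw_imp_inj_on[OF bij_betw_inv_into[OF \<Theta>_bij]])
    have ses: "short_exact A DS (\<lambda>z. f (\<Theta>' z)) (res E) g (rank_one_rep n {a, b})"
      unfolding short_exact_def
    proof (intro conjI g')
      show "(\<lambda>z. f (\<Theta>' z)) \<in> lmod_hom A DS (res E)" by (rule lmod_hom_compose[OF \<Theta>' f'])
      have "inj_on (f \<circ> \<Theta>') (carrier DS)"
        by (rule comp_inj_on[OF inj]) (use f(2) in \<open>simp only: im Reg_simps\<close>)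
      then show "inj_on (\<lambda>z. f (\<Theta>' z)) (carrier DS)" unfolding comp_def .
      have "(\<lambda>z. f (\<Theta>' z)) ` carrier DS = f ` \<Theta>' ` carrier DS" by (rule image_image[symmetric])
      also have "\<dots> = {e \<in> carrier E. g e = \<zero>\<^bsub>q.Q\<^esub>}" unfolding im using f(3) unfolding Reg_simps .
      finally show "(\<lambda>z. f (\<Theta>' z)) ` carrier DS = {e \<in> carrier (res E). g e = \<zero>\<^bsub>rank_one_rep n {a, b}\<^esub>}"
        unfolding restrict_scalars_simps q.Q_simps rank_one_rep_simps .
      show "g ` carrier (res E) = carrier (rank_one_rep n {a, b})"
        using g(2) unfolding restrict_scalars_simps q.Q_simps rank_one_rep_simps .
    qed
    have tf: "torsion_free n (res E)"
      by (rule torsion_free_extension[OF ses left_module_DS left_module_res[OF E] left_module_rank_one_rep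
          torsion_free_DS torsion_free_rank_one_rep])
    interpret e: circle_rep n "res E" k
    proof (intro circle_rep.intro path_rep.intro circle_rep_axioms.intro left_module_res[OF E] tf)
      fix r :: "qpath \<Rightarrow> complex fps" and z
      assume "r \<in> circle_ideal k n fps_X" "z \<in> carrier (res E)"
      then show "r \<odot>\<^bsub>res E\<^esub> z = \<zero>\<^bsub>res E\<^esub>"
        using res_circle_ideal[OF E, of r z] unfolding restrict_scalars_simps by blast
    qed
    obtain h where h: "h \<in> lmod_hom A (rank_one_rep n {a, b}) (res E)"
      and gh: "\<forall>v\<in>carrier (rank_one_rep n {a, b}). g (h v) = v"
      using e.extension_splits[OF k2 ab \<I>[unfolded k2] sep ses] by (rule bexE)
    have hB: "h \<in> lmod_hom BR q.Q E"
      by (rule lmod_hom_extend[OF _ q.left_module_Q E tf]) (unfold q.lmod_hom_from_Q, rule h)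
    have "\<forall>v\<in>carrier q.Q. g (h v) = v" using gh unfolding rank_one_rep_simps q.Q_simps .
    then show "\<exists>s\<in>lmod_hom BR q.Q E. \<forall>v\<in>carrier q.Q. g (s v) = v" by (rule bexI[of _ h, OF _ hB])
  qed
  show ?thesis
    unfolding rank_one_in_GP_def in_GP_def
    using q.in_CM_Q ext q.Q_iso by (intro exI conjI)
qed

end

section \<open>Positroids\<close>

lemma cyclic_rank_eq:
  assumes "i \<in> {1..n}" "j \<in> {1..n}"
  shows "cyclic_rank n i j = (if i \<le> j then j - i else j + n - i)"
proof (cases "i \<le> j")
  case True
  then have e: "j + n - i = (j - i) + n" by simp
  have "(j - i) mod n = j - i" by (rule mod_less) (use assms in auto)
  then show ?thesis unfolding cyclic_rank_def e mod_add_self2 using True by simp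
next
  case False
  then show ?thesis using assms by (simp add: cyclic_rank_def)
qed

lemma cyclic_rank_inj:
  assumes i: "i \<in> {1..n}"
  shows "inj_on (cyclic_rank n i) {1..n}"
proof (rule inj_onI)
  fix x y assume x: "x \<in> {1..n}" and y: "y \<in> {1..n}" and eq: "cyclic_rank n i x = cyclic_rank n i y"
  show "x = y"
    using eq x y i unfolding cyclic_rank_eq[OF i x] cyclic_rank_eq[OF i y] atLeastAtMost_iff
    by (cases "i \<le> x"; cases "i \<le> y"; simp; arith)
qed

lemma cyclic_rank_cpred:
  assumes "i \<in> {1..n}" "j \<in> {1..n}" "j \<noteq> i"
  shows "cyclic_rank n i j = Suc (cyclic_rank n i (cpred n j))"
  using assms cyclic_rank_eq[OF assms(1,2)] cyclic_rank_eq[OF assms(1) cpred_mem[OF assms(2)]]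
  by (auto simp: cpred_def split: if_splits)

lemma cyclic_rank_cpred_self:
  assumes "i \<in> {1..n}"
  shows "cyclic_rank n i (cpred n i) = n - 1"
  using assms cyclic_rank_eq[OF assms cpred_mem[OF assms]] by (auto simp: cpred_def split: if_splits)

lemma cyclic_rank_less: "i \<in> {1..n} \<Longrightarrow> cyclic_rank n i j < n"
  by (auto simp: cyclic_rank_def)

text \<open>Positions start at 0, so r refers to the first r + 1 places of the i-th cyclic order.
  Counting replaces the termwise comparison of sorted lists by one inequality for each r.\<close>

definition count_upto :: "nat \<Rightarrow> nat \<Rightarrow> nat set \<Rightarrow> nat \<Rightarrow> nat" where
  "count_upto n i K r = card {x \<in> K. cyclic_rank n i x \<le> r}"

lemma count_upto_step:
  assumes i: "i \<in> {1..n}" and j: "j \<in> {1..n}" "j \<noteq> i" and K: "K \<subseteq> {1..n}"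
  shows "count_upto n i K (cyclic_rank n i j) = count_upto n i K (cyclic_rank n i (cpred n j)) + (if j \<in> K then 1 else 0)"
proof -
  let ?r = "cyclic_rank n i"
  have fin: "finite K" using K by (rule finite_subset) simp
  have e: "?r x = Suc (?r (cpred n j)) \<longleftrightarrow> x = j" if "x \<in> K" for x
    unfolding cyclic_rank_cpred[OF i j, symmetric] using inj_onD[OF cyclic_rank_inj[OF i], of x j] that K j by blast
  have "{x \<in> K. ?r x \<le> ?r j} = {x \<in> K. ?r x \<le> ?r (cpred n j)} \<union> (if j \<in> K then {j} else {})"
    unfolding cyclic_rank_cpred[OF i j] le_Suc_eq using e by auto
  moreover have "card ({x \<in> K. ?r x \<le> ?r (cpred n j)} \<union> (if j \<in> K then {j} else {})) =
      card {x \<in> K. ?r x \<le> ?r (cpred n j)} + card (if j \<in> K then {j} else {})"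
    by (rule card_Un_disjoint) (use fin cyclic_rank_cpred[OF i j] in auto)
  ultimately show ?thesis unfolding count_upto_def by simp
qed

lemma count_upto_self:
  assumes i: "i \<in> {1..n}" and K: "K \<subseteq> {1..n}"
  shows "count_upto n i K (cyclic_rank n i i) = (if i \<in> K then 1 else 0)"
proof -
  have "cyclic_rank n i i = 0" by (simp add: cyclic_rank_eq[OF i i])
  then have "cyclic_rank n i x \<le> cyclic_rank n i i \<longleftrightarrow> x = i" if "x \<in> K" for x
    using that K i inj_onD[OF cyclic_rank_inj[OF i], of x i] by force
  then have "{x \<in> K. cyclic_rank n i x \<le> cyclic_rank n i i} = (if i \<in> K then {i} else {})" by auto
  then show ?thesis unfolding count_upto_def by simp
qed

lemma count_upto_all:
  assumes i: "i \<in> {1..n}"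
  shows "count_upto n i K (n - 1) = card K"
proof -
  have "cyclic_rank n i x \<le> n - 1" for x using cyclic_rank_less[OF i, of x] by simp
  then have "{x \<in> K. cyclic_rank n i x \<le> n - 1} = K" by simp
  then show ?thesis unfolding count_upto_def by simp
qed

section \<open>From the termwise order to counting\<close>

lemma list_all2_filter_le:
  fixes xs ys :: "nat list"
  shows "list_all2 (\<le>) xs ys \<Longrightarrow> length (filter (\<lambda>x. x \<le> r) ys) \<le> length (filter (\<lambda>x. x \<le> r) xs)"
  by (induction rule: list_all2_induct) auto

lemma length_filter_sorted_list:
  assumes "finite S"
  shows "length (filter P (sorted_list_of_set S)) = card {x \<in> S. P x}"
  using distinct_card[of "filter P (sorted_list_of_set S)"] assms by simp

text \<open>Whenever an entry in the sorted list of J is at most r, so is the entry of I in the same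
  place.\<close>

lemma cyclic_le_count:
  assumes i: "i \<in> {1..n}" and I: "I \<subseteq> {1..n}" and J: "J \<subseteq> {1..n}" and le: "cyclic_le n i I J"
  shows "count_upto n i J r \<le> count_upto n i I r"
proof -
  have *: "count_upto n i K r = length (filter (\<lambda>x. x \<le> r) (sorted_list_of_set (cyclic_rank n i ` K)))"
    if K: "K \<subseteq> {1..n}" for K
  proof -
    have fin: "finite K" using K by (rule finite_subset) simp
    have "{x \<in> cyclic_rank n i ` K. x \<le> r} = cyclic_rank n i ` {x \<in> K. cyclic_rank n i x \<le> r}" by auto
    moreover have "inj_on (cyclic_rank n i) {x \<in> K. cyclic_rank n i x \<le> r}"
      by (rule inj_on_subset[OF cyclic_rank_inj[OF i]]) (use K in auto)
    ultimately show ?thesis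
      using length_filter_sorted_list[of "cyclic_rank n i ` K" "\<lambda>x. x \<le> r"] fin
      by (simp add: count_upto_def card_image)
  qed
  show ?thesis
    using le list_all2_filter_le unfolding *[OF I] *[OF J] cyclic_le_def by blast
qed

lemma positroid_count:
  assumes "J \<in> positroid k n \<I>" "i \<in> {1..n}" "\<I> i \<in> k_subsets k n"
  shows "count_upto n i J r \<le> count_upto n i (\<I> i) r"
  by (rule cyclic_le_count) (use assms in \<open>auto simp: positroid_def k_subsets_def\<close>)

text \<open>
  The condition \<open>\<I> i \<le>\<^sub>i I\<close> says that the homomorphism \<open>M\<^bsub>\<I> i\<^esub> \<rightarrow> M\<^sub>I\<close> over \<open>\<complex>((t))\<close> that is the identity at the
  vertex \<open>i - 1\<close> is defined over \<open>\<complex>[[t]]\<close>.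
\<close>

lemma (in necklace_order) positroid_quotient:
  assumes I: "I \<in> positroid k n \<I>"
  shows "\<exists>\<Phi>. rank_one_quotient k n B I \<Phi>"
proof -
  have Ik: "I \<in> k_subsets k n" using I by (simp add: positroid_def)
  then have Is: "I \<subseteq> {1..n}" "card I = k" by (auto simp: k_subsets_def)
  have \<I>s: "\<I> i \<subseteq> {1..n}" "card (\<I> i) = k" if "i \<in> {1..n}" for i using \<I>[OF that] by (auto simp: k_subsets_def)
  \<comment> \<open>Passing x_j costs a factor t in M_I if j \<notin> I and in M_{I_i} if j \<notin>
    I_i; the exponent is the difference accumulated since i. By \<open>le\<close> below the
    subtraction never truncates.\<close>
  define c where "c i j = (fps_X :: complex fps) ^ (count_upto n i (\<I> i) (cyclic_rank n i j) - count_upto n i I (cyclic_rank n i j))" for i j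
  have le: "count_upto n i I r \<le> count_upto n i (\<I> i) r" if "i \<in> {1..n}" for i r
    by (rule positroid_count[OF I that \<I>[OF that]])
  \<comment> \<open>The vertex i - 1 is the last position, n - 1, where both sets have been counted
    completely, with k elements each. This normalisation also yields the relation at j = i, where
    the count starts anew.\<close>
  have c1: "c i (cpred n i) = 1" if i: "i \<in> {1..n}" for i
    unfolding c_def cyclic_rank_cpred_self[OF i] count_upto_all[OF i] by (simp add: Is \<I>s[OF i])
  have rel: "c i j * arrow_weight (\<I> i) (X j) = arrow_weight I (X j) * c i (cpred n j)"
    if i: "i \<in> {1..n}" and j: "j \<in> {1..n}" for i j
  proof (cases "j = i")
    case True
    show ?thesis
      using le[OF i, of "cyclic_rank n i i"]
      unfolding True c1[OF i] unfolding c_def count_upto_self[OF i \<I>s(1)[OF i]] count_upto_self[OF i Is(1)]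
      by auto
  next
    case False
    have "c i j * arrow_weight (\<I> i) (X j) = arrow_weight I (X j) * c i (cpred n j)"
      using le[OF i, of "cyclic_rank n i j"] le[OF i, of "cyclic_rank n i (cpred n j)"]
      unfolding c_def count_upto_step[OF i j False \<I>s(1)[OF i]] count_upto_step[OF i j False Is(1)]
      by (auto simp: Suc_diff_le mult.commute simp flip: power_Suc)
    then show ?thesis .
  qed
  have "rank_one_quotient k n B I (\<lambda>b. weighted_sum {1..n} n c (\<Theta> b))"
  proof (rule quotient_of_weights[OF Ik rel])
    fix v :: "nat \<Rightarrow> complex fps" assume v: "v \<in> {1..n} \<rightarrow>\<^sub>E UNIV"
    \<comment> \<open>At the vertex j only the summand i = j + 1 is used, where the weight is 1. As
      i varies, every vertex is reached, so the map is onto.\<close>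
    define z where "z = (\<lambda>i\<in>{1..n}. \<lambda>j\<in>{1..n}. if j = cpred n i then v j else 0)"
    have zc: "z \<in> carrier DS" unfolding direct_sum_module_simps rank_one_rep_simps z_def by (simp add: restrict_PiE_iff)
    have "weighted_sum {1..n} n c z = v"
    proof
      fix j show "weighted_sum {1..n} n c z j = v j"
      proof (cases "j \<in> {1..n}")
        case True
        have "weighted_sum {1..n} n c z j = (\<Sum>i\<in>{1..n}. if i = csucc n j then v j else 0)"
          unfolding weighted_sum_def restrict_apply'[OF True]
        proof (rule sum.cong[OF refl])
          fix i assume i: "i \<in> {1..n}"
          have "j = cpred n i \<longleftrightarrow> i = csucc n j" using csucc_cpred[OF i] cpred_csucc[OF True] by metis
          then show "c i j * z i j = (if i = csucc n j then v j else 0)"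
            using c1[OF i] unfolding z_def restrict_apply'[OF i] restrict_apply'[OF True] by auto
        qed
        then show ?thesis using csucc_mem[OF True] by simp
      next
        case False
        show ?thesis using PiE_arb[OF v False] False unfolding weighted_sum_def by (simp only: restrict_apply if_False)
      qed
    qed
    then show "\<exists>z\<in>carrier DS. weighted_sum {1..n} n c z = v" by (rule bexI[of _ z, OF _ zc])
  qed
  then show ?thesis by (rule exI[of "\<lambda>\<Phi>. rank_one_quotient k n B I \<Phi>"])
qed

section \<open>Rank one modules in \<open>add B\<close>\<close>

lemma (in abelian_monoid) add_interchange:
  "a \<in> carrier G \<Longrightarrow> b \<in> carrier G \<Longrightarrow> c \<in> carrier G \<Longrightarrow> d \<in> carrier G \<Longrightarrow>
    (a \<oplus> b) \<oplus> (c \<oplus> d) = (a \<oplus> c) \<oplus> (b \<oplus> d)"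
  by (simp add: a_ac)

text \<open>Every z is a sum of an element of P and one of the complement. The P-part is chosen by
  SOME, and uniqueness of the decomposition makes this choice additive and linear, so it is the
  projection that retracts onto the copy of M.\<close>

lemma in_add_retract:
  assumes R: "ring R" and M: "left_module R M" and reg: "left_module R (regular_module R)" and add: "in_add R M"
  shows "\<exists>(m::nat) s r. s \<in> lmod_hom R M (direct_sum_module {..<m} (\<lambda>_. regular_module R)) \<and>
    r \<in> lmod_hom R (direct_sum_module {..<m} (\<lambda>_. regular_module R)) M \<and> (\<forall>v\<in>carrier M. r (s v) = v)"
proof -
  obtain m :: nat and P K where PK: "submodule P R (direct_sum_module {..<m} (\<lambda>_. regular_module R))"
      "submodule K R (direct_sum_module {..<m} (\<lambda>_. regular_module R))"
      "P \<inter> K = {\<zero>\<^bsub>direct_sum_module {..<m} (\<lambda>_. regular_module R)\<^esub>}"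
      "P <+>\<^bsub>direct_sum_module {..<m} (\<lambda>_. regular_module R)\<^esub> K = carrier (direct_sum_module {..<m} (\<lambda>_. regular_module R))"
      "lmod_iso R M ((direct_sum_module {..<m} (\<lambda>_. regular_module R))\<lparr>carrier := P\<rparr>)"
    using add unfolding in_add_def Let_def by blast
  define F where "F = direct_sum_module {..<m} (\<lambda>_. regular_module R)"
  note PK = PK[folded F_def]
  have FM: "left_module R F" unfolding F_def by (rule left_module_direct_sum[OF R reg])
  interpret F: left_module R F by (rule FM)
  interpret M: left_module R M by (rule M)
  interpret P: submodule P R F by (rule PK(1))
  interpret K: submodule K R F by (rule PK(2))
  have Pc: "P \<subseteq> carrier F" and Kc: "K \<subseteq> carrier F" using P.subset K.subset by simp_all
  have Pa: "x \<oplus>\<^bsub>F\<^esub> y \<in> P" if "x \<in> P" "y \<in> P" for x y using P.m_closed[OF that] by simp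
  have Ka: "x \<oplus>\<^bsub>F\<^esub> y \<in> K" if "x \<in> K" "y \<in> K" for x y using K.m_closed[OF that] by simp
  have Pm: "\<ominus>\<^bsub>F\<^esub> x \<in> P" if "x \<in> P" for x using P.m_inv_closed[OF that] by (simp add: a_inv_def)
  have Km: "\<ominus>\<^bsub>F\<^esub> x \<in> K" if "x \<in> K" for x using K.m_inv_closed[OF that] by (simp add: a_inv_def)
  have uniq: "p = p'" if p: "p \<in> P" "p' \<in> P" and q: "q \<in> K" "q' \<in> K" and eq: "p \<oplus>\<^bsub>F\<^esub> q = p' \<oplus>\<^bsub>F\<^esub> q'" for p p' q q'
  proof -
    have c: "p \<in> carrier F" "p' \<in> carrier F" "q \<in> carrier F" "q' \<in> carrier F" using p q Pc Kc by auto
    note mc = F.M.a_inv_closed[OF c(2)] F.M.a_inv_closed[OF c(3)]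
    have "p \<oplus>\<^bsub>F\<^esub> \<ominus>\<^bsub>F\<^esub> p' = (p \<oplus>\<^bsub>F\<^esub> q) \<oplus>\<^bsub>F\<^esub> (\<ominus>\<^bsub>F\<^esub> p' \<oplus>\<^bsub>F\<^esub> \<ominus>\<^bsub>F\<^esub> q)"
    proof -
      have "(p \<oplus>\<^bsub>F\<^esub> q) \<oplus>\<^bsub>F\<^esub> (\<ominus>\<^bsub>F\<^esub> p' \<oplus>\<^bsub>F\<^esub> \<ominus>\<^bsub>F\<^esub> q) = (p \<oplus>\<^bsub>F\<^esub> \<ominus>\<^bsub>F\<^esub> p') \<oplus>\<^bsub>F\<^esub> (q \<oplus>\<^bsub>F\<^esub> \<ominus>\<^bsub>F\<^esub> q)"
        by (rule F.M.add_interchange[OF c(1,3) mc])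
      then show ?thesis unfolding F.M.r_neg[OF c(3)] F.M.r_zero[OF F.M.a_closed[OF c(1) mc(1)]] by (rule sym)
    qed
    also have "\<dots> = (p' \<oplus>\<^bsub>F\<^esub> \<ominus>\<^bsub>F\<^esub> p') \<oplus>\<^bsub>F\<^esub> (q' \<oplus>\<^bsub>F\<^esub> \<ominus>\<^bsub>F\<^esub> q)"
      unfolding eq by (rule F.M.add_interchange[OF c(2,4) mc])
    also have "\<dots> = q' \<oplus>\<^bsub>F\<^esub> \<ominus>\<^bsub>F\<^esub> q"
      unfolding F.M.r_neg[OF c(2)] by (rule F.M.l_zero[OF F.M.a_closed[OF c(4) mc(2)]])
    finally have "p \<oplus>\<^bsub>F\<^esub> \<ominus>\<^bsub>F\<^esub> p' \<in> P \<inter> K"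
      using Pa[OF p(1) Pm[OF p(2)]] Ka[OF q(2) Km[OF q(1)]] by simp
    then have "p \<oplus>\<^bsub>F\<^esub> \<ominus>\<^bsub>F\<^esub> p' = \<zero>\<^bsub>F\<^esub>" unfolding PK(3) by (rule singletonD)
    then show ?thesis by (rule F.M.eq_of_minus_zero[OF c(1,2)])
  qed
  define pr where "pr z = (SOME p. p \<in> P \<and> (\<exists>q\<in>K. z = p \<oplus>\<^bsub>F\<^esub> q))" for z
  have pr: "pr z \<in> P" "\<exists>q\<in>K. z = pr z \<oplus>\<^bsub>F\<^esub> q" if z: "z \<in> carrier F" for z
  proof -
    have "\<exists>p. p \<in> P \<and> (\<exists>q\<in>K. z = p \<oplus>\<^bsub>F\<^esub> q)" using z unfolding PK(4)[symmetric] set_add_def' by blast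
    from someI_ex[OF this] show "pr z \<in> P" "\<exists>q\<in>K. z = pr z \<oplus>\<^bsub>F\<^esub> q" unfolding pr_def by blast+
  qed
  have pr_eq: "pr (p \<oplus>\<^bsub>F\<^esub> q) = p" if "p \<in> P" "q \<in> K" for p q
  proof -
    have c: "p \<in> carrier F" "q \<in> carrier F" using that Pc Kc by auto
    have z: "p \<oplus>\<^bsub>F\<^esub> q \<in> carrier F" by (rule F.M.a_closed[OF c])
    from pr(2)[OF z] obtain q' where q': "q' \<in> K" "p \<oplus>\<^bsub>F\<^esub> q = pr (p \<oplus>\<^bsub>F\<^esub> q) \<oplus>\<^bsub>F\<^esub> q'" by (rule bexE)
    show ?thesis by (rule uniq[OF that(1) pr(1)[OF z] that(2) q'(1) q'(2), symmetric])
  qed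
  have zK: "\<zero>\<^bsub>F\<^esub> \<in> K" using PK(3) by blast
  have pr_id: "pr p = p" if "p \<in> P" for p
  proof -
    have "p \<in> carrier F" using that Pc by blast
    show ?thesis using pr_eq[OF that zK] unfolding F.M.r_zero[OF \<open>p \<in> carrier F\<close>] .
  qed
  have pr_add: "pr (x \<oplus>\<^bsub>F\<^esub> y) = pr x \<oplus>\<^bsub>F\<^esub> pr y" if x: "x \<in> carrier F" and y: "y \<in> carrier F" for x y
  proof -
    from pr(2)[OF x] obtain q where q: "q \<in> K" "x = pr x \<oplus>\<^bsub>F\<^esub> q" by (rule bexE)
    from pr(2)[OF y] obtain q' where q': "q' \<in> K" "y = pr y \<oplus>\<^bsub>F\<^esub> q'" by (rule bexE)
    have c: "pr x \<in> carrier F" "q \<in> carrier F" "pr y \<in> carrier F" "q' \<in> carrier F"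
      using q(1) q'(1) pr(1)[OF x] pr(1)[OF y] Pc Kc by auto
    have "x \<oplus>\<^bsub>F\<^esub> y = (pr x \<oplus>\<^bsub>F\<^esub> q) \<oplus>\<^bsub>F\<^esub> (pr y \<oplus>\<^bsub>F\<^esub> q')" using q(2) q'(2) by simp
    also have "\<dots> = (pr x \<oplus>\<^bsub>F\<^esub> pr y) \<oplus>\<^bsub>F\<^esub> (q \<oplus>\<^bsub>F\<^esub> q')" by (rule F.M.add_interchange[OF c])
    finally show ?thesis using pr_eq[OF Pa[OF pr(1)[OF x] pr(1)[OF y]] Ka[OF q(1) q'(1)]] by simp
  qed
  have pr_smult: "pr (a \<odot>\<^bsub>F\<^esub> x) = a \<odot>\<^bsub>F\<^esub> pr x" if a: "a \<in> carrier R" and x: "x \<in> carrier F" for a x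
  proof -
    from pr(2)[OF x] obtain q where q: "q \<in> K" "x = pr x \<oplus>\<^bsub>F\<^esub> q" by (rule bexE)
    have c: "pr x \<in> carrier F" "q \<in> carrier F" using q(1) pr(1)[OF x] Pc Kc by auto
    have "a \<odot>\<^bsub>F\<^esub> x = a \<odot>\<^bsub>F\<^esub> pr x \<oplus>\<^bsub>F\<^esub> a \<odot>\<^bsub>F\<^esub> q" using F.smult_r_distr[OF a c] q(2) by simp
    then show ?thesis using pr_eq[OF P.smult_closed[OF a pr(1)[OF x]] K.smult_closed[OF a q(1)]] by simp
  qed
  obtain h where h: "h \<in> lmod_hom R M (F\<lparr>carrier := P\<rparr>)" "bij_betw h (carrier M) P"
    using PK(5) unfolding lmod_iso_def by auto
  have h_inv: "inv_into (carrier M) h \<in> lmod_hom R (F\<lparr>carrier := P\<rparr>) M"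
    using lmod_hom_inv[OF h(1) M] h(2) by simp
  have s: "h \<in> lmod_hom R M F" using h(1) Pc by (auto simp: lmod_hom_def Pi_iff)
  have "pr \<in> lmod_hom R F (F\<lparr>carrier := P\<rparr>)"
    unfolding lmod_hom_def using pr(1) pr_add pr_smult by simp
  then have r: "(\<lambda>z. inv_into (carrier M) h (pr z)) \<in> lmod_hom R F M" by (rule lmod_hom_compose[OF _ h_inv])
  have rs: "\<forall>v\<in>carrier M. inv_into (carrier M) h (pr (h v)) = v"
  proof
    fix v assume v: "v \<in> carrier M"
    have "h v \<in> P" using bij_betwE[OF h(2)] v by blast
    then show "inv_into (carrier M) h (pr (h v)) = v" unfolding pr_id[OF \<open>h v \<in> P\<close>] by (intro bij_betw_inv_into_left[OF h(2) v])
  qed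
  show ?thesis using s r rs unfolding F_def by blast
qed

text \<open>z is a finite sum of its components and h is additive. The lemma is used twice in a row
  below: for the copies of B in a free module, and then for the rank one summands of each
  copy.\<close>

lemma direct_sum_hom_mem:
  assumes R: "ring R" and F: "\<And>i. i \<in> S \<Longrightarrow> left_module R (F i)"
    and h: "h \<in> lmod_hom R (direct_sum_module S F) N" and N: "left_module R N" and S: "finite S"
    and z: "z \<in> carrier (direct_sum_module S F)"
    and D0: "\<zero>\<^bsub>N\<^esub> \<in> D" and Da: "\<And>x y. x \<in> D \<Longrightarrow> y \<in> D \<Longrightarrow> x \<oplus>\<^bsub>N\<^esub> y \<in> D"
    and Di: "\<And>i. i \<in> S \<Longrightarrow> h (\<lambda>l\<in>S. if l = i then z i else \<zero>\<^bsub>F l\<^esub>) \<in> D"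
  shows "h z \<in> D"
proof -
  let ?DS = "direct_sum_module S F"
  have DS: "left_module R ?DS" by (rule left_module_direct_sum[OF R F])
  have am: "abelian_monoid (F i)" if "i \<in> S" for i
    using F[OF that] by (simp add: left_module_def abelian_group_def)
  have zi: "z i \<in> carrier (F i)" if "i \<in> S" for i using z that unfolding direct_sum_module_simps by blast
  let ?t = "\<lambda>T. \<lambda>l\<in>S. if l \<in> T then z l else \<zero>\<^bsub>F l\<^esub>"
  have tc: "?t T \<in> carrier ?DS" for T
    unfolding direct_sum_module_simps using zi abelian_monoid.zero_closed[OF am] by (simp add: restrict_PiE_iff)
  have "h (?t T) \<in> D" if "finite T" "T \<subseteq> S" for T
    using that
  proof (induction T)
    case empty
    have "?t {} = \<zero>\<^bsub>?DS\<^esub>" unfolding direct_sum_module_simps by simp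
    then show ?case using lmod_hom_zero[OF h DS N] D0 by simp
  next
    case (insert i T)
    have i: "i \<in> S" using insert.prems by simp
    have eq: "?t (insert i T) = ?t {i} \<oplus>\<^bsub>?DS\<^esub> ?t T"
      unfolding direct_sum_module_simps
    proof (rule restrict_ext)
      fix l assume l: "l \<in> S"
      show "(if l \<in> insert i T then z l else \<zero>\<^bsub>F l\<^esub>) = ?t {i} l \<oplus>\<^bsub>F l\<^esub> ?t T l"
        unfolding restrict_apply'[OF l]
        using abelian_monoid.r_zero[OF am[OF l] zi[OF l]] abelian_monoid.l_zero[OF am[OF l] zi[OF l]]
          abelian_monoid.l_zero[OF am[OF l] abelian_monoid.zero_closed[OF am[OF l]]] insert.hyps(2) by auto
    qed
    have hs: "h (?t (insert i T)) = h (?t {i}) \<oplus>\<^bsub>N\<^esub> h (?t T)" unfolding eq by (rule lmod_homD(2)[OF h tc tc])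
    have ti: "?t {i} = (\<lambda>l\<in>S. if l = i then z i else \<zero>\<^bsub>F l\<^esub>)" by (rule restrict_ext) auto
    have T: "T \<subseteq> S" using insert.prems by simp
    show ?case unfolding hs ti by (rule Da[OF Di[OF i] insert.IH[OF T]])
  qed
  moreover have "?t S = z"
    using z unfolding direct_sum_module_simps by (auto simp: fun_eq_iff PiE_iff extensional_def)
  ultimately show ?thesis using S by (metis order_refl)
qed

text \<open>h commutes with the trivial path at j and with scalars, so the j-th component of h v is
  a multiple of that of v; the factor is read off from the unit vector. Commutation with x relates
  the factors at neighbouring vertices.\<close>

lemma rank_one_hom_diagonal:
  assumes h: "h \<in> lmod_hom (path_algebra n) (rank_one_rep n J) (rank_one_rep n I)"
  shows "\<exists>a. (\<forall>v\<in>{1..n} \<rightarrow>\<^sub>E UNIV. \<forall>j\<in>{1..n}. h v j = a j * v j) \<and>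
    (\<forall>i\<in>{1..n}. a i * arrow_weight J (X i) = arrow_weight I (X i) * a (cpred n i))"
proof (intro exI conjI ballI)
  let ?a = "\<lambda>j. h (unit_vector n j) j"
  have uv: "unit_vector n j \<in> {1..n} \<rightarrow>\<^sub>E UNIV" for j by simp
  note h1 = lmod_homD(1)[OF h, unfolded rank_one_rep_simps] and h3 = lmod_homD(3)[OF h, unfolded rank_one_rep_simps]
  {
    fix v :: "nat \<Rightarrow> complex fps" and j assume v: "v \<in> {1..n} \<rightarrow>\<^sub>E UNIV" and j: "j \<in> {1..n}"
    have e: "path_elem (j, []) \<in> carrier (path_algebra n)" by (rule path_elem_closed) (use j in simp)
    have eq: "rank_one_act n J (path_elem (j, [])) v = rank_one_act n J (scal n (v j)) (unit_vector n j)"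
      unfolding rank_one_act_idem[OF j] rank_one_act_scal[OF uv] by (rule restrict_ext) auto
    have "h v j = rank_one_act n I (path_elem (j, [])) (h v) j"
      unfolding rank_one_act_idem[OF j] restrict_apply'[OF j] by simp
    also have "\<dots> = rank_one_act n I (scal n (v j)) (h (unit_vector n j)) j"
      unfolding h3[OF e v, symmetric] eq h3[OF scal_closed uv] ..
    also have "\<dots> = h (unit_vector n j) j * v j"
      unfolding rank_one_act_scal[OF h1[OF uv]] restrict_apply'[OF j] by (rule mult.commute)
    finally show "h v j = h (unit_vector n j) j * v j" .
  } note diag = this
  fix i assume i: "i \<in> {1..n}"
  let ?u = "unit_vector n (cpred n i)"
  have "rank_one_act n J (x_sum n) ?u \<in> {1..n} \<rightarrow>\<^sub>E UNIV" by (rule rank_one_act_closed)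
  from diag[OF this i] have "h (rank_one_act n J (x_sum n) ?u) i = ?a i * arrow_weight J (X i)"
    unfolding rank_one_act_x restrict_apply'[OF i] restrict_apply'[OF cpred_mem[OF i]] by simp
  moreover have "h (rank_one_act n J (x_sum n) ?u) i = arrow_weight I (X i) * ?a (cpred n i)"
    unfolding h3[OF x_sum_closed uv] unfolding rank_one_act_x restrict_apply'[OF i] ..
  ultimately show "?a i * arrow_weight J (X i) = arrow_weight I (X i) * ?a (cpred n i)" by simp
qed

text \<open>A composite \<open>M\<^sub>J \<rightarrow> M\<^sub>I \<rightarrow> M\<^sub>J\<close> multiplies by a scalar, which is a unit only if \<open>I = J\<close>.\<close>

lemma rank_one_hom_composite:
  assumes h: "h \<in> lmod_hom (path_algebra n) (rank_one_rep n J) (rank_one_rep n I)"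
    and g: "g \<in> lmod_hom (path_algebra n) (rank_one_rep n I) (rank_one_rep n J)"
    and IJ: "I \<noteq> J" "I \<subseteq> {1..n}" "J \<subseteq> {1..n}" and v: "v \<in> {1..n} \<rightarrow>\<^sub>E UNIV" and j: "j \<in> {1..n}"
  shows "fps_nth (g (h v) j) 0 = 0"
proof (rule ccontr)
  obtain a where a: "\<And>v j. v \<in> {1..n} \<rightarrow>\<^sub>E UNIV \<Longrightarrow> j \<in> {1..n} \<Longrightarrow> h v j = a j * v j"
    and ra: "\<And>i. i \<in> {1..n} \<Longrightarrow> a i * arrow_weight J (X i) = arrow_weight I (X i) * a (cpred n i)"
    using rank_one_hom_diagonal[OF h] by blast
  obtain b where b: "\<And>v j. v \<in> {1..n} \<rightarrow>\<^sub>E UNIV \<Longrightarrow> j \<in> {1..n} \<Longrightarrow> g v j = b j * v j"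
    and rb: "\<And>i. i \<in> {1..n} \<Longrightarrow> b i * arrow_weight I (X i) = arrow_weight J (X i) * b (cpred n i)"
    using rank_one_hom_diagonal[OF g] by blast
  assume "fps_nth (g (h v) j) 0 \<noteq> 0"
  moreover have "g (h v) j = b j * (a j * v j)"
    using b[OF lmod_homD(1)[OF h, unfolded rank_one_rep_simps, OF v] j] a[OF v j] by simp
  ultimately have unit_j: "fps_nth (b j * a j) 0 \<noteq> 0" by auto
  \<comment> \<open>In the composite the weights of x_i on the two modules cancel, so it multiplies
    by the same power series at every vertex.\<close>
  have const: "b i * a i = b (cpred n i) * a (cpred n i)" if i: "i \<in> {1..n}" for i
  proof -
    let ?J = "arrow_weight J (X i)" and ?I = "arrow_weight I (X i)"
    have "(?I * ?J) * (b i * a i) = (b i * ?I) * (a i * ?J)" by (simp only: mult_ac)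
    also have "\<dots> = (?I * ?J) * (b (cpred n i) * a (cpred n i))" unfolding ra[OF i] rb[OF i] by (simp only: mult_ac)
    finally have "b i * a i = b (cpred n i) * a (cpred n i) \<or> ?I * ?J = 0" by (simp only: mult_cancel_left) blast
    moreover have "?I * ?J \<noteq> 0" by simp
    ultimately show ?thesis by blast
  qed
  have unit: "fps_nth (b ((csucc n ^^ p) j) * a ((csucc n ^^ p) j)) 0 \<noteq> 0" for p
  proof (induction p)
    case 0
    show ?case using unit_j by simp
  next
    case (Suc p)
    have m: "(csucc n ^^ p) j \<in> {1..n}" by (rule csucc_pow_mem[OF j])
    have "(csucc n ^^ Suc p) j = csucc n ((csucc n ^^ p) j)" by simp
    then show ?case using const[OF csucc_mem[OF m]] Suc.IH unfolding cpred_csucc[OF m] by metis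
  qed
  have unit': "fps_nth (a i) 0 \<noteq> 0" if i: "i \<in> {1..n}" for i
  proof -
    have "i \<in> (\<lambda>p. (csucc n ^^ p) j) ` {1..n}" using csucc_pow_bij[OF j] i unfolding bij_betw_def by blast
    then show ?thesis using unit by auto
  qed
  \<comment> \<open>The factors of h at neighbouring vertices have nonzero constant terms, so
    comparing constant terms shows that x_i acts as 1 on both modules or as t on both.\<close>
  have "i \<in> I \<longleftrightarrow> i \<in> J" if i: "i \<in> {1..n}" for i
    using arg_cong[OF ra[OF i], of "\<lambda>f. fps_nth f 0"] unit'[OF i] unit'[OF cpred_mem[OF i]]
    by (auto split: if_splits)
  then show False using IJ by blast
qed

text \<open>M_J is a retract of some B^m, so its identity is a sum of composites M_J \<rightarrow>
  M_{I_i} \<rightarrow> M_J. If J were none of the I_i, each of them would have its image in D = t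
  M_J, and so would the identity; the vector with all entries 1 refutes this.\<close>

lemma (in necklace_order) in_add_necklace:
  assumes J: "J \<in> k_subsets k n" and add: "rank_one_in_add k n B J" and n: "0 < n"
  shows "J \<in> \<I> ` {1..n}"
proof (rule ccontr)
  assume notin: "J \<notin> \<I> ` {1..n}"
  obtain M :: "((qpath \<Rightarrow> complex fls) set, nat \<Rightarrow> complex fps) module" where
    CM: "in_CM k n B M" and ad: "in_add BR M" and iso: "lmod_iso (Calg k n) (rank_one_module n J) (as_C_module k n M)"
    using add unfolding rank_one_in_add_def by blast
  have M: "left_module BR M" using CM by (simp add: in_CM_def)
  have pb: "pulls_back k n (rank_one_module n J) (rank_one_rep n J)" by (rule pulls_back_rank_one[OF J k])
  have car: "carrier (rank_one_module n J) = carrier (rank_one_rep n J)" "carrier (as_C_module k n M) = carrier (res M)"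
    using pb pulls_back_as_C_module[of k n M] unfolding pulls_back_def by blast+
  obtain \<phi> where \<phi>: "\<phi> \<in> lmod_hom A (rank_one_rep n J) (res M)" "bij_betw \<phi> (carrier (rank_one_rep n J)) (carrier (res M))"
    using iso unfolding lmod_iso_def lmod_hom_pulls_back[OF pb pulls_back_as_C_module] car by (rule bexE)
  have \<phi>': "inv_into (carrier (rank_one_rep n J)) \<phi> \<in> lmod_hom A (res M) (rank_one_rep n J)"
    by (rule lmod_hom_inv[OF \<phi>(1) left_module_rank_one_rep \<phi>(2)])
  obtain m :: nat and s r where sr: "s \<in> lmod_hom BR M (direct_sum_module {..<m} (\<lambda>_. Reg))"
      "r \<in> lmod_hom BR (direct_sum_module {..<m} (\<lambda>_. Reg)) M" "\<forall>v\<in>carrier M. r (s v) = v"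
    using in_add_retract[OF BR.ring_axioms M left_module_Reg ad] by blast
  let ?F = "direct_sum_module {..<m} (\<lambda>_. Reg)" and ?F' = "direct_sum_module {..<m} (\<lambda>_. res Reg)"
  let ?V = "rank_one_rep n J"
  have Fc: "carrier (res ?F) = carrier ?F'" unfolding restrict_scalars_simps direct_sum_module_simps ..
  have FF: "lmod_hom A N (res ?F) = lmod_hom A N ?F'" "lmod_hom A (res ?F) N' = lmod_hom A ?F' N'"
    for N :: "(qpath \<Rightarrow> complex fps, nat \<Rightarrow> complex fps) module" and N' :: "(qpath \<Rightarrow> complex fps, nat \<Rightarrow> complex fps) module"
    unfolding lmod_hom_def restrict_scalars_simps direct_sum_module_simps by (rule refl)+
  define s' where "s' v = s (\<phi> v)" for v
  define r' where "r' z = inv_into (carrier ?V) \<phi> (r z)" for z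
  have s': "s' \<in> lmod_hom A ?V ?F'"
    using lmod_hom_compose[OF \<phi>(1)] lmod_hom_res sr(1) unfolding FF(1)[symmetric] s'_def by blast
  have r': "r' \<in> lmod_hom A ?F' ?V"
    using lmod_hom_compose[OF _ \<phi>'] lmod_hom_res sr(2) unfolding FF(2)[symmetric] r'_def by blast
  have rs: "r' (s' v) = v" if v: "v \<in> carrier ?V" for v
  proof -
    have "\<phi> v \<in> carrier M" using lmod_homD(1)[OF \<phi>(1) v] unfolding restrict_scalars_simps .
    then have "r (s (\<phi> v)) = \<phi> v" using sr(3) by blast
    then show ?thesis unfolding s'_def r'_def using bij_betw_inv_into_left[OF \<phi>(2) v] by simp
  qed
  define D where "D = {v \<in> carrier ?V. \<forall>j\<in>{1..n}. fps_nth (v j) 0 = 0}"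
  have D0: "\<zero>\<^bsub>?V\<^esub> \<in> D" unfolding D_def rank_one_rep_simps by simp
  have Da: "x \<oplus>\<^bsub>?V\<^esub> y \<in> D" if "x \<in> D" "y \<in> D" for x y
    using that unfolding D_def rank_one_rep_simps by simp
  have incl_F: "(\<lambda>b. \<lambda>l'\<in>{..<m}. if l' = l then b else \<zero>\<^bsub>res Reg\<^esub>) \<in> lmod_hom A (res Reg) ?F'" if l: "l \<in> {..<m}" for l
  proof -
    interpret Rg: left_module A "res Reg" by (rule left_module_res_Reg)
    have z2: "\<zero>\<^bsub>res Reg\<^esub> \<oplus>\<^bsub>res Reg\<^esub> \<zero>\<^bsub>res Reg\<^esub> = \<zero>\<^bsub>res Reg\<^esub>" by (rule Rg.M.l_zero[OF Rg.M.zero_closed])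
    show ?thesis
      unfolding lmod_hom_def direct_sum_module_simps
    proof (intro CollectI conjI ballI funcsetI)
      fix x assume x: "x \<in> carrier (res Reg)"
      show "(\<lambda>l'\<in>{..<m}. if l' = l then x else \<zero>\<^bsub>res Reg\<^esub>) \<in> {..<m} \<rightarrow>\<^sub>E carrier (res Reg)"
        using x Rg.M.zero_closed by (simp add: restrict_PiE_iff)
      fix y
      show "(\<lambda>l'\<in>{..<m}. if l' = l then x \<oplus>\<^bsub>res Reg\<^esub> y else \<zero>\<^bsub>res Reg\<^esub>) =
          (\<lambda>i\<in>{..<m}. (\<lambda>l'\<in>{..<m}. if l' = l then x else \<zero>\<^bsub>res Reg\<^esub>) i \<oplus>\<^bsub>res Reg\<^esub>
            (\<lambda>l'\<in>{..<m}. if l' = l then y else \<zero>\<^bsub>res Reg\<^esub>) i)"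
        by (rule restrict_ext) (simp add: z2)
    next
      fix f :: "qpath \<Rightarrow> complex fps" and x assume f: "f \<in> carrier A"
      show "(\<lambda>l'\<in>{..<m}. if l' = l then f \<odot>\<^bsub>res Reg\<^esub> x else \<zero>\<^bsub>res Reg\<^esub>) =
          (\<lambda>i\<in>{..<m}. f \<odot>\<^bsub>res Reg\<^esub> (\<lambda>l'\<in>{..<m}. if l' = l then x else \<zero>\<^bsub>res Reg\<^esub>) i)"
        by (rule restrict_ext) (simp add: Rg.smult_r_null[OF f])
    qed
  qed
  have proj_F: "(\<lambda>z. z l) \<in> lmod_hom A ?F' (res Reg)" if l: "l \<in> {..<m}" for l
    unfolding lmod_hom_def direct_sum_module_simps using l by auto
  have proj_DS: "(\<lambda>z. z i) \<in> lmod_hom A DS (rank_one_rep n (\<I> i))" if i: "i \<in> {1..n}" for i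
    unfolding lmod_hom_def direct_sum_module_simps using i by (auto simp del: One_nat_def atLeastAtMost_iff)
  have mem: "v \<in> D" if v: "v \<in> carrier ?V" for v
  proof -
    have "r' (s' v) \<in> D"
    proof (rule direct_sum_hom_mem[OF ring_path_algebra left_module_res_Reg r' left_module_rank_one_rep finite_lessThan
          lmod_homD(1)[OF s' v] D0 Da])
      fix l assume l: "l \<in> {..<m}"
      let ?inc = "\<lambda>b. \<lambda>l'\<in>{..<m}. if l' = l then b else \<zero>\<^bsub>res Reg\<^esub>"
      let ?b = "s' v l"
      have sl: "(\<lambda>v. s' v l) \<in> lmod_hom A ?V (res Reg)" by (rule lmod_hom_compose[OF s' proj_F[OF l]])
      have ts: "(\<lambda>v. \<Theta> (s' v l)) \<in> lmod_hom A ?V DS" by (rule lmod_hom_compose[OF sl \<Theta>])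
      have rl: "(\<lambda>b. r' (?inc b)) \<in> lmod_hom A (res Reg) ?V" by (rule lmod_hom_compose[OF incl_F[OF l] r'])
      have rt: "(\<lambda>z. r' (?inc (\<Theta>' z))) \<in> lmod_hom A DS ?V" by (rule lmod_hom_compose[OF \<Theta>' rl])
      have "r' (?inc (\<Theta>' (\<Theta> ?b))) \<in> D"
      proof (rule direct_sum_hom_mem[OF ring_path_algebra left_module_rank_one_rep rt left_module_rank_one_rep
            finite_atLeastAtMost lmod_homD(1)[OF ts v] D0 Da])
        fix i assume i: "i \<in> {1..n}"
        have h: "(\<lambda>v. \<Theta> (s' v l) i) \<in> lmod_hom A ?V (rank_one_rep n (\<I> i))"
          by (rule lmod_hom_compose[OF ts proj_DS[OF i]])
        have g: "(\<lambda>w. r' (?inc (\<Theta>' (summand_incl {1..n} n i w)))) \<in> lmod_hom A (rank_one_rep n (\<I> i)) ?V"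
          by (rule lmod_hom_compose[OF summand_incl_hom[OF i] rt])
        have ne: "\<I> i \<noteq> J" using notin i by blast
        have sub: "\<I> i \<subseteq> {1..n}" "J \<subseteq> {1..n}" using \<I>[OF i] J by (auto simp: k_subsets_def)
        have "r' (?inc (\<Theta>' (summand_incl {1..n} n i (\<Theta> ?b i)))) \<in> D"
          unfolding D_def
        proof (intro CollectI conjI ballI)
          show "r' (?inc (\<Theta>' (summand_incl {1..n} n i (\<Theta> ?b i)))) \<in> carrier ?V"
            by (rule lmod_homD(1)[OF g lmod_homD(1)[OF h v]])
          fix j assume j: "j \<in> {1..n}"
          show "fps_nth (r' (?inc (\<Theta>' (summand_incl {1..n} n i (\<Theta> ?b i)))) j) 0 = 0"
            by (rule rank_one_hom_composite[OF h g ne sub v[unfolded rank_one_rep_simps] j])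
        qed
        then show "r' (?inc (\<Theta>' (\<lambda>l\<in>{1..n}. if l = i then \<Theta> ?b i else \<zero>\<^bsub>rank_one_rep n (\<I> l)\<^esub>))) \<in> D"
          unfolding summand_incl_def rank_one_rep_simps .
      qed
      moreover have "?b \<in> B" using lmod_homD(1)[OF sl v] unfolding res_Reg_carrier .
      ultimately show "r' (?inc ?b) \<in> D" unfolding \<Theta>'_\<Theta>[OF \<open>?b \<in> B\<close>] by blast
    qed
    then show ?thesis unfolding rs[OF v] .
  qed
  have "(\<lambda>j\<in>{1..n}. 1) \<in> D" by (rule mem) (simp add: rank_one_rep_simps)
  then have "\<forall>j\<in>{1..n}. False" unfolding D_def by auto
  then show False using n by auto
qed

section \<open>Grassmann necklaces of rank two\<close>

text \<open>The step from I_j to I_{j+1} can remove j only, so an element x of I_i survives until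
  I_x is reached.\<close>

lemma grassmann_necklace_persist:
  assumes neck: "grassmann_necklace k n \<I>" and i: "i \<in> {1..n}" and x: "x \<in> \<I> i"
  shows "j \<in> {1..n} \<Longrightarrow> cyclic_rank n i j \<le> cyclic_rank n i x \<Longrightarrow> x \<in> \<I> j"
proof (induction "cyclic_rank n i j" arbitrary: j)
  case 0
  have "cyclic_rank n i j = cyclic_rank n i i" using 0(1) by (simp add: cyclic_rank_eq[OF i i])
  then have "j = i" using inj_onD[OF cyclic_rank_inj[OF i]] 0(2) i by blast
  then show ?case using x by simp
next
  case (Suc r)
  have "j \<noteq> i" using Suc.hyps(2) by (auto simp: cyclic_rank_eq[OF i i])
  then have r: "cyclic_rank n i j = Suc (cyclic_rank n i (cpred n j))" by (rule cyclic_rank_cpred[OF i Suc.prems(1)])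
  have m: "cpred n j \<in> {1..n}" by (rule cpred_mem[OF Suc.prems(1)])
  have "x \<in> \<I> (cpred n j)" using Suc.hyps(1)[OF _ m] Suc.hyps(2) Suc.prems(2) r by simp
  moreover have "x \<noteq> cpred n j" using r Suc.prems(2) by auto
  moreover have "\<I> (cpred n j) - {cpred n j} \<subseteq> \<I> (csucc n (cpred n j))"
    using neck m unfolding grassmann_necklace_def by blast
  ultimately show ?case unfolding csucc_cpred[OF Suc.prems(1)] by blast
qed

section \<open>Crossing chords and the cyclic order\<close>

lemma cyclic_rank_add:
  assumes "p \<in> {1..n}" "a \<in> {1..n}" "q \<in> {1..n}" "cyclic_rank n p a \<le> cyclic_rank n p q"
  shows "cyclic_rank n p q = cyclic_rank n p a + cyclic_rank n a q"
  using assms(4) assms(1-3)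
  unfolding cyclic_rank_eq[OF assms(1,2)] cyclic_rank_eq[OF assms(1,3)] cyclic_rank_eq[OF assms(2,3)]
  by (auto split: if_splits)

lemma crossing_ranks:
  assumes "lo \<in> {1..n}" "hi \<in> {1..n}" "c \<in> {1..n}" "d \<in> {1..n}" "lo < c" "c < hi" "d < lo \<or> hi < d"
  shows "cyclic_rank n c hi < cyclic_rank n c d \<and> cyclic_rank n c d < cyclic_rank n c lo"
    "cyclic_rank n d lo < cyclic_rank n d c \<and> cyclic_rank n d c < cyclic_rank n d hi"
  using assms(5-7) assms(1-4)
  unfolding cyclic_rank_eq[OF assms(3,2)] cyclic_rank_eq[OF assms(3,4)] cyclic_rank_eq[OF assms(3,1)]
    cyclic_rank_eq[OF assms(4,1)] cyclic_rank_eq[OF assms(4,3)] cyclic_rank_eq[OF assms(4,2)]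
  by auto

lemma two_subset_eq:
  assumes "I \<in> k_subsets 2 n" "x \<in> I" "y \<in> I" "x \<noteq> y"
  shows "I = {x, y}"
proof -
  have "finite I" "card I = 2" using assms(1) by (auto simp: k_subsets_def intro: finite_subset)
  then show ?thesis using assms(2-4) card_subset_eq[of I "{x, y}"] by auto
qed

lemma two_subset_mem: "a \<in> {1..n} \<Longrightarrow> b \<in> {1..n} \<Longrightarrow> a \<noteq> b \<Longrightarrow> {a, b} \<in> k_subsets 2 n"
  by (auto simp: k_subsets_def)

locale rank_two_necklace =
  fixes n :: nat and \<I> :: "nat \<Rightarrow> nat set"
  assumes neck: "grassmann_necklace 2 n \<I>"
begin

lemma neck_subset: "i \<in> {1..n} \<Longrightarrow> \<I> i \<in> k_subsets 2 n"
  using neck unfolding grassmann_necklace_def by blast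

lemma neck_mem: "i \<in> {1..n} \<Longrightarrow> x \<in> \<I> i \<Longrightarrow> x \<in> {1..n}"
  using neck_subset unfolding k_subsets_def by blast

text \<open>Compare the counts at position 0 of the order that starts with a: J has an element
  there, so I_a must have one, and it can only be a.\<close>

lemma positroid_nonloop:
  assumes a: "a \<in> {1..n}" and J: "J \<in> positroid 2 n \<I>" and aJ: "a \<in> J"
  shows "a \<in> \<I> a"
proof -
  have "J \<subseteq> {1..n}" "\<I> a \<subseteq> {1..n}" using J neck_subset[OF a] by (auto simp: positroid_def k_subsets_def)
  then show ?thesis
    using positroid_count[OF J a neck_subset[OF a], of "cyclic_rank n a a"] aJ
    by (auto simp: count_upto_self[OF a] split: if_splits)
qed

text \<open>Elements between \<open>p\<close> and its successor \<open>q\<close> in the necklace are parallel to \<open>p\<close>.\<close>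

lemma parallel_not_in_positroid:
  assumes p: "p \<in> {1..n}" and I: "\<I> p = {p, q}" and a: "a \<in> {1..n}" "a \<noteq> p"
    and r: "cyclic_rank n p a < cyclic_rank n p q"
  shows "{p, a} \<notin> positroid 2 n \<I>"
proof
  assume J: "{p, a} \<in> positroid 2 n \<I>"
  have r0: "cyclic_rank n p p = 0" by (simp add: cyclic_rank_eq[OF p p])
  \<comment> \<open>Up to the position of a, the set {p,a} has two elements and I_p has only p,
    because q comes later. This contradicts the counting inequality for members of the
    positroid.\<close>
  have "{x \<in> {p, a}. cyclic_rank n p x \<le> cyclic_rank n p a} = {p, a}" using r0 by auto
  then have "count_upto n p {p, a} (cyclic_rank n p a) = 2" using a(2) by (simp add: count_upto_def)
  moreover have "{x \<in> \<I> p. cyclic_rank n p x \<le> cyclic_rank n p a} \<subseteq> {p}" unfolding I using r by auto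
  then have "count_upto n p (\<I> p) (cyclic_rank n p a) \<le> 1"
    unfolding count_upto_def using card_mono[of "{p}"] by fastforce
  ultimately show False using positroid_count[OF J p neck_subset[OF p], of "cyclic_rank n p a"] by simp
qed

text \<open>Whichever of x and y comes first after i is reached while the other one is still in the
  necklace, so both belong to the member indexed by it.\<close>

lemma first_element:
  assumes i: "i \<in> {1..n}" and I: "x \<in> \<I> i" "y \<in> \<I> i" "x \<noteq> y"
  shows "\<I> x = {x, y} \<or> \<I> y = {y, x}"
proof -
  have x: "x \<in> {1..n}" and y: "y \<in> {1..n}" using neck_mem[OF i] I by blast+
  note persist = grassmann_necklace_persist[OF neck i]
  show ?thesis
  proof (cases "cyclic_rank n i x \<le> cyclic_rank n i y")
    case True
    then have "x \<in> \<I> x" "y \<in> \<I> x" using persist[OF I(1) x] persist[OF I(2) x] by auto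
    then show ?thesis using two_subset_eq[OF neck_subset[OF x]] I(3) by blast
  next
    case False
    then have "x \<in> \<I> y" "y \<in> \<I> y" using persist[OF I(1) y] persist[OF I(2) y] by auto
    then show ?thesis using two_subset_eq[OF neck_subset[OF y]] I(3) by blast
  qed
qed

text \<open>A member of the necklace that crosses {lo,hi} has the form I_p = {p,q}. For a take the
  one of lo and hi that is met on the way from p to q: then q persists into I_a, and a \<in> I_a
  because a lies in a member of the positroid. These are the data for the exchange in
  \<open>Pluecker_parallel\<close>.\<close>

lemma crossing:
  assumes lo: "lo \<in> {1..n}" and hi: "hi \<in> {1..n}" and i: "i \<in> {1..n}"
    and J: "{lo, hi} \<in> positroid 2 n \<I>" and ns: "\<not> separated lo hi (\<I> i)"
  shows "\<exists>p q a b. {a, b} = {lo, hi} \<and> p \<in> {1..n} \<and> q \<in> {1..n} \<and> \<I> p = {p, q} \<and> \<I> a = {a, q} \<and> a \<noteq> q \<and> p \<noteq> q \<and>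
    a \<noteq> p \<and> b \<noteq> p \<and> b \<noteq> q \<and> cyclic_rank n p a < cyclic_rank n p q"
proof -
  obtain c d where cd: "c \<in> \<I> i" "d \<in> \<I> i" "lo < c" "c < hi" "d < lo \<or> hi < d"
    using ns unfolding separated_def by blast
  have c: "c \<in> {1..n}" and d: "d \<in> {1..n}" using neck_mem[OF i] cd by blast+
  have ne: "c \<noteq> d" using cd by auto
  note ranks = crossing_ranks[OF lo hi c d cd(3-5)]
  have *: "\<I> a = {a, q}" if p: "p \<in> {1..n}" "\<I> p = {p, q}" and q: "q \<in> {1..n}" and a: "a \<in> {lo, hi}" "a \<noteq> q"
    and r: "cyclic_rank n p a < cyclic_rank n p q" for p q a
  proof -
    have am: "a \<in> {1..n}" using a lo hi by blast
    have "q \<in> \<I> a" by (rule grassmann_necklace_persist[OF neck p(1) _ am]) (use p(2) r in auto)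
    moreover have "a \<in> \<I> a" by (rule positroid_nonloop[OF am J a(1)])
    ultimately show ?thesis using two_subset_eq[OF neck_subset[OF am]] a(2) by blast
  qed
  from first_element[OF i cd(1,2) ne] show ?thesis
  proof
    assume I: "\<I> c = {c, d}"
    have h: "\<I> hi = {hi, d}" by (rule *[OF c I d]) (use cd ranks in auto)
    have n': "hi \<noteq> d" "hi \<noteq> c" "lo \<noteq> c" "lo \<noteq> d" using cd by auto
    show ?thesis
      by (rule exI[of _ c], rule exI[of _ d], rule exI[of _ hi], rule exI[of _ lo])
        (intro conjI insert_commute c d I h n' ne conjunct1[OF ranks(1)])
  next
    assume I: "\<I> d = {d, c}"
    have h: "\<I> lo = {lo, c}" by (rule *[OF d I c]) (use cd ranks in auto)
    have n': "hi \<noteq> d" "hi \<noteq> c" "lo \<noteq> c" "lo \<noteq> d" using cd by auto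
    show ?thesis
      by (rule exI[of _ d], rule exI[of _ c], rule exI[of _ lo], rule exI[of _ hi])
        (intro conjI refl c d I h n' ne[symmetric] conjunct1[OF ranks(2)])
  qed
qed

end

section \<open>Coordinate rings\<close>

text \<open>Pluecker coordinates are indexed by sets, whereas the minor of two columns depends on
  their order; the sign mediates.\<close>

definition pair_sign :: "nat \<Rightarrow> nat \<Rightarrow> complex" where "pair_sign a b = (if a < b then 1 else -1)"

lemma det_two: "det (mat 2 2 f) = f (0, 0) * f (1, 1) - f (0, 1) * f (1, 0 :: nat)" for f :: "nat \<times> nat \<Rightarrow> complex"
proof -
  let ?A = "mat 2 2 f"
  have single: "det (mat_delete ?A i 0) = mat_delete ?A i 0 $$ (0, 0)" for i
    by (rule det_single) (use mat_delete_carrier[of ?A 2 2 i 0] in simp)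
  have "det ?A = (\<Sum>i<2. ?A $$ (i, 0) * cofactor ?A i 0)"
    by (rule laplace_expansion_column) auto
  also have "\<dots> = ?A $$ (0, 0) * cofactor ?A 0 0 + ?A $$ (1, 0) * cofactor ?A 1 0"
    by (simp add: numeral_2_eq_2)
  also have "\<dots> = f (0, 0) * f (1, 1) - f (0, 1) * f (1, 0)"
    unfolding cofactor_def single by (simp add: mat_delete_def)
  finally show ?thesis .
qed

lemma Gr_cone_two:
  assumes V: "V \<in> Gr_cone 2 n"
  shows "\<exists>u w. \<forall>a\<in>{1..n}. \<forall>b\<in>{1..n}. a \<noteq> b \<longrightarrow> Pluecker {a, b} V = pair_sign a b * (u a * w b - u b * w a)"
proof -
  obtain M where M: "V = (\<lambda>I\<in>k_subsets 2 n. det (mat 2 2 (\<lambda>(r, s). M $$ (r, sorted_list_of_set I ! s - 1))))"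
    using V unfolding Gr_cone_def by blast
  define u where "u a = M $$ (0, a - 1)" for a
  define w where "w a = M $$ (1, a - 1)" for a
  have lt: "Pluecker {a, b} V = u a * w b - u b * w a" if ab: "a \<in> {1..n}" "b \<in> {1..n}" "a < b" for a b
  proof -
    have s: "sorted_list_of_set {a, b} = [a, b]" using ab(3) by simp
    have k: "{a, b} \<in> k_subsets 2 n" using ab by (intro two_subset_mem) auto
    show ?thesis
      unfolding Pluecker_def M restrict_apply'[OF k] s
      by (simp add: det_two u_def w_def)
  qed
  show ?thesis
  proof (intro exI ballI impI)
    fix a b assume ab: "a \<in> {1..n}" "b \<in> {1..n}" "a \<noteq> b"
    show "Pluecker {a, b} V = pair_sign a b * (u a * w b - u b * w a)"
    proof (cases "a < b")
      case True
      then show ?thesis using lt[OF ab(1,2)] by (simp add: pair_sign_def)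
    next
      case False
      then show ?thesis using lt[OF ab(2,1)] ab(3) by (simp add: pair_sign_def insert_commute)
    qed
  qed
qed

text \<open>In the three-term Pluecker relation for a, b, p, q one product has the factor
  \<Delta>_{p,a} = 0, so \<Delta>_{a,b} can be solved for. All signs square to 1 and may therefore
  be collected on one side.\<close>

lemma Pluecker_parallel:
  assumes V: "V \<in> Gr_cone 2 n" and m: "a \<in> {1..n}" "b \<in> {1..n}" "p \<in> {1..n}" "q \<in> {1..n}"
    and ne: "a \<noteq> b" "p \<noteq> q" "p \<noteq> b" "a \<noteq> q" "a \<noteq> p"
    and par: "Pluecker {p, a} V = 0" and pq: "Pluecker {p, q} V \<noteq> 0"
  shows "Pluecker {a, b} V = pair_sign a b * pair_sign p q * pair_sign p b * pair_sign a q *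
    Pluecker {p, b} V * Pluecker {a, q} V * inverse (Pluecker {p, q} V)"
proof -
  obtain u w where uw: "\<And>a b. a \<in> {1..n} \<Longrightarrow> b \<in> {1..n} \<Longrightarrow> a \<noteq> b \<Longrightarrow>
      Pluecker {a, b} V = pair_sign a b * (u a * w b - u b * w a)"
    using Gr_cone_two[OF V] by blast
  have sq: "pair_sign x y * pair_sign x y = 1" and nz: "pair_sign x y \<noteq> 0" for x y by (simp_all add: pair_sign_def)
  let ?d = "\<lambda>x y. u x * w y - u y * w x"
  have d: "?d x y = pair_sign x y * Pluecker {x, y} V" if "x \<in> {1..n}" "y \<in> {1..n}" "x \<noteq> y" for x y
    using sq[of x y] by (simp add: uw[OF that] mult.assoc[symmetric])
  have pa: "?d p a = 0" using d[OF m(3,1)] ne par by simp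
  have "?d a b * ?d p q = ?d p b * ?d a q - ?d p a * ?d b q"
    by (simp add: algebra_simps)
  then have "pair_sign a b * Pluecker {a, b} V * (pair_sign p q * Pluecker {p, q} V) =
      pair_sign p b * Pluecker {p, b} V * (pair_sign a q * Pluecker {a, q} V)"
    unfolding pa d[OF m(1,2) ne(1)] d[OF m(3,4) ne(2)] d[OF m(3,2) ne(3)] d[OF m(1,4) ne(4)] by simp
  then have "(pair_sign a b * pair_sign a b) * (pair_sign p q * pair_sign p q) * (Pluecker {a, b} V * Pluecker {p, q} V) =
      pair_sign a b * pair_sign p q * pair_sign p b * pair_sign a q * Pluecker {p, b} V * Pluecker {a, q} V"
    by (simp add: mult_ac)
  then show ?thesis unfolding sq using pq by (simp add: field_simps)
qed

section \<open>Subalgebras of functions and the localised coordinate ring\<close>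

lemma generated_algebra_cmult:
  "f \<in> generated_algebra D S \<Longrightarrow> (\<lambda>V\<in>D. c * f V) \<in> generated_algebra D S"
  using generated_algebra.mult[OF generated_algebra.const[of c D S]] by (simp cong: restrict_cong)

lemma generated_algebra_prod:
  assumes "finite T" "\<And>i. i \<in> T \<Longrightarrow> (\<lambda>V\<in>D. g i V) \<in> generated_algebra D S"
  shows "(\<lambda>V\<in>D. \<Prod>i\<in>T. g i V) \<in> generated_algebra D S"
  using assms
proof (induction T)
  case empty
  show ?case unfolding prod.empty by (rule generated_algebra.const)
next
  case (insert i T)
  have "(\<lambda>V\<in>D. (\<lambda>V\<in>D. g i V) V * (\<lambda>V\<in>D. \<Prod>i\<in>T. g i V) V) \<in> generated_algebra D S"
    using insert by (intro generated_algebra.mult) auto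
  also have "(\<lambda>V\<in>D. (\<lambda>V\<in>D. g i V) V * (\<lambda>V\<in>D. \<Prod>i\<in>T. g i V) V) = (\<lambda>V\<in>D. \<Prod>i\<in>insert i T. g i V)"
    using insert.hyps by (intro restrict_ext) simp
  finally show ?case .
qed

lemma generated_algebra_power:
  assumes "(\<lambda>V\<in>D. g V) \<in> generated_algebra D S"
  shows "(\<lambda>V\<in>D. g V ^ m) \<in> generated_algebra D S"
  using generated_algebra_prod[of "{..<m}" "\<lambda>_. g" D S] assms by simp

lemma coord_ring_positroid_prod:
  assumes "finite T" "T \<subseteq> k_subsets k n"
  shows "(\<lambda>V\<in>positroid_variety k n \<I>. \<Prod>I\<in>T. Pluecker I V) \<in> coord_ring_positroid k n \<I>"
  unfolding coord_ring_positroid_def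
  by (rule generated_algebra_prod[OF assms(1)], rule generated_algebra.gen) (use assms(2) in auto)

lemma open_positroid_subset: "open_positroid_variety k n \<I> \<subseteq> positroid_variety k n \<I>"
  by (auto simp: open_positroid_variety_def)

text \<open>Isolates what the modules have to provide: G consists of Pluecker coordinates and
  inverses of necklace coordinates, contains all of the latter, and generates all Pluecker
  coordinates. With D the product over the necklace, the inverse of \<Delta>_J is the product of the
  other factors over D; conversely 1/D^m is a power of the product of the inverses.\<close>

lemma generated_algebra_eq_coord_ring:
  fixes k n :: nat and \<I> :: "nat \<Rightarrow> nat set" and G :: "((nat set \<Rightarrow> complex) \<Rightarrow> complex) set"
  assumes \<I>: "\<And>i. i \<in> {1..n} \<Longrightarrow> \<I> i \<in> k_subsets k n"
    and G: "\<And>g. g \<in> G \<Longrightarrow> (\<exists>I\<in>k_subsets k n. g = Pluecker I) \<or> (\<exists>J\<in>\<I> ` {1..n}. g = (\<lambda>V. inverse (Pluecker J V)))"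
    and inv: "\<And>J. J \<in> \<I> ` {1..n} \<Longrightarrow> (\<lambda>V. inverse (Pluecker J V)) \<in> G"
    and gen: "\<And>I. I \<in> k_subsets k n \<Longrightarrow>
      restrict (Pluecker I) (open_positroid_variety k n \<I>) \<in> generated_algebra (open_positroid_variety k n \<I>) G"
  shows "generated_algebra (open_positroid_variety k n \<I>) G = coord_ring_open_positroid k n \<I>"
proof
  let ?O = "open_positroid_variety k n \<I>" and ?P = "positroid_variety k n \<I>"
  let ?N = "\<I> ` {1..n}"
  \<comment> \<open>The product runs over the set of necklace members, so repeated members count
    once, as in \<open>coord_ring_open_positroid\<close>.\<close>
  define D where "D V = (\<Prod>I\<in>?N. Pluecker I V)" for V
  have N: "finite ?N" "?N \<subseteq> k_subsets k n" using \<I> by auto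
  have OP: "V \<in> ?P" if "V \<in> ?O" for V using open_positroid_subset that by blast
  have nz: "Pluecker J V \<noteq> 0" if "V \<in> ?O" "J \<in> ?N" for V J
    using that unfolding open_positroid_variety_def by blast
  have Dnz: "D V \<noteq> 0" if "V \<in> ?O" for V unfolding D_def using nz[OF that] N(1) by simp
  have Dc: "(\<lambda>V\<in>?P. D V) \<in> coord_ring_positroid k n \<I>"
    unfolding D_def by (rule coord_ring_positroid_prod[OF N])
  have Dp: "(\<lambda>V\<in>?P. D V ^ m) \<in> coord_ring_positroid k n \<I>" for m
    using Dc unfolding coord_ring_positroid_def by (rule generated_algebra_power)
  have mem: "g \<in> coord_ring_open_positroid k n \<I> \<longleftrightarrow> (\<exists>f m. g = (\<lambda>V\<in>?O. f V / D V ^ m) \<and> f \<in> coord_ring_positroid k n \<I>)" for g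
    unfolding coord_ring_open_positroid_def D_def by blast
  show "generated_algebra ?O G \<subseteq> coord_ring_open_positroid k n \<I>"
  proof
    fix g assume "g \<in> generated_algebra ?O G"
    then show "g \<in> coord_ring_open_positroid k n \<I>"
    proof induction
      case (const c)
      have "(\<lambda>V\<in>?P. c) \<in> coord_ring_positroid k n \<I>"
        unfolding coord_ring_positroid_def by (rule generated_algebra.const)
      moreover have "(\<lambda>V\<in>?O. c) = (\<lambda>V\<in>?O. (\<lambda>V\<in>?P. c) V / D V ^ 0)"
        by (rule restrict_ext) (simp add: OP)
      ultimately show ?case unfolding mem by blast
    next
      case (gen g)
      from G[OF gen] show ?case
      proof (elim disjE bexE)
        fix I assume I: "I \<in> k_subsets k n" and g: "g = Pluecker I"
        have "restrict (Pluecker I) ?P \<in> coord_ring_positroid k n \<I>"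
          unfolding coord_ring_positroid_def using I by (intro generated_algebra.gen imageI)
        moreover have "restrict g ?O = (\<lambda>V\<in>?O. restrict (Pluecker I) ?P V / D V ^ 0)"
          by (rule restrict_ext) (simp add: OP g)
        ultimately show ?thesis unfolding mem by blast
      next
        fix J assume J: "J \<in> ?N" and g: "g = (\<lambda>V. inverse (Pluecker J V))"
        have "(\<lambda>V\<in>?P. \<Prod>I\<in>?N - {J}. Pluecker I V) \<in> coord_ring_positroid k n \<I>"
          by (rule coord_ring_positroid_prod) (use N in auto)
        moreover have "restrict g ?O = (\<lambda>V\<in>?O. (\<lambda>V\<in>?P. \<Prod>I\<in>?N - {J}. Pluecker I V) V / D V ^ 1)"
        proof (rule restrict_ext)
          fix V assume V: "V \<in> ?O"
          have "D V = Pluecker J V * (\<Prod>I\<in>?N - {J}. Pluecker I V)"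
            unfolding D_def by (rule prod.remove[OF N(1) J])
          then show "g V = (\<lambda>V\<in>?P. \<Prod>I\<in>?N - {J}. Pluecker I V) V / D V ^ 1"
            unfolding restrict_apply'[OF OP[OF V]] using Dnz[OF V] by (simp add: g field_simps)
        qed
        ultimately show ?thesis unfolding mem by blast
      qed
    next
      case (add g h)
      from add.IH obtain f m f' m' where f: "g = (\<lambda>V\<in>?O. f V / D V ^ m)" "f \<in> coord_ring_positroid k n \<I>"
        and f': "h = (\<lambda>V\<in>?O. f' V / D V ^ m')" "f' \<in> coord_ring_positroid k n \<I>" unfolding mem by blast
      have "(\<lambda>V\<in>?P. (\<lambda>V\<in>?P. f V * (\<lambda>V\<in>?P. D V ^ m') V) V + (\<lambda>V\<in>?P. f' V * (\<lambda>V\<in>?P. D V ^ m) V) V) \<in> coord_ring_positroid k n \<I>"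
        using f(2) f'(2) Dp unfolding coord_ring_positroid_def by (intro generated_algebra.add generated_algebra.mult)
      moreover have "(\<lambda>V\<in>?O. g V + h V) = (\<lambda>V\<in>?O. (\<lambda>V\<in>?P. (\<lambda>V\<in>?P. f V * (\<lambda>V\<in>?P. D V ^ m') V) V +
          (\<lambda>V\<in>?P. f' V * (\<lambda>V\<in>?P. D V ^ m) V) V) V / D V ^ (m + m'))"
        by (rule restrict_ext) (simp add: OP f(1) f'(1) Dnz field_simps power_add)
      ultimately show ?case unfolding mem by blast
    next
      case (mult g h)
      from mult.IH obtain f m f' m' where f: "g = (\<lambda>V\<in>?O. f V / D V ^ m)" "f \<in> coord_ring_positroid k n \<I>"
        and f': "h = (\<lambda>V\<in>?O. f' V / D V ^ m')" "f' \<in> coord_ring_positroid k n \<I>" unfolding mem by blast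
      have "(\<lambda>V\<in>?P. f V * f' V) \<in> coord_ring_positroid k n \<I>"
        using f(2) f'(2) unfolding coord_ring_positroid_def by (rule generated_algebra.mult)
      moreover have "(\<lambda>V\<in>?O. g V * h V) = (\<lambda>V\<in>?O. (\<lambda>V\<in>?P. f V * f' V) V / D V ^ (m + m'))"
        by (rule restrict_ext) (simp add: OP f(1) f'(1) power_add)
      ultimately show ?case unfolding mem by blast
    qed
  qed
  show "coord_ring_open_positroid k n \<I> \<subseteq> generated_algebra ?O G"
  proof
    fix g assume "g \<in> coord_ring_open_positroid k n \<I>"
    then obtain f m where g: "g = (\<lambda>V\<in>?O. f V / D V ^ m)" and f: "f \<in> coord_ring_positroid k n \<I>"
      unfolding mem by blast
    have rf: "restrict f ?O \<in> generated_algebra ?O G"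
      using f unfolding coord_ring_positroid_def
    proof induction
      case (const c)
      have "restrict (\<lambda>V\<in>?P. c) ?O = (\<lambda>V\<in>?O. c)" by (rule restrict_ext) (simp add: OP)
      then show ?case using generated_algebra.const by metis
    next
      case (gen f)
      then obtain I where I: "I \<in> k_subsets k n" "f = Pluecker I" by blast
      have eq: "restrict (restrict f ?P) ?O = restrict (Pluecker I) ?O" by (rule restrict_ext) (simp add: OP I(2))
      show ?case unfolding eq by (rule assms(4)[OF I(1)])
    next
      case (add f h)
      have eq: "restrict (\<lambda>V\<in>?P. f V + h V) ?O = (\<lambda>V\<in>?O. restrict f ?O V + restrict h ?O V)"
        by (rule restrict_ext) (simp add: OP)
      show ?case unfolding eq by (rule generated_algebra.add[OF add.IH])
    next
      case (mult f h)
      have eq: "restrict (\<lambda>V\<in>?P. f V * h V) ?O = (\<lambda>V\<in>?O. restrict f ?O V * restrict h ?O V)"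
        by (rule restrict_ext) (simp add: OP)
      show ?case unfolding eq by (rule generated_algebra.mult[OF mult.IH])
    qed
    have "(\<lambda>V\<in>?O. \<Prod>J\<in>?N. inverse (Pluecker J V)) \<in> generated_algebra ?O G"
      by (rule generated_algebra_prod[OF N(1)]) (rule generated_algebra.gen[OF inv])
    then have "(\<lambda>V\<in>?O. (\<Prod>J\<in>?N. inverse (Pluecker J V)) ^ m) \<in> generated_algebra ?O G"
      by (rule generated_algebra_power)
    from generated_algebra.mult[OF rf this]
    have "(\<lambda>V\<in>?O. restrict f ?O V * (\<lambda>V\<in>?O. (\<Prod>J\<in>?N. inverse (Pluecker J V)) ^ m) V) \<in> generated_algebra ?O G" .
    also have "(\<lambda>V\<in>?O. restrict f ?O V * (\<lambda>V\<in>?O. (\<Prod>J\<in>?N. inverse (Pluecker J V)) ^ m) V) = g"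
      unfolding g by (rule restrict_ext) (simp add: D_def prod_inversef[unfolded o_def] power_inverse divide_inverse)
    finally show "g \<in> generated_algebra ?O G" .
  qed
qed

text \<open>
  Each crossing with the necklace is removed by replacing one element with a parallel one of which
  the necklace successor is farther away.
\<close>

lemma (in rank_two_necklace) Pluecker_generated:
  fixes G :: "((nat set \<Rightarrow> complex) \<Rightarrow> complex) set"
  defines "O' \<equiv> open_positroid_variety 2 n \<I>"
  assumes neck_gen: "\<And>i. i \<in> {1..n} \<Longrightarrow> Pluecker (\<I> i) \<in> G"
    and neck_inv: "\<And>i. i \<in> {1..n} \<Longrightarrow> (\<lambda>V. inverse (Pluecker (\<I> i) V)) \<in> G"
    and sep_gen: "\<And>a b. a \<in> {1..n} \<Longrightarrow> b \<in> {1..n} \<Longrightarrow> a < b \<Longrightarrow> {a, b} \<in> positroid 2 n \<I> \<Longrightarrow>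
      (\<And>i. i \<in> {1..n} \<Longrightarrow> separated a b (\<I> i)) \<Longrightarrow> Pluecker {a, b} \<in> G"
    and ab: "a \<in> {1..n}" "b \<in> {1..n}" "a \<noteq> b"
  shows "restrict (Pluecker {a, b}) O' \<in> generated_algebra O' G"
proof -
  \<comment> \<open>If I_a = {a,q}, then a has rank 0 and contributes n, while q contributes n minus
    its distance from a. Thus \<mu> drops when a is replaced by an element with the same successor q
    from which q is farther away.\<close>
  define \<mu> where "\<mu> a = (\<Sum>x\<in>\<I> a. n - cyclic_rank n a x)" for a
  have main: "restrict (Pluecker {a, b}) O' \<in> generated_algebra O' G"
    if "a \<in> {1..n}" "b \<in> {1..n}" "a \<noteq> b" "\<mu> a + \<mu> b = s" for a b s
    using that
  proof (induction s arbitrary: a b rule: less_induct)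
    case (less s)
    note ab = less.prems(1-3)
    have vanish: "Pluecker I V = 0" if "I \<in> k_subsets 2 n" "I \<notin> positroid 2 n \<I>" "V \<in> O'" for I V
      using that unfolding O'_def open_positroid_variety_def positroid_variety_def by blast
    show ?case
    proof (cases "{a, b} \<in> positroid 2 n \<I>")
      case False
      have eq: "restrict (Pluecker {a, b}) O' = (\<lambda>V\<in>O'. 0)"
        by (rule restrict_ext) (rule vanish[OF two_subset_mem[OF ab] False])
      show ?thesis unfolding eq by (rule generated_algebra.const)
    next
      case J: True
      define lo where "lo = min a b"
      define hi where "hi = max a b"
      have lohi: "lo \<in> {1..n}" "hi \<in> {1..n}" "lo < hi" "{lo, hi} = {a, b}"
        using ab by (auto simp: lo_def hi_def min_def max_def)
      have J': "{lo, hi} \<in> positroid 2 n \<I>" unfolding lohi(4) by (rule J)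
      show ?thesis
      proof (cases "\<forall>i\<in>{1..n}. separated lo hi (\<I> i)")
        case True
        then have "Pluecker {lo, hi} \<in> G" by (intro sep_gen[OF lohi(1-3) J']) blast
        then show ?thesis unfolding lohi(4) by (rule generated_algebra.gen)
      next
        case False
        then obtain i where i: "i \<in> {1..n}" "\<not> separated lo hi (\<I> i)" by blast
        obtain p q c d where eq: "{c, d} = {lo, hi}" and p: "p \<in> {1..n}" and q: "q \<in> {1..n}"
          and Ip: "\<I> p = {p, q}" and Ic: "\<I> c = {c, q}" and ne: "c \<noteq> q" "p \<noteq> q" "c \<noteq> p" "d \<noteq> p" "d \<noteq> q"
          and r: "cyclic_rank n p c < cyclic_rank n p q"
          using crossing[OF lohi(1,2) i(1) J' i(2)] by blast
        have cd: "{c, d} = {a, b}" using eq lohi(4) by simp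
        have c: "c \<in> {1..n}" and d: "d \<in> {1..n}" and cd_ne: "c \<noteq> d" using cd ab by (auto simp: doubleton_eq_iff)
        have add: "cyclic_rank n p q = cyclic_rank n p c + cyclic_rank n c q"
          by (rule cyclic_rank_add[OF p c q]) (use r in simp)
        have "cyclic_rank n p c \<noteq> 0"
          using inj_onD[OF cyclic_rank_inj[OF p], of c p] c p ne(3) by (auto simp: cyclic_rank_eq[OF p p])
        moreover have "cyclic_rank n p q < n" "cyclic_rank n c q < n" by (rule cyclic_rank_less[OF p], rule cyclic_rank_less[OF c])
        moreover have "\<mu> p = n + (n - cyclic_rank n p q)" "\<mu> c = n + (n - cyclic_rank n c q)"
          unfolding \<mu>_def Ip Ic using ne by (simp_all add: cyclic_rank_eq[OF p p] cyclic_rank_eq[OF c c])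
        ultimately have "\<mu> p < \<mu> c" using add by simp
        \<comment> \<open>The measure is symmetric in the two elements, so it does not matter which
          of a and b is the one exchanged for p.\<close>
        moreover have "\<mu> c + \<mu> d = s" using cd less.prems(4) by (auto simp: doubleton_eq_iff)
        ultimately have pd: "restrict (Pluecker {p, d}) O' \<in> generated_algebra O' G"
          by (intro less.IH[OF _ p d _ refl]) (use ne in auto)
        have cq: "restrict (Pluecker {c, q}) O' \<in> generated_algebra O' G"
          using generated_algebra.gen[OF neck_gen[OF c]] unfolding Ic .
        have pq: "restrict (\<lambda>V. inverse (Pluecker {p, q} V)) O' \<in> generated_algebra O' G"
          using generated_algebra.gen[OF neck_inv[OF p]] unfolding Ip .
        define e where "e = pair_sign c d * pair_sign p q * pair_sign p d * pair_sign c q"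
        have "(\<lambda>V\<in>O'. e * (\<lambda>V\<in>O'. (\<lambda>V\<in>O'. restrict (Pluecker {p, d}) O' V * restrict (Pluecker {c, q}) O' V) V *
            restrict (\<lambda>V. inverse (Pluecker {p, q} V)) O' V) V) \<in> generated_algebra O' G"
          by (intro generated_algebra_cmult generated_algebra.mult pd cq pq)
        also have "(\<lambda>V\<in>O'. e * (\<lambda>V\<in>O'. (\<lambda>V\<in>O'. restrict (Pluecker {p, d}) O' V * restrict (Pluecker {c, q}) O' V) V *
            restrict (\<lambda>V. inverse (Pluecker {p, q} V)) O' V) V) = restrict (Pluecker {a, b}) O'"
        proof (rule restrict_ext)
          fix V assume V: "V \<in> O'"
          have Gr: "V \<in> Gr_cone 2 n" using V unfolding O'_def open_positroid_variety_def positroid_variety_def by blast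
          have par: "Pluecker {p, c} V = 0"
            by (rule vanish[OF two_subset_mem[OF p c] parallel_not_in_positroid[OF p Ip c ne(3) r] V]) (use ne in auto)
          have nz: "Pluecker {p, q} V \<noteq> 0"
            using V p unfolding O'_def open_positroid_variety_def Ip[symmetric] by blast
          have "Pluecker {a, b} V = e * Pluecker {p, d} V * Pluecker {c, q} V * inverse (Pluecker {p, q} V)"
            unfolding cd[symmetric] e_def
            by (rule Pluecker_parallel[OF Gr c d p q cd_ne ne(2) _ ne(1) ne(3) par nz]) (use ne in auto)
          then show "e * (\<lambda>V\<in>O'. (\<lambda>V\<in>O'. restrict (Pluecker {p, d}) O' V * restrict (Pluecker {c, q}) O' V) V *
            restrict (\<lambda>V. inverse (Pluecker {p, q} V)) O' V) V = Pluecker {a, b} V"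
            unfolding restrict_apply'[OF V] by (simp only: mult.assoc)
        qed
        finally show ?thesis .
      qed
    qed
  qed
  show ?thesis by (rule main[OF ab refl])
qed

theorem proposition8p4:
  fixes n :: nat
    and B :: "(qpath \<Rightarrow> complex fls) set set"
    and \<I> :: "nat \<Rightarrow> nat set"
  assumes "2 < n"
    and "is_order 2 n B"
    and "rigid_C_module 2 n (as_C_module 2 n (regular_module (order_ring 2 n B)))"
    and "necklace_of_order 2 n B \<I>"
  shows "generated_algebra (open_positroid_variety 2 n \<I>)
           ({Pluecker I | I. I \<in> k_subsets 2 n \<and> rank_one_in_GP 2 n B I} \<union>
            {\<lambda>V. inverse (Pluecker J V) | J. J \<in> k_subsets 2 n \<and> rank_one_in_add 2 n B J})
         = coord_ring_open_positroid 2 n \<I>"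
proof -
  let ?G = "{Pluecker I | I. I \<in> k_subsets 2 n \<and> rank_one_in_GP 2 n B I} \<union>
    {\<lambda>V. inverse (Pluecker J V) | J. J \<in> k_subsets 2 n \<and> rank_one_in_add 2 n B J}"
  have neck: "grassmann_necklace 2 n \<I>"
    and iso: "lmod_iso (Calg 2 n) (as_C_module 2 n (regular_module (order_ring 2 n B)))
      (direct_sum_module {1..n} (\<lambda>i. rank_one_module n (\<I> i)))"
    using assms(4) unfolding necklace_of_order_def by blast+
  interpret r: rank_two_necklace n \<I> by unfold_locales (rule neck)
  interpret o: circle_order 2 n B by unfold_locales (use assms(1,2) in auto)
  have pb: "pulls_back 2 n (direct_sum_module {1..n} (\<lambda>i. rank_one_module n (\<I> i)))
      (direct_sum_module {1..n} (\<lambda>i. rank_one_rep n (\<I> i)))"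
    by (intro pulls_back_direct_sum pulls_back_rank_one r.neck_subset) (use assms(1) in auto)
  have car: "carrier (as_C_module 2 n o.Reg) = B"
    unfolding as_C_module_def restrict_scalars_simps o.Reg_simps ..
  have car': "carrier (direct_sum_module {1..n} (\<lambda>i. rank_one_module n (\<I> i))) =
      carrier (direct_sum_module {1..n} (\<lambda>i. rank_one_rep n (\<I> i)))"
    using pb unfolding pulls_back_def by blast
  \<comment> \<open>The isomorphism of C-modules given by the necklace, read over the path algebra,
    where the summands become \<open>rank_one_rep\<close> and no cosets are left.\<close>
  obtain \<Theta> where \<Theta>: "\<Theta> \<in> lmod_hom o.A (o.res o.Reg) (direct_sum_module {1..n} (\<lambda>i. rank_one_rep n (\<I> i)))"
      "bij_betw \<Theta> B (carrier (direct_sum_module {1..n} (\<lambda>i. rank_one_rep n (\<I> i))))"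
    using iso unfolding lmod_iso_def lmod_hom_pulls_back[OF pulls_back_as_C_module pb] car car' by (rule bexE)
  interpret m: necklace_order 2 n B \<I> \<Theta>
    by unfold_locales (rule r.neck_subset, assumption, rule \<Theta>(1), rule \<Theta>(2))
  have neck_gen: "Pluecker (\<I> i) \<in> ?G" if "i \<in> {1..n}" for i
    using m.necklace_module(1)[OF that] r.neck_subset[OF that] by blast
  have neck_inv: "(\<lambda>V. inverse (Pluecker (\<I> i) V)) \<in> ?G" if "i \<in> {1..n}" for i
    using m.necklace_module(2)[OF that] r.neck_subset[OF that] by blast
  have sep_gen: "Pluecker {a, b} \<in> ?G"
    if ab: "a \<in> {1..n}" "b \<in> {1..n}" "a < b" and J: "{a, b} \<in> positroid 2 n \<I>"
      and sep: "\<And>i. i \<in> {1..n} \<Longrightarrow> separated a b (\<I> i)" for a b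
  proof -
    obtain \<Phi> where \<Phi>: "rank_one_quotient 2 n B {a, b} \<Phi>" using m.positroid_quotient[OF J] by (rule exE)
    have ab': "1 \<le> a" "b \<le> n" using ab by auto
    have "rank_one_in_GP 2 n B {a, b}" by (rule m.in_GP_of_separated[OF refl ab'(1) ab(3) ab'(2) \<Phi> sep])
    moreover have "{a, b} \<in> k_subsets 2 n" using J by (simp add: positroid_def)
    ultimately show ?thesis by blast
  qed
  show ?thesis
  proof (rule generated_algebra_eq_coord_ring[OF r.neck_subset])
    fix g assume "g \<in> ?G"
    then show "(\<exists>I\<in>k_subsets 2 n. g = Pluecker I) \<or> (\<exists>J\<in>\<I> ` {1..n}. g = (\<lambda>V. inverse (Pluecker J V)))"
      using m.in_add_necklace assms(1) by auto
  next
    fix J assume "J \<in> \<I> ` {1..n}"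
    then show "(\<lambda>V. inverse (Pluecker J V)) \<in> ?G" using neck_inv by (elim imageE) simp
  next
    fix I assume I: "I \<in> k_subsets 2 n"
    then obtain a b where I': "I = {a, b}" "a \<noteq> b" by (auto simp: k_subsets_def card_2_iff)
    have ab: "a \<in> {1..n}" "b \<in> {1..n}" using I unfolding I' k_subsets_def by auto
    show "restrict (Pluecker I) (open_positroid_variety 2 n \<I>) \<in> generated_algebra (open_positroid_variety 2 n \<I>) ?G"
      unfolding I'(1) by (rule r.Pluecker_generated[OF neck_gen neck_inv sep_gen ab I'(2)])
  qed
qed

end
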